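(* Let $T_1,\dots,T_m:\mathbb{R}^d\to\mathbb{R}^d$ be non-singular linear maps with $\|T_i\|<1/2$ for all $1\le i\le m$, and let $(p_1,\dots,p_m)$ be a probability vector with all $p_i>0$. With $D$, $\tau$, $\mu^{\mathbf a}$ and $\tau(\mu^{\mathbf a},\cdot)$ as defined in the context: (1) For $\mathcal{L}^{md}$-a.e. $\mathbf a\in\mathbb{R}^{md}$ we have $\tau(\mu^{\mathbf a},q)=\tau(q)$ for all $q$ in the set $$[2,\ \sup\{t:\ D(t)/(t-1)\le1,\ \tau(t)\le1\}].$$ This set is a non-empty interval for instance if $\tau'(1+)\le1$, in which case it contains $[2,1+1/\tau'(1+)]$. Here $\tau'(1+)$ is the right derivative of $\tau$ at $1$. (2) If the $T_i$ are similitudes, then for $\mathcal{L}^{md}$-a.e. $\mathbf a\in\mathbb{R}^{md}$ we have $\tau(\mu^{\mathbf a},q)=\tau(q)$ for all $q\in[2,\max\{q:\tau(q)\le d\}]$.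
   Context: Here $d\ge1$, $m\ge2$; $\|\cdot\|$ is the Euclidean operator norm; $\mathcal{L}^{n}$ is $n$-dimensional Lebesgue measure; $B_r(x)$ is the closed Euclidean ball. An interval $[u,v]$ with $v<u$ is empty. For $\mathbf a=(a_1,\dots,a_m)\in\mathbb{R}^{md}$ (each $a_i\in\mathbb{R}^d$), $\mu^{\mathbf a}$ is the self-affine measure of the IFS $\{S_i=T_i+a_i\}_{i=1}^m$ and $(p_1,\dots,p_m)$, i.e. the unique Borel probability measure on $\mathbb{R}^d$ with $\mu^{\mathbf a}=\sum_{i=1}^m p_i\,\mu^{\mathbf a}\circ S_i^{-1}$. For a non-singular linear map $T$ with singular values $\alpha_1\ge\dots\ge\alpha_d>0$, the singular value function is $\phi^0(T)=1$, $\phi^s(T)=\alpha_1\cdots\alpha_{k-1}\alpha_k^{s-k+1}$ if $k-1<s\le k\le d$ ($k$ a positive integer), and $\phi^s(T)=(\alpha_1\cdots\alpha_d)^{s/d}$ if $s\ge d$. For $k\in\mathbb{N}$, $\Sigma_k=\{1,\dots,m\}^k$; for $I=i_1\dots i_k$, $T_I=T_{i_1}\circ\dots\circ T_{i_k}$ and $p_I=p_{i_1}\cdots p_{i_k}$. Define $D(1)=0$, $$D(q)=(q-1)\inf\Big\{s\ge0:\sum_{k=1}^\infty\sum_{I\in\Sigma_k}(\phi^s(T_I))^{1-q}p_I^q<\infty\Big\}\quad(0\le q<1),$$ $$D(q)=(q-1)\sup\Big\{s\ge0:\sum_{k=1}^\infty\sum_{I\in\Sigma_k}(\phi^s(T_I))^{1-q}p_I^q<\infty\Big\}\quad(q>1),$$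 and $\tau(q)=(q-1)\min\{D(q)/(q-1),d\}$ for $q\neq1$, $\tau(1)=0$. For a compactly supported Borel probability measure $\mu$ on $\mathbb{R}^d$, the $L^q$-spectrum is $$\tau(\mu,q)=\liminf_{r\to0}\frac{\log\sup\sum_j\mu(B_r(x_j))^q}{\log r},$$ the supremum being over all families of disjoint balls $\{B_r(x_j)\}_j$ of radius $r$ with centers $x_j\in\mathrm{supp}(\mu)$.
   Formalization: When d=1 and τ'(1+)=1, the claim that the set is non-empty and contains [2,1+1/τ'(1+)] also assumes D(2)≤1; without it the claim fails (three maps x↦0.49x+a_i, p_i=1/3: D(t)/(t-1)>1 for all t≠1, so the set is empty). *)

theory Defs
  imports "HOL-Probability.Probability"
begin

text \<open>The singular values in decreasing order: the square roots of the eigenvalues of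
  \<open>adjoint T \<circ> T\<close>, each repeated as often as the dimension of its eigenspace. The list
  exists, and is unique, for every linear \<open>T\<close>, by the spectral theorem.\<close>

definition singular_values :: "('a::euclidean_space \<Rightarrow> 'a) \<Rightarrow> real list" where
  "singular_values T = (THE xs. length xs = DIM('a) \<and> sorted_wrt (\<ge>) xs \<and> (\<forall>\<sigma>\<in>set xs. 0 \<le> \<sigma>) \<and>
     (\<forall>\<sigma>\<ge>0. count_list xs \<sigma> = dim {v. adjoint T (T v) = \<sigma>\<^sup>2 *\<^sub>R v}))"

text \<open>Lists are indexed from 0, so \<open>\<alpha> ! (k - 1)\<close> is the \<open>k\<close>-th largest singular value;
  \<open>k = \<lceil>s\<rceil>\<close> is the integer with \<open>k - 1 < s \<le> k\<close>.\<close>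

definition sv_function :: "real \<Rightarrow> ('a::euclidean_space \<Rightarrow> 'a) \<Rightarrow> real" where
  "sv_function s T =
    (let \<alpha> = singular_values T; k = nat \<lceil>s\<rceil> in
     if s = 0 then 1
     else if s \<ge> real DIM('a) then prod_list \<alpha> powr (s / real DIM('a))
     else prod_list (take (k - 1) \<alpha>) * (\<alpha> ! (k - 1)) powr (s - real k + 1))"

definition word_map :: "('m \<Rightarrow> 'a \<Rightarrow> 'a) \<Rightarrow> 'm list \<Rightarrow> 'a \<Rightarrow> 'a" where
  "word_map T I = foldr (\<lambda>i f. T i \<circ> f) I id"

definition word_prob :: "('m \<Rightarrow> real) \<Rightarrow> 'm list \<Rightarrow> real" where
  "word_prob p I = prod_list (map p I)"

text \<open>The exponents \<open>s \<ge> 0\<close> for which the (nonnegative) double series over \<open>k \<ge> 1\<close> and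
  over all words of length \<open>k\<close> is finite; the summation index is shifted by one.\<close>

definition convergence_exponents ::
  "('m::finite \<Rightarrow> 'a::euclidean_space \<Rightarrow> 'a) \<Rightarrow> ('m \<Rightarrow> real) \<Rightarrow> real \<Rightarrow> real set" where
  "convergence_exponents T p q = {s. 0 \<le> s \<and>
     summable (\<lambda>k. \<Sum>I | length I = Suc k.
       sv_function s (word_map T I) powr (1 - q) * word_prob p I powr q)}"

text \<open>Only meaningful for \<open>q \<ge> 0\<close>.\<close>

definition D_fun ::
  "('m::finite \<Rightarrow> 'a::euclidean_space \<Rightarrow> 'a) \<Rightarrow> ('m \<Rightarrow> real) \<Rightarrow> real \<Rightarrow> real" where
  "D_fun T p q =
    (if q = 1 then 0
     else if q < 1 then (q - 1) * Inf (convergence_exponents T p q)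
     else (q - 1) * Sup (convergence_exponents T p q))"

definition tau_fun ::
  "('m::finite \<Rightarrow> 'a::euclidean_space \<Rightarrow> 'a) \<Rightarrow> ('m \<Rightarrow> real) \<Rightarrow> real \<Rightarrow> real" where
  "tau_fun T p q =
    (if q = 1 then 0 else (q - 1) * min (D_fun T p q / (q - 1)) (real DIM('a)))"

definition self_affine_measure ::
  "('m::finite \<Rightarrow> 'a::euclidean_space \<Rightarrow> 'a) \<Rightarrow> ('m \<Rightarrow> real) \<Rightarrow> 'a ^ 'm \<Rightarrow> 'a measure" where
  "self_affine_measure T p a = (THE \<mu>. sets \<mu> = sets borel \<and> prob_space \<mu> \<and>
     (\<forall>A\<in>sets borel. measure \<mu> A =
        (\<Sum>i\<in>UNIV. p i * measure \<mu> ((\<lambda>x. T i x + a $ i) -` A))))"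

definition measure_support :: "'a::topological_space measure \<Rightarrow> 'a set" where
  "measure_support \<mu> = {x. \<forall>U. open U \<longrightarrow> x \<in> U \<longrightarrow> 0 < emeasure \<mu> U}"

text \<open>Sets of centres of disjoint balls. If the support is compact and \<open>r > 0\<close>, every such
  set is automatically finite.\<close>

definition ball_packings :: "'a::metric_space measure \<Rightarrow> real \<Rightarrow> 'a set set" where
  "ball_packings \<mu> r =
    {X. finite X \<and> X \<subseteq> measure_support \<mu> \<and> disjoint_family_on (\<lambda>x. cball x r) X}"

definition Lq_spectrum :: "'a::euclidean_space measure \<Rightarrow> real \<Rightarrow> ereal" where
  "Lq_spectrum \<mu> q = Liminf (at_right 0) (\<lambda>r. ereal
     (ln (SUP X\<in>ball_packings \<mu> r. \<Sum>x\<in>X. measure \<mu> (cball x r) powr q) / ln r))"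

definition similitude :: "('a::metric_space \<Rightarrow> 'a) \<Rightarrow> bool" where
  "similitude f \<longleftrightarrow> (\<exists>c>0. \<forall>x y. dist (f x) (f y) = c * dist x y)"

text \<open>The interval from 2 to \<open>sup {t. D(t)/(t-1) \<le> 1, \<tau>(t) \<le> 1}\<close>. The supremum is taken in the
  extended reals, so that it is \<open>-\<infinity>\<close>, and the interval empty, when no such \<open>t\<close> exists. The
  point \<open>t = 1\<close>, where the quotient is undefined, is left out. Here \<open>D(t)/(t-1)\<close> is not capped by the dimension,
  unlike \<open>\<tau>(t)/(t-1)\<close>: in dimension 1 the right derivative of \<open>\<tau>\<close> at 1 is always at most 1, yet
  the interval is empty when \<open>D(t)/(t-1) > 1\<close> for all \<open>t\<close> (three copies of \<open>x \<mapsto> 0.49 x\<close> with equal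
  probabilities). So \<open>\<tau>'(1+) \<le> 1\<close> yields a nonempty interval in dimension 1 only if the borderline
  \<open>\<tau>'(1+) = 1\<close> comes with \<open>D(2) \<le> 1\<close>.\<close>

definition q_interval ::
  "('m::finite \<Rightarrow> 'a::euclidean_space \<Rightarrow> 'a) \<Rightarrow> ('m \<Rightarrow> real) \<Rightarrow> real set" where
  "q_interval T p = {q. 2 \<le> q \<and> ereal q \<le>
     (SUP t\<in>{t. 0 \<le> t \<and> t \<noteq> 1 \<and> D_fun T p t / (t - 1) \<le> 1 \<and> tau_fun T p t \<le> 1}. ereal t)}"

end

(*
  Lower bound. A point of the support is coded by a word, and the q-th packing sum of \<mu>\<^sup>a is
  comparable to the energy J(r) = integral of \<mu>\<^sup>a(B(x,r))^(q-1). Writing this as a double integral over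
  words and sorting pairs of words by their common prefix I, the part of mass p_I contributes at most
  p_I^(q-2) (as q \<ge> 2) times the measure of the pairs that are r-close. Averaging over a bounds the latter by
  (r/||T_I||)^\<sigma> for \<sigma> \<le> D, with D = 1 always and D = d for similitudes. With \<sigma> = (q-1)s this
  is r^\<sigma> ||T_I||^(-(q-1)s), and ||T_I||^s = \<phi>^s(T_I) because s \<le> 1 (or because T_I is a similitude), so
  the sum over I is the defining series of D(q) and E J(r) \<le> C r^\<sigma> up to a logarithm.

  Upper bound. If J(r) \<le> C r^t with t > \<tau>(q), then the mass of a cylinder is at most the \<mu>\<^sup>a-measure of a
  ball of its diameter, so the terms of the defining series decay geometrically at s = D(q)/(q-1); then the
  series converges slightly beyond s, which is absurd.
*)
theory Submission
  imports Defs "HOL-Real_Asymp.Real_Asymp"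
begin

text \<open>The delicate point is a single null set for all q. Averaging gives, for one q and one s
  < tau(q), almost sure decay of the energy at rate s; it is applied to rational q and s only. A
  real q is served by a rational q' <= q: the energy decreases in q, so decay passes from q' to q,
  and tau(q') >= (q'-1)/(q-1) tau(q) keeps tau(q') above any given rate below tau(q). The constraint
  tau <= D descends to q' because tau is nondecreasing, which rests on the concavity of s -> ln
  phi^s on [0,d]. The supremum in D(q), q > 1, is used in one form: s < D(q)/(q-1) iff the level
  sums of the series decay geometrically. The reason is that raising s by eps changes phi^s on words
  of length n by a factor between c1^(eps n) and c2^(eps n), with c1, c2 in (0,1). The upper bound
  must also see the cap d in tau. A bounded support is covered by about r^-d balls, so no energy
  decays faster than r^(d(q-1)); a rate above tau(q) therefore forces D(q)/(q-1) < d, and only then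
  does the series enter.\<close>

section \<open>Singular values\<close>

text \<open>A maximiser e of the quadratic form x . A x on the unit sphere of V is an eigenvector:
  otherwise moving along the line of the residual w = l e - A e, which lies in V by invariance,
  would violate maximality to first order.\<close>

lemma selfadjoint_eigenvector:
  fixes A :: "'a::euclidean_space \<Rightarrow> 'a"
  assumes A: "linear A" "\<And>x y. A x \<bullet> y = x \<bullet> A y" and V: "subspace V" "\<And>x. x \<in> V \<Longrightarrow> A x \<in> V"
    and "V \<noteq> {0}"
  obtains e l where "e \<in> V" "norm e = 1" "A e = l *\<^sub>R e"
proof -
  interpret A: linear A by fact
  obtain x where x: "x \<in> V" "x \<noteq> 0" using \<open>V \<noteq> {0}\<close> V(1) subspace_0 by blast
  have ne: "V \<inter> sphere 0 1 \<noteq> {}"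
  proof -
    have "(1 / norm x) *\<^sub>R x \<in> V \<inter> sphere 0 1" using x V(1) by (simp add: subspace_scale)
    then show ?thesis by blast
  qed
  have "compact (V \<inter> sphere 0 1)" using closed_subspace[OF V(1)] by (simp add: closed_Int_compact)
  moreover have "continuous_on (V \<inter> sphere 0 1) (\<lambda>x. x \<bullet> A x)"
    by (intro continuous_intros linear_continuous_on linear_conv_bounded_linear[THEN iffD1] A)
  ultimately obtain e where e: "e \<in> V" "norm e = 1" and emax: "\<And>y. y \<in> V \<Longrightarrow> norm y = 1 \<Longrightarrow> y \<bullet> A y \<le> e \<bullet> A e"
    using continuous_attains_sup[OF _ ne, of "\<lambda>x. x \<bullet> A x"] by fastforce
  define l where "l = e \<bullet> A e"
  have Q: "y \<bullet> A y \<le> l * (y \<bullet> y)" if "y \<in> V" for y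
  proof (cases "y = 0")
    case True then show ?thesis by (simp add: A.zero)
  next
    case False
    let ?y = "(1 / norm y) *\<^sub>R y"
    have "?y \<bullet> A ?y \<le> l" using that False V(1) unfolding l_def by (intro emax) (auto simp: subspace_scale)
    then have "(y \<bullet> A y) / (norm y)\<^sup>2 \<le> l" by (simp add: A.scaleR power2_eq_square)
    then show ?thesis using False by (simp add: divide_le_eq power2_norm_eq_inner)
  qed
  have "l *\<^sub>R e - A e = 0"
  proof -
    define w where "w = l *\<^sub>R e - A e"
    have w: "w \<in> V" unfolding w_def using e V by (simp add: subspace_diff subspace_scale)
    have ee: "e \<bullet> e = 1" using e by (simp add: norm_eq_1)
    define b where "b = l * (w \<bullet> w) - w \<bullet> A w"
    have bnn: "0 \<le> b" using Q[OF w] by (simp add: b_def)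
    have "0 \<le> 2 * t * (w \<bullet> w) + t\<^sup>2 * b" for t :: real
    proof -
      have "e + t *\<^sub>R w \<in> V" using e w V by (simp add: subspace_add subspace_scale)
      from Q[OF this] have "0 \<le> l * ((e + t *\<^sub>R w) \<bullet> (e + t *\<^sub>R w)) - (e + t *\<^sub>R w) \<bullet> A (e + t *\<^sub>R w)" by simp
      also have "\<dots> = (l * (e \<bullet> e) - e \<bullet> A e) + t * (2 * l * (e \<bullet> w) - e \<bullet> A w - w \<bullet> A e) + t\<^sup>2 * b"
        by (simp add: A.add A.scaleR inner_add algebra_simps b_def power2_eq_square inner_commute[of w e])
      also have "e \<bullet> A w = A e \<bullet> w" by (simp add: A(2))
      also have "l * (e \<bullet> e) - e \<bullet> A e = 0" using ee by (simp add: l_def)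
      also have "2 * l * (e \<bullet> w) - A e \<bullet> w - w \<bullet> A e = 2 * (w \<bullet> w)"
      proof -
        have "w \<bullet> w = w \<bullet> (l *\<^sub>R e - A e)" by (simp add: w_def)
        then show ?thesis by (simp add: inner_diff_right inner_commute algebra_simps)
      qed
      finally show ?thesis by (simp add: algebra_simps)
    qed
    \<comment> \<open>Up to the \<open>+ 1\<close>, this t minimises the quadratic 2 t |w|^2 + t^2
      b; the \<open>+ 1\<close> covers b = 0.\<close>
    from this[of "- (w \<bullet> w) / (b + 1)"] have "w \<bullet> w = 0"
    proof -
      assume h: "0 \<le> 2 * (- (w \<bullet> w) / (b + 1)) * (w \<bullet> w) + (- (w \<bullet> w) / (b + 1))\<^sup>2 * b"
      have "(- (w \<bullet> w) / (b + 1))\<^sup>2 * b = (w \<bullet> w)\<^sup>2 / (b + 1) * (b / (b+1))"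
        by (simp add: power2_eq_square)
      also have "\<dots> \<le> (w \<bullet> w)\<^sup>2 / (b + 1) * 1" using bnn by (intro mult_left_mono) auto
      finally have "0 \<le> - (w \<bullet> w)\<^sup>2 / (b + 1)" using h by (simp add: power2_eq_square)
      then have "(w \<bullet> w)\<^sup>2 / (b + 1) \<le> 0" by simp
      then have "(w \<bullet> w)\<^sup>2 \<le> 0" using bnn by (auto simp: divide_le_0_iff)
      then show ?thesis by simp
    qed
    then show ?thesis by (simp add: w_def)
  qed
  then show ?thesis using that[OF e, of l] by simp
qed

text \<open>Induction on the dimension: the orthogonal complement in V of an eigenvector is again
  invariant because A is self-adjoint.\<close>

lemma selfadjoint_eigenbasis:
  fixes A :: "'a::euclidean_space \<Rightarrow> 'a"
  assumes A: "linear A" "\<And>x y. A x \<bullet> y = x \<bullet> A y"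
    and V: "subspace V" "\<And>x. x \<in> V \<Longrightarrow> A x \<in> V"
  shows "\<exists>B. B \<subseteq> V \<and> finite B \<and> pairwise orthogonal B \<and> (\<forall>b\<in>B. norm b = 1 \<and> (\<exists>l. A b = l *\<^sub>R b)) \<and> span B = V"
  using V
proof (induction "dim V" arbitrary: V rule: less_induct)
  case (less V)
  show ?case
  proof (cases "V = {0}")
    case True then show ?thesis by (intro exI[of _ "{}"]) auto
  next
    case False
    interpret A: linear A by fact
    from selfadjoint_eigenvector[OF A less.prems False]
    obtain e l where e: "e \<in> V" "norm e = 1" "A e = l *\<^sub>R e" by blast
    define W where "W = {v \<in> V. orthogonal e v}"
    have subW: "subspace W" unfolding W_def
      using subspace_inter[OF less.prems(1) subspace_orthogonal_to_vector[of e]] by (simp add: Int_def)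
    have AW: "A x \<in> W" if "x \<in> W" for x
      using that less.prems(2) A(2)[of e x] e by (auto simp: W_def orthogonal_def)
    have "W \<subseteq> V" by (auto simp: W_def)
    moreover have "e \<notin> W" using e by (auto simp: W_def orthogonal_def)
    ultimately have "W \<subset> V" using e by auto
    then have "dim W < dim V" using subW less.prems(1) by (metis dim_psubset span_eq_iff)
    from less.hyps[OF this subW AW] obtain B where
      B: "B \<subseteq> W" "finite B" "pairwise orthogonal B" "\<forall>b\<in>B. norm b = 1 \<and> (\<exists>l. A b = l *\<^sub>R b)" "span B = W" by blast
    show ?thesis
    proof (intro exI[of _ "insert e B"] conjI)
      show "insert e B \<subseteq> V" using e B \<open>W \<subseteq> V\<close> by auto
      show "finite (insert e B)" using B by auto
      show "pairwise orthogonal (insert e B)" using B(1,3)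
        by (auto simp: pairwise_insert W_def orthogonal_commute)
      show "\<forall>b\<in>insert e B. norm b = 1 \<and> (\<exists>l. A b = l *\<^sub>R b)" using B(4) e by auto
      show "span (insert e B) = V"
      proof
        show "span (insert e B) \<subseteq> V" using \<open>insert e B \<subseteq> V\<close> less.prems(1) by (metis span_mono span_eq_iff)
        show "V \<subseteq> span (insert e B)"
        proof
          fix v assume v: "v \<in> V"
          have "v - (v \<bullet> e) *\<^sub>R e \<in> W" using v e less.prems(1)
            by (auto simp: W_def orthogonal_def subspace_diff subspace_scale inner_diff_right norm_eq_1 inner_commute)
          then show "v \<in> span (insert e B)" using B(5) by (auto simp: span_insert)
        qed
      qed
    qed
  qed
qed

lemma adjoint_comp_selfadjoint:
  fixes T :: "'a::euclidean_space \<Rightarrow> 'a"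
  assumes "linear T"
  shows "linear (\<lambda>v. adjoint T (T v))" "adjoint T (T x) \<bullet> y = x \<bullet> adjoint T (T y)" "adjoint T (T x) \<bullet> x = (norm (T x))\<^sup>2"
  using linear_compose[OF assms adjoint_linear[OF assms]] assms
  by (simp_all add: o_def adjoint_clauses power2_norm_eq_inner)

text \<open>Pairing with b shows that the eigenvalue of a unit eigenvector b is |T b|^2. Singular
  values thus become the lengths of the images of one orthonormal basis, counted with
  multiplicity.\<close>

lemma adjoint_comp_eigenbasis:
  fixes T :: "'a::euclidean_space \<Rightarrow> 'a"
  assumes "linear T"
  obtains B where "finite B" "card B = DIM('a)" "\<And>b. b \<in> B \<Longrightarrow> norm b = 1" "independent B" "span B = UNIV"
    "\<And>b b'. b \<in> B \<Longrightarrow> b' \<in> B \<Longrightarrow> b \<noteq> b' \<Longrightarrow> b \<bullet> b' = 0"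
    "\<And>b. b \<in> B \<Longrightarrow> adjoint T (T b) = (norm (T b))\<^sup>2 *\<^sub>R b"
proof -
  note T = adjoint_comp_selfadjoint[OF assms]
  from selfadjoint_eigenbasis[OF T(1,2), of UNIV] obtain B where
    B: "finite B" "pairwise orthogonal B" "\<And>b. b \<in> B \<Longrightarrow> norm b = 1" "\<And>b. b \<in> B \<Longrightarrow> \<exists>l. adjoint T (T b) = l *\<^sub>R b" "span B = UNIV"
    by auto
  have "0 \<notin> B" using B(3) by fastforce
  then have ind: "independent B" using B(2) pairwise_orthogonal_independent by blast
  have card: "card B = DIM('a)" using dim_eq_card_independent[OF ind] dim_span[of B] B(5) by simp
  have ev: "adjoint T (T b) = (norm (T b))\<^sup>2 *\<^sub>R b" if b: "b \<in> B" for b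
  proof -
    obtain l where l: "adjoint T (T b) = l *\<^sub>R b" using B(4)[OF b] by blast
    then have "(norm (T b))\<^sup>2 = l" using T(3)[of b] B(3)[OF b] by (simp add: norm_eq_1)
    then show ?thesis using l by simp
  qed
  have orth: "b \<bullet> b' = 0" if "b \<in> B" "b' \<in> B" "b \<noteq> b'" for b b'
    using B(2) that by (auto simp: pairwise_def orthogonal_def)
  show ?thesis using that[OF B(1) card B(3) ind B(5) orth ev] by blast
qed

text \<open>By Parseval the operator norm is attained at the eigenbasis vector with the longest
  image. The vector itself is kept, since transversality later shifts the translations along
  it.\<close>

lemma onorm_eigenvector:
  fixes T :: "'a::euclidean_space \<Rightarrow> 'a"
  assumes T: "linear T"
  obtains e where "norm e = 1" "adjoint T (T e) = (onorm T)\<^sup>2 *\<^sub>R e" "norm (T e) = onorm T"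
proof -
  from adjoint_comp_eigenbasis[OF T] obtain B where B: "finite B" "card B = DIM('a)" "\<And>b. b \<in> B \<Longrightarrow> norm b = 1" "independent B" "span B = UNIV"
    "\<And>b b'. b \<in> B \<Longrightarrow> b' \<in> B \<Longrightarrow> b \<noteq> b' \<Longrightarrow> b \<bullet> b' = 0"
    "\<And>b. b \<in> B \<Longrightarrow> adjoint T (T b) = (norm (T b))\<^sup>2 *\<^sub>R b" by blast
  have "B \<noteq> {}" using B(1,2) by auto
  then obtain e where e: "e \<in> B" and emax: "\<And>b. b \<in> B \<Longrightarrow> norm (T b) \<le> norm (T e)"
    using Max_in[of "(\<lambda>b. norm (T b)) ` B"] Max_ge[of "(\<lambda>b. norm (T b)) ` B"] B(1) by fastforce
  have bl: "bounded_linear T" using T linear_conv_bounded_linear by blast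
  have "norm (T v) \<le> norm (T e) * norm v" for v
  proof -
    have "v \<in> span B" using B(5) by simp
    then obtain u where u: "v = (\<Sum>b\<in>B. u b *\<^sub>R b)" using span_finite[OF B(1)] by auto
    have in1: "(\<Sum>b\<in>B. u b *\<^sub>R b) \<bullet> (\<Sum>b\<in>B. (w b * u b) *\<^sub>R b) = (\<Sum>b\<in>B. w b * (u b)\<^sup>2)" for w
    proof -
      have "(\<Sum>b\<in>B. u b *\<^sub>R b) \<bullet> (\<Sum>b\<in>B. (w b * u b) *\<^sub>R b) = (\<Sum>b\<in>B. \<Sum>b'\<in>B. (if b' = b then w b * (u b)\<^sup>2 else 0))"
        unfolding inner_sum_left inner_sum_right using B(3,6)
        by (intro sum.cong refl) (auto simp: power2_eq_square norm_eq_1)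
      then show ?thesis using B(1) by simp
    qed
    have "adjoint T (T v) = (\<Sum>b\<in>B. ((norm (T b))\<^sup>2 * u b) *\<^sub>R b)"
      unfolding u using linear_sum[OF adjoint_comp_selfadjoint(1)[OF T], of "\<lambda>b. u b *\<^sub>R b" B]
        linear_scale[OF adjoint_comp_selfadjoint(1)[OF T]] B(7) by (simp add: mult.commute)
    then have "(norm (T v))\<^sup>2 = (\<Sum>b\<in>B. (norm (T b))\<^sup>2 * (u b)\<^sup>2)"
      using adjoint_comp_selfadjoint(3)[OF T, of v] in1[of "\<lambda>b. (norm (T b))\<^sup>2"] u by (simp add: inner_commute)
    also have "\<dots> \<le> (\<Sum>b\<in>B. (norm (T e))\<^sup>2 * (u b)\<^sup>2)"
      by (intro sum_mono mult_right_mono power_mono emax) auto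
    also have "\<dots> = (norm (T e))\<^sup>2 * (v \<bullet> v)" using in1[of "\<lambda>b. 1"] u by (simp add: sum_distrib_left)
    also have "\<dots> = (norm (T e) * norm v)\<^sup>2" by (simp only: power_mult_distrib power2_norm_eq_inner)
    finally show ?thesis by (rule power2_le_imp_le) simp
  qed
  then have "onorm T \<le> norm (T e)" by (intro onorm_bound) auto
  moreover have "norm (T e) \<le> onorm T" using onorm[OF bl, of e] B(3)[OF e] by simp
  ultimately have "norm (T e) = onorm T" by simp
  then show ?thesis using that[of e] B(3,7)[OF e] by simp
qed

section \<open>Existence, uniqueness and range of the list of singular values\<close>

abbreviation is_singular_values :: "('a::euclidean_space \<Rightarrow> 'a) \<Rightarrow> real list \<Rightarrow> bool" where
  "is_singular_values T xs \<equiv> length xs = DIM('a) \<and> sorted_wrt (\<ge>) xs \<and> (\<forall>\<sigma>\<in>set xs. 0 \<le> \<sigma>) \<and>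
     (\<forall>\<sigma>\<ge>0. count_list xs \<sigma> = dim {v. adjoint T (T v) = \<sigma>\<^sup>2 *\<^sub>R v})"

text \<open>The prescribed counts fix the multiset and the sorting fixes the list. At negative
  numbers no count is prescribed; there nonnegativity of the entries makes it 0.\<close>

lemma is_singular_values_unique:
  assumes "is_singular_values T xs" "is_singular_values T ys"
  shows "xs = ys"
proof -
  have c: "count_list xs s = count_list ys s" for s
  proof (cases "0 \<le> s")
    case False
    then have "s \<notin> set xs" "s \<notin> set ys" using assms by auto
    then show ?thesis by (simp add: count_list_0_iff)
  qed (use assms in auto)
  then have m: "mset xs = mset ys"
    by (intro multiset_eqI) (simp add: count_mset)
  have "sorted (rev xs)" "sorted (rev ys)" using assms by (auto simp: sorted_wrt_rev)
  moreover have "mset (rev ys) = mset (rev xs)" using m by simp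
  ultimately have "sort (rev xs) = rev xs" "sort (rev xs) = rev ys" by (auto intro: sorted_sort_id properties_for_sort)
  then show ?thesis by simp
qed

lemma singular_values_exist:
  fixes T :: "'a::euclidean_space \<Rightarrow> 'a"
  assumes T: "linear T"
  shows "\<exists>xs. is_singular_values T xs"
proof -
  from adjoint_comp_eigenbasis[OF T] obtain B where B: "finite B" "card B = DIM('a)" "\<And>b. b \<in> B \<Longrightarrow> norm b = 1" "independent B" "span B = UNIV"
    "\<And>b b'. b \<in> B \<Longrightarrow> b' \<in> B \<Longrightarrow> b \<noteq> b' \<Longrightarrow> b \<bullet> b' = 0"
    "\<And>b. b \<in> B \<Longrightarrow> adjoint T (T b) = (norm (T b))\<^sup>2 *\<^sub>R b" by blast
  define M where "M = image_mset (\<lambda>b. norm (T b)) (mset_set B)"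
  define xs where "xs = rev (sorted_list_of_multiset M)"
  have m: "mset xs = M" by (simp add: xs_def)
  have "length xs = DIM('a)" using arg_cong[OF m, of size] B(2) by (simp add: M_def)
  moreover have "sorted_wrt (\<ge>) xs" by (simp add: xs_def sorted_wrt_rev)
  moreover have "\<forall>\<sigma>\<in>set xs. 0 \<le> \<sigma>"
  proof -
    have "set xs = set_mset M" using arg_cong[OF m, of set_mset] by simp
    then show ?thesis by (auto simp: M_def)
  qed
  moreover have "count_list xs s = dim {v. adjoint T (T v) = s\<^sup>2 *\<^sub>R v}" if s: "0 \<le> s" for s
  proof -
    define C where "C = {b\<in>B. norm (T b) = s}"
    have "count_list xs s = count M s" by (simp add: m[symmetric] count_mset)
    also have "\<dots> = card C" using B(1) unfolding M_def C_def
      by (simp add: count_image_mset vimage_def Int_def conj_commute)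
    also have "\<dots> = dim {v. adjoint T (T v) = s\<^sup>2 *\<^sub>R v}"
    proof (rule dim_unique[symmetric])
      show "C \<subseteq> {v. adjoint T (T v) = s\<^sup>2 *\<^sub>R v}" using B(7) by (auto simp: C_def)
      show "independent C" using B(4) by (rule independent_mono) (auto simp: C_def)
      show "{v. adjoint T (T v) = s\<^sup>2 *\<^sub>R v} \<subseteq> span C"
      proof
        fix v assume "v \<in> {v. adjoint T (T v) = s\<^sup>2 *\<^sub>R v}"
        then have v: "adjoint T (T v) = s\<^sup>2 *\<^sub>R v" by simp
        have "v \<in> span B" using B(5) by simp
        then obtain u where u: "v = (\<Sum>b\<in>B. u b *\<^sub>R b)" using span_finite[OF B(1)] by auto
        have ip: "v \<bullet> b = u b" if "b \<in> B" for b
        proof -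
          have "v \<bullet> b = (\<Sum>b'\<in>B. if b' = b then u b else 0)" unfolding u inner_sum_left
            using B(3,6) that by (intro sum.cong refl) (auto simp: norm_eq_1)
          then show ?thesis using B(1) that by simp
        qed
        \<comment> \<open>Eigenvectors for different eigenvalues are orthogonal, so v has no
          component along basis vectors outside C.\<close>
        have z: "u b = 0" if b: "b \<in> B" "b \<notin> C" for b
        proof -
          have "s\<^sup>2 * u b = adjoint T (T v) \<bullet> b" using v ip b by simp
          also have "\<dots> = v \<bullet> adjoint T (T b)" using adjoint_comp_selfadjoint(2)[OF T] by simp
          also have "\<dots> = (norm (T b))\<^sup>2 * u b" using B(7) ip b by simp
          finally have "(s\<^sup>2 - (norm (T b))\<^sup>2) * u b = 0" by (simp add: algebra_simps)
          moreover have "s\<^sup>2 \<noteq> (norm (T b))\<^sup>2" using b s by (auto simp: C_def power2_eq_iff_nonneg)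
          ultimately show ?thesis by simp
        qed
        have "v = (\<Sum>b\<in>C. u b *\<^sub>R b)" unfolding u
          using B(1) z by (intro sum.mono_neutral_right) (auto simp: C_def)
        then show "v \<in> span C" by (simp add: span_sum span_base span_scale)
      qed
    qed simp
    finally show ?thesis .
  qed
  ultimately show ?thesis by blast
qed

lemma singular_values_props:
  fixes T :: "'a::euclidean_space \<Rightarrow> 'a"
  assumes T: "linear T"
  shows "is_singular_values T (singular_values T)"
  unfolding singular_values_def
  using singular_values_exist[OF T] is_singular_values_unique[where T = T]
  by (intro theI'[of "is_singular_values T"]) blast

text \<open>A listed number has positive count, hence a nonzero eigenspace, and so occurs as |T v|
  for a unit vector; bounds on the singular values follow from bounds on |T v|.\<close>

lemma singular_value_eigenvector:
  fixes T :: "'a::euclidean_space \<Rightarrow> 'a"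
  assumes T: "linear T" and s: "s \<in> set (singular_values T)"
  obtains v where "norm v = 1" "norm (T v) = s"
proof -
  note sv = singular_values_props[OF T]
  have s0: "0 \<le> s" using sv s by auto
  then have "dim {v. adjoint T (T v) = s\<^sup>2 *\<^sub>R v} > 0" using sv s count_list_0_iff[of "singular_values T" s] by auto
  then have "\<not> {v. adjoint T (T v) = s\<^sup>2 *\<^sub>R v} \<subseteq> {0}" using dim_eq_0 by (metis less_numeral_extra(3))
  then obtain v where v: "adjoint T (T v) = s\<^sup>2 *\<^sub>R v" "v \<noteq> 0" by auto
  have "(norm (T v))\<^sup>2 = (s * norm v)\<^sup>2"
    using adjoint_comp_selfadjoint(3)[OF T, of v] v(1) by (simp add: power_mult_distrib power2_norm_eq_inner)
  then have n: "norm (T v) = s * norm v" using s0 by (simp add: power2_eq_iff_nonneg)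
  show ?thesis
    using that[of "(1 / norm v) *\<^sub>R v"] v(2) n linear_scale[OF T] by simp
qed

lemma singular_values_bounds:
  fixes T :: "'a::euclidean_space \<Rightarrow> 'a"
  assumes T: "linear T" and s: "s \<in> set (singular_values T)"
  shows "s \<le> onorm T" "(\<And>v. c * norm v \<le> norm (T v)) \<Longrightarrow> c \<le> s"
proof -
  obtain v where v: "norm v = 1" "norm (T v) = s" using singular_value_eigenvector[OF T s] .
  have "bounded_linear T" using T linear_conv_bounded_linear by blast
  then show "s \<le> onorm T" using v onorm[of T v] by simp
  show "c \<le> s" if "\<And>v. c * norm v \<le> norm (T v)" using that[of v] v by simp
qed

lemma singular_values_hd:
  fixes T :: "'a::euclidean_space \<Rightarrow> 'a"
  assumes T: "linear T"
  shows "singular_values T ! 0 = onorm T"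
proof -
  note sv = singular_values_props[OF T]
  have bl: "bounded_linear T" using T linear_conv_bounded_linear by blast
  obtain e where e: "norm e = 1" "adjoint T (T e) = (onorm T)\<^sup>2 *\<^sub>R e" using onorm_eigenvector[OF T] .
  have "e \<noteq> 0" using e by auto
  then have "\<not> {v. adjoint T (T v) = (onorm T)\<^sup>2 *\<^sub>R v} \<subseteq> {0}" using e by auto
  then have "0 < dim {v. adjoint T (T v) = (onorm T)\<^sup>2 *\<^sub>R v}" using dim_eq_0 by (metis gr0I)
  then have "onorm T \<in> set (singular_values T)" using sv onorm_pos_le[OF bl] count_list_0_iff by (metis less_numeral_extra(3))
  then obtain k where k: "k < length (singular_values T)" "singular_values T ! k = onorm T" by (metis in_set_conv_nth)
  have "onorm T \<le> singular_values T ! 0"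
    using sorted_wrt_nth_less[OF conjunct1[OF conjunct2[OF sv]], of 0 k] k by (cases "k = 0") auto
  moreover have "singular_values T ! 0 \<le> onorm T" using k by (intro singular_values_bounds(1)[OF T] nth_mem) linarith
  ultimately show ?thesis by simp
qed

section \<open>The singular value function\<close>

text \<open>The exponent of the (i+1)-th singular value in phi^s. It turns the case distinction in
  \<open>sv_function\<close> into a single product whose weights increase with s and, for s >= 0,
  add up to s.\<close>

definition sv_weight :: "nat \<Rightarrow> real \<Rightarrow> nat \<Rightarrow> real" where
  "sv_weight d s i = (if real d \<le> s then s / real d else max 0 (min 1 (s - real i)))"

lemma sv_weight_nonneg: "0 \<le> s \<Longrightarrow> 0 \<le> sv_weight d s i"
  by (simp add: sv_weight_def)

lemma sum_clamp: "0 \<le> s \<Longrightarrow> (\<Sum>i<d. max 0 (min 1 (s - real i))) = min s (real d)"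
  by (induction d) auto

lemma sum_sv_weight: "0 \<le> s \<Longrightarrow> 0 < d \<Longrightarrow> (\<Sum>i<d. sv_weight d s i) = s"
  using sum_clamp[of s d] by (cases "real d \<le> s") (simp_all add: sv_weight_def)

lemma sv_weight_mono: "s \<le> s' \<Longrightarrow> 0 < d \<Longrightarrow> sv_weight d s i \<le> sv_weight d s' i"
proof -
  assume "s \<le> s'" "0 < d"
  moreover have "max 0 (min 1 (s - real i)) \<le> s' / real d" if "real d \<le> s'"
  proof -
    have "1 \<le> s' / real d" using that \<open>0 < d\<close> by simp
    then show ?thesis by linarith
  qed
  ultimately show ?thesis by (auto simp: sv_weight_def divide_right_mono)
qed

lemma prod_list_conv_prod_nth: "prod_list xs = (\<Prod>i<length xs. xs ! i)" for xs :: "real list"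
  by (induction xs rule: rev_induct) (simp_all add: nth_append)

text \<open>Positivity of the singular values is what makes factors of weight zero equal to 1, since
  \<open>0 powr 0 = 0\<close>.\<close>

lemma sv_function_prod:
  fixes T :: "'a::euclidean_space \<Rightarrow> 'a"
  assumes T: "linear T" and pos: "\<And>x. x \<in> set (singular_values T) \<Longrightarrow> 0 < x" and s: "0 \<le> s"
  shows "sv_function s T = (\<Prod>i<DIM('a). (singular_values T ! i) powr sv_weight DIM('a) s i)"
proof -
  define \<alpha> where "\<alpha> = singular_values T"
  define d where "d = DIM('a)"
  have d: "0 < d" by (simp add: d_def)
  have len: "length \<alpha> = d" using singular_values_props[OF T] by (simp add: \<alpha>_def d_def)
  have pos': "0 < \<alpha> ! i" if "i < d" for i using pos len that by (simp add: \<alpha>_def)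
  consider "s = 0" | "s \<noteq> 0" "real d \<le> s" | "0 < s" "s < real d" using s by linarith
  then show ?thesis unfolding \<alpha>_def[symmetric] d_def[symmetric]
  proof cases
    case 1
    have "(\<Prod>i<d. \<alpha> ! i powr sv_weight d s i) = 1"
    proof (intro prod.neutral ballI)
      fix i assume "i \<in> {..<d}"
      then show "\<alpha> ! i powr sv_weight d s i = 1" using pos'[of i] d 1 by (auto simp: sv_weight_def)
    qed
    then show "sv_function s T = (\<Prod>i<d. \<alpha> ! i powr sv_weight d s i)" using 1 by (simp add: sv_function_def)
  next
    case 2
    have "sv_function s T = (\<Prod>i<d. \<alpha> ! i) powr (s / real d)"
      using 2 len by (simp add: sv_function_def Let_def \<alpha>_def[symmetric] d_def[symmetric] prod_list_conv_prod_nth)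
    also have "\<dots> = (\<Prod>i<d. \<alpha> ! i powr (s / real d))"
      using pos' by (subst prod_powr_distrib) (auto intro: less_imp_le)
    finally show "sv_function s T = (\<Prod>i<d. \<alpha> ! i powr sv_weight d s i)" using 2 by (simp add: sv_weight_def)
  next
    case 3
    define k where "k = nat \<lceil>s\<rceil>"
    have k: "1 \<le> k" "real k - 1 < s" "s \<le> real k" "k \<le> d" using 3 unfolding k_def by linarith+
    have "sv_function s T = prod_list (take (k - 1) \<alpha>) * (\<alpha> ! (k - 1)) powr (s - real k + 1)"
      using 3 by (simp add: sv_function_def Let_def \<alpha>_def[symmetric] d_def[symmetric] k_def)
    also have "prod_list (take (k - 1) \<alpha>) = (\<Prod>i<k-1. \<alpha> ! i powr sv_weight d s i)"
    proof -
      have "prod_list (take (k - 1) \<alpha>) = (\<Prod>i<k-1. \<alpha> ! i)"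
        using k len by (simp add: prod_list_conv_prod_nth min_def)
      also have "\<dots> = (\<Prod>i<k-1. \<alpha> ! i powr sv_weight d s i)"
      proof (intro prod.cong refl)
        fix i assume "i \<in> {..<k-1}"
        then have "i < d" "sv_weight d s i = 1" using k 3 by (auto simp: sv_weight_def max_def min_def)
        then show "\<alpha> ! i = \<alpha> ! i powr sv_weight d s i" using pos'[of i] by simp
      qed
      finally show ?thesis .
    qed
    also have "s - real k + 1 = sv_weight d s (k - 1)" using k 3 by (auto simp: sv_weight_def of_nat_diff)
    also have "(\<Prod>i<k-1. \<alpha> ! i powr sv_weight d s i) * \<alpha> ! (k-1) powr sv_weight d s (k-1)
       = (\<Prod>i<k. \<alpha> ! i powr sv_weight d s i)" using prod.lessThan_Suc[of "\<lambda>i. \<alpha> ! i powr sv_weight d s i" "k - 1"] k by simp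
    also have "\<dots> = (\<Prod>i<d. \<alpha> ! i powr sv_weight d s i)"
    proof (intro prod.mono_neutral_left ballI)
      fix i assume i: "i \<in> {..<d} - {..<k}"
      then have "sv_weight d s i = 0" using k 3 by (auto simp: sv_weight_def)
      then show "\<alpha> ! i powr sv_weight d s i = 1" using i pos'[of i] by auto
    qed (use k in auto)
    finally show "sv_function s T = (\<Prod>i<d. \<alpha> ! i powr sv_weight d s i)" .
  qed
qed

lemma prod_powr_sum:
  assumes "0 < (x::real)" "finite A"
  shows "(\<Prod>i\<in>A. x powr w i) = x powr (\<Sum>i\<in>A. w i)"
  using assms(2) by (induction rule: finite_induct) (use assms(1) in \<open>auto simp: powr_add\<close>)

text \<open>The quotient of phi at s' and at s is a product of powers of singular values whose
  exponents are nonnegative and add up to s' - s; bounds a and M on the singular values therefore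
  become a^(s'-s) and M^(s'-s).\<close>

lemma sv_function_ratio_bounds:
  fixes T :: "'a::euclidean_space \<Rightarrow> 'a"
  assumes T: "linear T" and b: "\<And>x. x \<in> set (singular_values T) \<Longrightarrow> a \<le> x" "\<And>x. x \<in> set (singular_values T) \<Longrightarrow> x \<le> M"
    and a: "0 < a" and s: "0 \<le> s" "s \<le> s'"
  shows "0 < sv_function s T"
    and "a powr (s' - s) * sv_function s T \<le> sv_function s' T"
    and "sv_function s' T \<le> M powr (s' - s) * sv_function s T"
proof -
  define \<alpha> where "\<alpha> = (\<lambda>i. singular_values T ! i)"
  define d where "d = DIM('a)"
  have d: "0 < d" by (simp add: d_def)
  have len: "length (singular_values T) = d" using singular_values_props[OF T] by (simp add: d_def)
  have al: "a \<le> \<alpha> i" "\<alpha> i \<le> M" if "i < d" for i using b len that by (simp_all add: \<alpha>_def)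
  have pos: "0 < \<alpha> i" if "i < d" for i using al[OF that] a by simp
  have M: "0 < M" using al[OF d] a by simp
  let ?w = "sv_weight d"
  have eq: "sv_function s T = (\<Prod>i<d. \<alpha> i powr ?w s i)" if "0 \<le> s" for s
    unfolding \<alpha>_def d_def using b(1) a that by (intro sv_function_prod[OF T]) force+
  show p: "0 < sv_function s T" unfolding eq[OF s(1)] using pos by (intro prod_pos) fastforce
  have "sv_function s' T = (\<Prod>i<d. \<alpha> i powr (?w s' i - ?w s i)) * sv_function s T"
    using s by (simp add: eq prod.distrib[symmetric] powr_add[symmetric])
  moreover have wn: "0 \<le> ?w s' i - ?w s i" for i using sv_weight_mono[OF s(2) d] by simp
  moreover have "(\<Sum>i<d. ?w s' i - ?w s i) = s' - s" using s d by (simp add: sum_subtractf sum_sv_weight)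
  moreover have "(\<Prod>i<d. a powr (?w s' i - ?w s i)) \<le> (\<Prod>i<d. \<alpha> i powr (?w s' i - ?w s i))"
    using al a wn by (intro prod_mono conjI powr_mono2) auto
  moreover have "(\<Prod>i<d. \<alpha> i powr (?w s' i - ?w s i)) \<le> (\<Prod>i<d. M powr (?w s' i - ?w s i))"
    using al pos wn by (intro prod_mono conjI powr_mono2) (auto intro: less_imp_le)
  ultimately show "a powr (s' - s) * sv_function s T \<le> sv_function s' T"
    and "sv_function s' T \<le> M powr (s' - s) * sv_function s T"
    using p a M by (simp_all add: prod_powr_sum)
qed

text \<open>The slopes \<open>ln \<alpha>\<^sub>k\<close> of \<open>s \<mapsto> ln (\<phi>\<^sup>s T)\<close> decrease, so this function is concave on \<open>[0, d]\<close> and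
  vanishes at 0.\<close>

lemma sv_function_powr_le:
  fixes T :: "'a::euclidean_space \<Rightarrow> 'a"
  assumes T: "linear T" and pos: "\<And>x. x \<in> set (singular_values T) \<Longrightarrow> 0 < x"
    and s: "0 < s" "s \<le> s'" "s' < real DIM('a)"
  shows "sv_function s' T powr s \<le> sv_function s T powr s'"
proof -
  define \<alpha> where "\<alpha> = (\<lambda>i. singular_values T ! i)"
  define d where "d = DIM('a)"
  have d: "0 < d" by (simp add: d_def)
  have s'd: "s' < real d" "s < real d" using s by (auto simp: d_def)
  have sv: "length (singular_values T) = d" "sorted_wrt (\<ge>) (singular_values T)" using singular_values_props[OF T] by (simp_all add: d_def)
  have al: "0 < \<alpha> i" if "i < d" for i using pos sv that by (simp add: \<alpha>_def)
  have dec: "\<alpha> j \<le> \<alpha> i" if "i \<le> j" "j < d" for i j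
    using sorted_wrt_nth_less[OF sv(2), of i j] that sv(1) by (cases "i = j") (auto simp: \<alpha>_def)
  let ?w = "sv_weight d"
  have eq: "sv_function s T = (\<Prod>i<d. \<alpha> i powr ?w s i)" if "0 \<le> s" for s
    unfolding \<alpha>_def d_def using pos that by (intro sv_function_prod[OF T]) force+
  \<comment> \<open>With b the singular value of index k, ln b is the slope of ln phi just to the
    left of s: the weight present at s sits on singular values >= b, the weight added between s and
    s' on singular values <= b.\<close>
  define k where "k = nat \<lceil>s\<rceil> - 1"
  have k: "real k < s" "s \<le> real k + 1" "k < d" using s s'd unfolding k_def by linarith+
  define b where "b = \<alpha> k"
  have b: "0 < b" using al k by (simp add: b_def)
  have 1: "b powr s \<le> sv_function s T"
  proof -
    have "b powr s = (\<Prod>i<d. b powr ?w s i)" using b s d by (simp add: prod_powr_sum sum_sv_weight)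
    also have "\<dots> \<le> (\<Prod>i<d. \<alpha> i powr ?w s i)"
    proof (intro prod_mono conjI)
      fix i assume i: "i \<in> {..<d}"
      show "b powr ?w s i \<le> \<alpha> i powr ?w s i"
      proof (cases "i \<le> k")
        case True
        then show ?thesis using dec[of i k] k b s by (intro powr_mono2) (auto simp: b_def sv_weight_nonneg)
      next
        case False
        then have "?w s i = 0" using k s'd by (auto simp: sv_weight_def)
        then show ?thesis using b al[of i] i by auto
      qed
    qed simp
    finally show ?thesis using s by (simp add: eq)
  qed
  have 2: "sv_function s' T \<le> b powr (s' - s) * sv_function s T"
  proof -
    have "sv_function s' T = (\<Prod>i<d. \<alpha> i powr (?w s' i - ?w s i)) * sv_function s T"
      using s by (simp add: eq prod.distrib[symmetric] powr_add[symmetric])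
    moreover have "(\<Prod>i<d. \<alpha> i powr (?w s' i - ?w s i)) \<le> (\<Prod>i<d. b powr (?w s' i - ?w s i))"
    proof (intro prod_mono conjI)
      fix i assume i: "i \<in> {..<d}"
      show "\<alpha> i powr (?w s' i - ?w s i) \<le> b powr (?w s' i - ?w s i)"
      proof (cases "k \<le> i")
        case True
        then show ?thesis using dec[of k i] i al[of i] sv_weight_mono[OF s(2) d, of i] by (intro powr_mono2) (auto simp: b_def)
      next
        case False
        then have "?w s' i - ?w s i = 0" using k s'd s by (auto simp: sv_weight_def)
        then show ?thesis using b al[of i] i by auto
      qed
    qed simp
    moreover have "(\<Sum>i<d. ?w s' i - ?w s i) = s' - s" using s d by (simp add: sum_subtractf sum_sv_weight)
    moreover have "0 \<le> sv_function s T" using s by (simp add: eq prod_nonneg)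
    ultimately show ?thesis using b by (simp add: prod_powr_sum mult_right_mono)
  qed
  have p: "0 < sv_function s T" using less_le_trans[OF _ 1] b by simp
  have nn: "0 \<le> sv_function s' T" using s by (simp add: eq prod_nonneg)
  have "sv_function s' T powr s \<le> (b powr (s' - s) * sv_function s T) powr s"
    using 2 nn s by (intro powr_mono2) auto
  also have "\<dots> = (b powr s) powr (s' - s) * sv_function s T powr s"
    using b p by (simp add: powr_mult powr_powr mult.commute)
  also have "\<dots> \<le> sv_function s T powr (s' - s) * sv_function s T powr s"
    using 1 s by (intro mult_right_mono powr_mono2) auto
  also have "\<dots> = sv_function s T powr s'" using p by (simp add: powr_add[symmetric])
  finally show ?thesis .
qed

text \<open>Up to exponent 1 only the largest singular value carries weight.\<close>

lemma sv_function_le_1: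
  fixes T :: "'a::euclidean_space \<Rightarrow> 'a"
  assumes T: "linear T" and pos: "\<And>x. x \<in> set (singular_values T) \<Longrightarrow> 0 < x" and s: "0 \<le> s" "s \<le> 1"
  shows "sv_function s T = onorm T powr s"
proof -
  define d where "d = DIM('a)"
  obtain n where n: "d = Suc n" using DIM_positive[where 'a='a] unfolding d_def[symmetric] by (cases d) auto
  have len: "length (singular_values T) = d" using singular_values_props[OF T] by (simp add: d_def)
  have "sv_function s T = (\<Prod>i<d. (singular_values T ! i) powr sv_weight d s i)"
    unfolding d_def by (rule sv_function_prod[OF T pos s(1)])
  moreover have "\<dots> = (\<Prod>i\<in>{0}. (singular_values T ! i) powr sv_weight d s i)"
  proof (intro prod.mono_neutral_right ballI)
    fix i assume i: "i \<in> {..<d} - {0}"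
    then have "sv_weight d s i = 0" using s n by (auto simp: sv_weight_def)
    moreover have "0 < singular_values T ! i" using pos i len by auto
    ultimately show "(singular_values T ! i) powr sv_weight d s i = 1" by auto
  qed (use n in auto)
  moreover have "sv_weight d s 0 = s" using s n by (cases n) (auto simp: sv_weight_def)
  ultimately show ?thesis using singular_values_hd[OF T] by simp
qed

text \<open>All singular values are squeezed between the expansion bound c and the norm c; phi^s
  then follows from phi^0 = 1 by the ratio bounds with both constants equal to c.\<close>

lemma sv_function_conformal:
  fixes T :: "'a::euclidean_space \<Rightarrow> 'a"
  assumes T: "linear T" and c: "0 < c" "\<And>v. norm (T v) = c * norm v" and s: "0 \<le> s"
  shows "onorm T = c" "sv_function s T = c powr s"
proof -
  have on: "onorm T = c"
  proof (rule antisym)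
    show "onorm T \<le> c" by (rule onorm_bound) (use c in auto)
    obtain b :: 'a where "norm b = 1" using norm_Basis nonempty_Basis by blast
    then show "c \<le> onorm T" using onorm[of T b] c T linear_conv_bounded_linear[of T] by auto
  qed
  then show "onorm T = c" .
  have c': "x = c" if "x \<in> set (singular_values T)" for x
    using singular_values_bounds(1)[OF T that] singular_values_bounds(2)[OF T that, of c] c on by (auto intro: antisym)
  have z: "sv_function 0 T = 1" by (simp add: sv_function_def)
  have "sv_function s T = c powr (s - 0) * sv_function 0 T"
    using sv_function_ratio_bounds(2,3)[OF T, of c c 0 s] c' c s by (intro antisym) auto
  then show "sv_function s T = c powr s" using z by simp
qed

section \<open>The function tau\<close>

lemma power_powr_swap: "0 < (x::real) \<Longrightarrow> (x ^ n) powr y = (x powr y) ^ n"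
  by (simp add: powr_power powr_realpow[symmetric] powr_powr mult.commute)

lemma powr_less_1: "0 < (x::real) \<Longrightarrow> x < 1 \<Longrightarrow> 0 < a \<Longrightarrow> x powr a < 1"
  using powr_less_mono2[of a x 1] by simp

lemma word_map_simps [simp]:
  "word_map T [] = id" "word_map T (i # I) = T i \<circ> word_map T I"
  by (simp_all add: word_map_def)

lemma word_prob_simps [simp]:
  "word_prob p [] = 1" "word_prob p (i # I) = p i * word_prob p I"
  by (simp_all add: word_prob_def)

lemma words_Suc: "{I :: 'm::finite list. length I = Suc n} = (\<lambda>(i, I). i # I) ` (UNIV \<times> {I. length I = n})"
  by (auto simp: length_Suc_conv image_iff)

lemma finite_words [simp]: "finite {I :: 'm::finite list. length I = n}"
  using finite_lists_length_eq[of "UNIV :: 'm set" n] by simp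

lemma sum_words_Suc:
  fixes f :: "'m::finite list \<Rightarrow> 'b::comm_monoid_add"
  shows "(\<Sum>I | length I = Suc n. f I) = (\<Sum>i\<in>UNIV. \<Sum>I | length I = n. f (i # I))"
  unfolding words_Suc by (subst sum.reindex) (auto simp: inj_on_def sum.cartesian_product split_def)

lemma sum_words_prod_list:
  fixes g :: "'m::finite \<Rightarrow> real"
  shows "(\<Sum>I | length I = n. prod_list (map g I)) = (\<Sum>i\<in>UNIV. g i) ^ n"
proof (induction n)
  case (Suc n)
  have "(\<Sum>I | length I = Suc n. prod_list (map g I)) = (\<Sum>i\<in>UNIV. g i * (\<Sum>I | length I = n. prod_list (map g I)))"
    by (simp add: sum_words_Suc sum_distrib_left)
  also have "\<dots> = (\<Sum>i\<in>UNIV. g i) * (\<Sum>i\<in>UNIV. g i) ^ n" by (simp add: Suc sum_distrib_right)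
  finally show ?case by simp
qed simp

locale affine_ifs =
  fixes T :: "'m::finite \<Rightarrow> 'a::euclidean_space \<Rightarrow> 'a" and p :: "'m \<Rightarrow> real"
  assumes card_ge_2: "2 \<le> CARD('m)"
    and linear_T: "\<And>i. linear (T i)"
    and bij_T: "\<And>i. bij (T i)"
    and onorm_T: "\<And>i. onorm (T i) < 1 / 2"
    and p_pos: "\<And>i. 0 < p i"
    and sum_p: "(\<Sum>i\<in>UNIV. p i) = 1"
begin

abbreviation "W \<equiv> word_map T"
abbreviation "pw \<equiv> word_prob p"
abbreviation "phi s I \<equiv> sv_function s (W I)"
abbreviation "tau \<equiv> tau_fun T p"
abbreviation "conv \<equiv> convergence_exponents T p"

lemma linear_W: "linear (W I)"
proof (induction I)
  case (Cons i I)
  then show ?case using linear_compose[OF Cons linear_T[of i]] by (simp add: o_def)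
qed (simp add: linear_id[unfolded id_def])

lemma bounded_linear_W: "bounded_linear (W I)"
  using linear_W linear_conv_bounded_linear by blast

lemma bounded_linear_T: "bounded_linear (T i)"
  using linear_T linear_conv_bounded_linear by blast

lemma norm_T_le: "norm (T i v) \<le> norm v / 2"
proof -
  have "norm (T i v) \<le> onorm (T i) * norm v" by (rule onorm[OF bounded_linear_T])
  also have "\<dots> \<le> 1 / 2 * norm v" using onorm_T[of i] by (intro mult_right_mono) auto
  finally show ?thesis by simp
qed

lemma onorm_W_le: "onorm (W I) \<le> (1 / 2) ^ length I"
proof (induction I)
  case Nil
  then show ?case by (simp add: onorm_id_le id_def)
next
  case (Cons i I)
  have "onorm (W (i # I)) \<le> onorm (T i) * onorm (W I)"
    using onorm_compose[OF bounded_linear_T bounded_linear_W, of i I] by simp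
  also have "\<dots> \<le> (1 / 2) * (1 / 2) ^ length I"
    using onorm_T[of i] Cons by (intro mult_mono) (auto intro: onorm_pos_le bounded_linear_W)
  finally show ?case by (simp add: o_def)
qed

text \<open>By invertibility no vector is contracted more than this in one step. It bounds the price
  of raising s, and so lets the series converge slightly beyond any exponent with geometric
  decay.\<close>

definition lower_ratio :: real where
  "lower_ratio = (SOME c. 0 < c \<and> (\<forall>i v. c * norm v \<le> norm (T i v)))"

lemma lower_ratio: "0 < lower_ratio" "lower_ratio * norm v \<le> norm (T i v)"
proof -
  have "\<exists>B>0. \<forall>v. B * norm v \<le> norm (T i v)" for i
    using linear_inj_bounded_below_pos[OF linear_T bij_is_inj[OF bij_T], of i] by (metis mult.commute)
  then obtain B where B: "\<And>i. 0 < B i" "\<And>i v. B i * norm v \<le> norm (T i v)" by metis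
  have "\<exists>c. 0 < c \<and> (\<forall>i v. c * norm v \<le> norm (T i v))"
  proof (intro exI[of _ "Min (range B)"] conjI allI)
    show "0 < Min (range B)" using B(1) by (subst Min_gr_iff) auto
    show "Min (range B) * norm v \<le> norm (T i v)" for i v
      by (rule order_trans[OF mult_right_mono B(2)]) auto
  qed
  from someI_ex[OF this] show "0 < lower_ratio" "lower_ratio * norm v \<le> norm (T i v)"
    unfolding lower_ratio_def by blast+
qed

lemma lower_ratio_less_1: "lower_ratio < 1"
proof -
  obtain b :: 'a where b: "norm b = 1" using norm_Basis nonempty_Basis by blast
  show ?thesis using lower_ratio(2)[of b undefined] norm_T_le[of undefined b] b by simp
qed

lemma norm_W_ge: "lower_ratio ^ length I * norm v \<le> norm (W I v)"
proof (induction I)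
  case (Cons i I)
  have "lower_ratio ^ length (i # I) * norm v \<le> lower_ratio * norm (W I v)"
    using Cons lower_ratio(1) by simp
  also have "\<dots> \<le> norm (W (i # I) v)" using lower_ratio(2) by simp
  finally show ?case .
qed simp

lemma singular_values_W:
  assumes "x \<in> set (singular_values (W I))"
  shows "lower_ratio ^ length I \<le> x" "x \<le> (1 / 2) ^ length I" "0 < x"
proof -
  show 1: "lower_ratio ^ length I \<le> x" using singular_values_bounds(2)[OF linear_W assms] norm_W_ge by blast
  show "x \<le> (1 / 2) ^ length I" using singular_values_bounds(1)[OF linear_W assms] onorm_W_le[of I] by simp
  show "0 < x" using lower_ratio(1) by (rule less_le_trans[OF zero_less_power 1])
qed

lemma onorm_W_ge: "lower_ratio ^ length I \<le> onorm (W I)"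
proof -
  have "singular_values (W I) ! 0 \<in> set (singular_values (W I))"
    using singular_values_props[OF linear_W, of I] by (intro nth_mem) auto
  then show ?thesis using singular_values_hd[OF linear_W, of I] singular_values_W(1) by metis
qed

lemma onorm_W_pos: "0 < onorm (W I)"
  using lower_ratio(1) by (rule less_le_trans[OF zero_less_power onorm_W_ge])

text \<open>On words of length n, raising s to s' multiplies phi by a factor between two geometric
  sequences in n. This exchange between exponent and decay rate is behind all statements about the
  critical exponent.\<close>

lemma sv_W:
  assumes "0 \<le> s" "s \<le> s'"
  shows sv_W_pos: "0 < phi s I"
    and sv_W_ge: "(lower_ratio powr (s' - s)) ^ length I * phi s I \<le> phi s' I"
    and sv_W_le: "phi s' I \<le> ((1/2) powr (s' - s)) ^ length I * phi s I"
  using sv_function_ratio_bounds[OF linear_W, of I "lower_ratio ^ length I" "(1/2) ^ length I" s s']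
    singular_values_W[of _ I] lower_ratio(1) assms by (auto simp: power_powr_swap)

lemma p_less_1: "p i < 1"
proof -
  have "\<exists>j. j \<noteq> i"
  proof (rule ccontr)
    assume "\<not> (\<exists>j. j \<noteq> i)"
    then have "(UNIV :: 'm set) = {i}" by auto
    then have "CARD('m) = card {i}" by simp
    then show False using card_ge_2 by simp
  qed
  then obtain j where "j \<noteq> i" by blast
  have "p i < p i + p j" using p_pos by simp
  also have "\<dots> = sum p {i, j}" using \<open>j \<noteq> i\<close> by simp
  also have "\<dots> \<le> sum p UNIV" using p_pos by (intro sum_mono2) (auto intro: less_imp_le)
  finally show ?thesis using sum_p by simp
qed

lemma pw_pos: "0 < pw I"
  by (induction I) (auto simp: p_pos)

lemma pw_le_1: "pw I \<le> 1"
  by (induction I) (auto simp: p_pos less_imp_le[OF p_less_1] less_imp_le[OF pw_pos] intro!: mult_le_one)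

lemma pw_powr: "pw I powr q = prod_list (map (\<lambda>i. p i powr q) I)"
  by (induction I) (auto simp: powr_mult p_pos less_imp_le pw_pos)

lemma sum_pw_powr: "(\<Sum>I | length I = n. pw I powr q) = (\<Sum>i\<in>UNIV. p i powr q) ^ n"
  unfolding pw_powr by (rule sum_words_prod_list)

lemma sum_pw: "(\<Sum>I | length I = n. pw I) = 1"
  using sum_pw_powr[where n = n and q = 1] p_pos pw_pos sum_p by (simp add: less_imp_le)

lemma sum_p_powr_pos: "0 < (\<Sum>i\<in>UNIV. p i powr q)"
  by (intro sum_pos) (auto simp: p_pos less_imp_neq[OF p_pos, symmetric])

lemma sum_p_powr_less_1: "1 < q \<Longrightarrow> (\<Sum>i\<in>UNIV. p i powr q) < 1"
proof -
  assume q: "1 < q"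
  have "(\<Sum>i\<in>UNIV. p i powr q) < (\<Sum>i\<in>UNIV. p i)"
  proof (intro sum_strict_mono)
    show "p i powr q < p i" for i using powr_less_mono'[of "p i" 1 q] p_pos[of i] p_less_1[of i] q by simp
  qed auto
  then show ?thesis using sum_p by simp
qed

section \<open>Level sums of the defining series and its critical exponent\<close>

definition psum :: "real \<Rightarrow> real \<Rightarrow> nat \<Rightarrow> real" where
  "psum q s n = (\<Sum>I | length I = n. phi s I powr (1 - q) * pw I powr q)"

lemma psum_nonneg: "0 \<le> psum q s n"
  by (simp add: psum_def sum_nonneg)

lemma in_convergence_exponents:
  "s \<in> conv q \<longleftrightarrow> 0 \<le> s \<and> summable (\<lambda>k. psum q s (Suc k))"
  by (simp add: convergence_exponents_def psum_def)

text \<open>For q > 1 the exponent 1 - q is negative: a larger s makes phi smaller and the sum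
  larger, so stepping down from s' to s gains a geometric factor.\<close>

lemma psum_le:
  assumes "1 < q" "0 \<le> s" "s \<le> s'"
  shows "psum q s n \<le> ((1/2) powr ((s' - s) * (q - 1))) ^ n * psum q s' n"
  unfolding psum_def sum_distrib_left
proof (intro sum_mono)
  fix I :: "'m list" assume I: "I \<in> {I. length I = n}"
  have pos: "0 < phi s I" "0 < phi s' I" using sv_W_pos[of s s] sv_W_pos[of s' s'] assms by auto
  have "phi s I powr (1 - q) \<le> (phi s' I / ((1/2) powr (s' - s)) ^ n) powr (1 - q)"
    using sv_W_le[OF assms(2,3), of I] I pos assms by (intro powr_mono2') (auto simp: divide_le_eq mult.commute)
  also have "\<dots> = (((1/2) powr (s' - s)) ^ n) powr (q - 1) * phi s' I powr (1 - q)"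
    using pos powr_minus_divide[of "((1/2::real) powr (s' - s)) ^ n" "q - 1"] by (simp add: powr_divide)
  also have "(((1/2::real) powr (s' - s)) ^ n) powr (q - 1) = ((1/2) powr ((s' - s) * (q - 1))) ^ n"
    by (subst power_powr_swap) (auto simp: powr_powr)
  finally show "phi s I powr (1 - q) * pw I powr q
     \<le> ((1/2) powr ((s' - s) * (q - 1))) ^ n * (phi s' I powr (1 - q) * pw I powr q)"
    by (simp add: mult_right_mono mult.assoc[symmetric])
qed

text \<open>The reverse exchange: stepping up from s to s' loses at most a geometric factor,
  governed by \<open>lower_ratio\<close>.\<close>

lemma psum_ge:
  assumes "1 < q" "0 \<le> s" "s \<le> s'"
  shows "psum q s' n \<le> (lower_ratio powr ((s' - s) * (1 - q))) ^ n * psum q s n"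
  unfolding psum_def sum_distrib_left
proof (intro sum_mono)
  fix I :: "'m list" assume I: "I \<in> {I. length I = n}"
  have pos: "0 < phi s I" using sv_W_pos assms by auto
  have "phi s' I powr (1 - q) \<le> ((lower_ratio powr (s' - s)) ^ n * phi s I) powr (1 - q)"
    using sv_W_ge[OF assms(2,3), of I] I pos assms lower_ratio(1) by (intro powr_mono2') auto
  also have "\<dots> = ((lower_ratio powr (s' - s)) ^ n) powr (1 - q) * phi s I powr (1 - q)"
    using pos lower_ratio(1) by (simp add: powr_mult)
  also have "((lower_ratio powr (s' - s)) ^ n) powr (1 - q) = (lower_ratio powr ((s' - s) * (1 - q))) ^ n"
    using lower_ratio(1) by (subst power_powr_swap) (auto simp: powr_powr)
  finally show "phi s' I powr (1 - q) * pw I powr q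
     \<le> (lower_ratio powr ((s' - s) * (1 - q))) ^ n * (phi s I powr (1 - q) * pw I powr q)"
    by (simp add: mult_right_mono mult.assoc[symmetric])
qed

text \<open>Convergence at s' is used only to bound the level sums there; the gap between s and s'
  supplies the geometric factor.\<close>

lemma psum_decay:
  assumes "1 < q" "0 \<le> s" "s < s'" "s' \<in> conv q"
  shows "\<exists>C \<theta>. 0 < \<theta> \<and> \<theta> < 1 \<and> (\<forall>n. psum q s n \<le> C * \<theta> ^ n)"
proof -
  define \<theta> where "\<theta> = (1/2::real) powr ((s' - s) * (q - 1))"
  have th: "0 < \<theta>" "\<theta> < 1" using assms unfolding \<theta>_def
    by (auto intro!: powr_less_1)
  have "summable (\<lambda>k. psum q s' (Suc k))" using assms(4) in_convergence_exponents by simp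
  then have "summable (\<lambda>k. psum q s' k)" using summable_Suc_iff by blast
  then have "Bseq (\<lambda>k. psum q s' k)" by (intro convergent_imp_Bseq convergentI[OF summable_LIMSEQ_zero])
  then obtain C where C: "\<And>n. norm (psum q s' n) \<le> C" unfolding Bseq_def by blast
  have "psum q s n \<le> C * \<theta> ^ n" for n
  proof -
    have "psum q s n \<le> \<theta> ^ n * psum q s' n" unfolding \<theta>_def using assms by (intro psum_le) auto
    also have "\<dots> \<le> \<theta> ^ n * C" using C[of n] th by (intro mult_left_mono) auto
    finally show ?thesis by (simp add: mult.commute)
  qed
  then show ?thesis using th by blast
qed

text \<open>Geometric decay has room to spare: part of it pays for a small increase of s.\<close>

lemma convergence_exponents_open:
  assumes "1 < q" "0 \<le> s" "0 < \<theta>" "\<theta> < 1" "\<And>n. psum q s n \<le> C * \<theta> ^ n"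
  shows "\<exists>\<epsilon>>0. s + \<epsilon> \<in> conv q"
proof -
  \<comment> \<open>Solves \<open>lower_ratio powr (\<epsilon> * (1 - q)) = \<theta> powr (- 1 /
    2)\<close>, so that the increase uses up half of the decay.\<close>
  define \<epsilon> where "\<epsilon> = ln \<theta> / (2 * (q - 1) * ln lower_ratio)"
  have neg: "ln \<theta> < 0" "ln lower_ratio < 0" using assms lower_ratio lower_ratio_less_1 by auto
  have eps: "0 < \<epsilon>" unfolding \<epsilon>_def using neg assms(1) by (intro divide_neg_neg mult_pos_neg) auto
  have e2: "\<epsilon> * (1 - q) * ln lower_ratio = - ln \<theta> / 2" unfolding \<epsilon>_def using neg assms(1)
    by (simp add: field_simps)
  have "lower_ratio powr (\<epsilon> * (1 - q)) = exp (- ln \<theta> / 2)"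
    using lower_ratio(1) e2 by (simp add: powr_def)
  also have "\<dots> * \<theta> = exp (ln \<theta> / 2)"
    using assms(3) exp_add[of "- ln \<theta> / 2" "ln \<theta>"] by simp
  also have "\<dots> < 1" using neg by simp
  finally have lt: "lower_ratio powr (\<epsilon> * (1 - q)) * \<theta> < 1" .
  define \<theta>' where "\<theta>' = lower_ratio powr (\<epsilon> * (1 - q)) * \<theta>"
  have th: "0 \<le> \<theta>'" "\<theta>' < 1" using lt assms by (auto simp: \<theta>'_def)
  have le: "psum q (s + \<epsilon>) n \<le> C * \<theta>' ^ n" for n
  proof -
    have "psum q (s + \<epsilon>) n \<le> (lower_ratio powr (\<epsilon> * (1 - q))) ^ n * psum q s n"
      using psum_ge[of q s "s + \<epsilon>" n] assms eps by simp
    also have "\<dots> \<le> (lower_ratio powr (\<epsilon> * (1 - q))) ^ n * (C * \<theta> ^ n)"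
      using assms(5) by (intro mult_left_mono) auto
    finally show ?thesis by (simp add: \<theta>'_def power_mult_distrib mult_ac)
  qed
  have "summable (\<lambda>n. C * \<theta>' ^ n)" using th by (intro summable_mult summable_geometric) auto
  then have "summable (\<lambda>k. psum q (s + \<epsilon>) k)"
    by (rule summable_comparison_test'[where N = 0]) (use le psum_nonneg in auto)
  then have "s + \<epsilon> \<in> conv q"
    using summable_Suc_iff[of "psum q (s + \<epsilon>)"] assms eps by (simp add: in_convergence_exponents)
  then show ?thesis using eps by blast
qed

text \<open>Words repeating a single letter suffice: for large s their terms alone stay at least 1.
  Without such a bound \<open>Sup\<close> on the reals would carry no information.\<close>

lemma convergence_exponents_bdd:
  assumes "1 < q"
  shows "bdd_above (conv q)"
proof -
  define i :: 'm where "i = undefined"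
  \<comment> \<open>At s = K the ratio 2^(s(q-1)) p_i^q, which bounds the terms of these words from
    below, equals 1.\<close>
  define K where "K = - (q * ln (p i)) / ((q - 1) * ln 2)"
  have "s \<le> K" if s: "s \<in> conv q" for s
  proof (rule ccontr)
    assume "\<not> s \<le> K"
    then have sK: "K < s" by simp
    have s0: "0 \<le> s" and sm: "summable (\<lambda>k. psum q s (Suc k))" using s by (auto simp: in_convergence_exponents)
    have "1 \<le> psum q s n" for n
    proof -
      define I where "I = replicate n i"
      have I: "length I = n" "pw I = p i ^ n" by (simp_all add: I_def word_prob_def prod_list_replicate)
      have pos: "0 < phi s I" using s0 sv_W_pos by blast
      have z: "phi 0 I = 1" by (simp add: sv_function_def)
      have "phi s I \<le> ((1/2) powr s) ^ n" using sv_W_le[of 0 s I] s0 z I by simp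
      then have "(((1/2) powr s) ^ n) powr (1 - q) \<le> phi s I powr (1 - q)"
        using pos assms by (intro powr_mono2') auto
      moreover have "(((1/2::real) powr s) ^ n) powr (1 - q) = ((1/2) powr (s * (1 - q))) ^ n"
        by (subst power_powr_swap) (auto simp: powr_powr)
      moreover have "pw I powr q = (p i powr q) ^ n" using I p_pos by (simp add: power_powr_swap)
      ultimately have "((1/2) powr (s * (1 - q)) * p i powr q) ^ n \<le> phi s I powr (1 - q) * pw I powr q"
        by (simp add: power_mult_distrib mult_right_mono)
      also have "\<dots> \<le> psum q s n" unfolding psum_def
        using I by (intro member_le_sum) auto
      finally have "((1/2) powr (s * (1 - q)) * p i powr q) ^ n \<le> psum q s n" .
      moreover have "1 \<le> (1/2) powr (s * (1 - q)) * p i powr q"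
      proof -
        have "(1/2) powr (s * (1 - q)) * p i powr q = exp (s * (q - 1) * ln 2 + q * ln (p i))"
          using p_pos[of i] by (simp add: powr_def exp_add[symmetric] ln_div algebra_simps)
        moreover have "0 \<le> s * (q - 1) * ln 2 + q * ln (p i)"
        proof -
          have "- (q * ln (p i)) < s * ((q - 1) * ln 2)"
            using sK assms unfolding K_def by (subst (asm) divide_less_eq) auto
          then show ?thesis by (simp add: mult.assoc)
        qed
        ultimately show ?thesis by simp
      qed
      ultimately show ?thesis using one_le_power order_trans by blast
    qed
    moreover have "(\<lambda>k. psum q s (Suc k)) \<longlonglongrightarrow> 0" using sm by (rule summable_LIMSEQ_zero)
    ultimately have "(1::real) \<le> 0" by (intro LIMSEQ_le_const[where X = "\<lambda>k. psum q s (Suc k)"]) auto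
    then show False by simp
  qed
  then show ?thesis by (auto simp: bdd_above_def)
qed

text \<open>For q > 1 this is the uncapped quotient D(q)/(q-1).\<close>

definition sdim :: "real \<Rightarrow> real" where
  "sdim q = Sup (conv q)"

lemma psum_0: "psum q 0 n = (\<Sum>i\<in>UNIV. p i powr q) ^ n"
  by (simp add: psum_def sv_function_def sum_pw_powr)

text \<open>At s = 0 level n is the n-th power of the sum of the p_i^q, which is below 1 for q >
  1.\<close>

lemma sdim_pos_exponent: "1 < q \<Longrightarrow> \<exists>\<epsilon>>0. \<epsilon> \<in> conv q"
  using convergence_exponents_open[of q 0 "\<Sum>i\<in>UNIV. p i powr q" 1] sum_p_powr_pos[of q] sum_p_powr_less_1[of q]
  by (simp add: psum_0)

lemma sdim_pos: "1 < q \<Longrightarrow> 0 < sdim q"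
  unfolding sdim_def using sdim_pos_exponent[of q] convergence_exponents_bdd[of q] cSup_upper by fastforce

text \<open>The working form of the supremum: the lower bound on the spectrum reads it from left to
  right, the upper bound from right to left.\<close>

lemma less_sdim_iff:
  assumes "1 < q" "0 \<le> s"
  shows "s < sdim q \<longleftrightarrow> (\<exists>C \<theta>. 0 < \<theta> \<and> \<theta> < 1 \<and> (\<forall>n. psum q s n \<le> C * \<theta> ^ n))"
proof
  assume "s < sdim q"
  then obtain s' where "s < s'" "s' \<in> conv q"
    using less_cSup_iff[of "conv q" s] sdim_pos_exponent[OF assms(1)] convergence_exponents_bdd[OF assms(1)]
    unfolding sdim_def by blast
  then show "\<exists>C \<theta>. 0 < \<theta> \<and> \<theta> < 1 \<and> (\<forall>n. psum q s n \<le> C * \<theta> ^ n)" using psum_decay assms by blast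
next
  assume "\<exists>C \<theta>. 0 < \<theta> \<and> \<theta> < 1 \<and> (\<forall>n. psum q s n \<le> C * \<theta> ^ n)"
  then obtain \<epsilon> where e: "0 < \<epsilon>" "s + \<epsilon> \<in> conv q" using convergence_exponents_open[OF assms] by blast
  have "s + \<epsilon> \<le> sdim q" unfolding sdim_def by (rule cSup_upper[OF e(2) convergence_exponents_bdd[OF assms(1)]])
  then show "s < sdim q" using e by simp
qed

text \<open>An interpolation of Hoelder type. With weights p_I, level n at q is the mean of the
  \<beta>-th powers of the quantities whose mean is level n at q', where \<beta> = (q-1)/(q'-1) <=
  1. Geometric decay at q' thus forces geometric decay at q for the same s.\<close>

lemma sdim_antimono:
  assumes q: "1 < q" "q \<le> q'"
  shows "sdim q' \<le> sdim q"
proof (rule ccontr)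
  assume "\<not> sdim q' \<le> sdim q"
  then have less: "sdim q < sdim q'" by simp
  define s where "s = sdim q"
  have s: "0 \<le> s" using sdim_pos[OF q(1)] by (simp add: s_def)
  have q': "1 < q'" using q by simp
  obtain C \<theta> where C: "0 < \<theta>" "\<theta> < 1" "\<And>n. psum q' s n \<le> C * \<theta> ^ n" using less s less_sdim_iff[OF q' s] by (auto simp: s_def)
  define \<beta> where "\<beta> = (q - 1) / (q' - 1)"
  have b: "0 < \<beta>" "\<beta> \<le> 1" using q by (auto simp: \<beta>_def)
  \<comment> \<open>Plays the role of the concavity of x^\<beta>: below the threshold y the first
    term dominates, above it x^(\<beta>-1) <= y^(\<beta>-1).\<close>
  have young: "x powr \<beta> \<le> y powr \<beta> + y powr (\<beta> - 1) * x" if "0 < x" "0 < y" for x y :: real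
  proof (cases "x \<le> y")
    case True
    then have "x powr \<beta> \<le> y powr \<beta>" using that b by (intro powr_mono2) auto
    then show ?thesis using that by (simp add: add_increasing2)
  next
    case False
    have "x powr \<beta> = x powr (\<beta> - 1) * x" using that by (simp add: powr_diff)
    also have "\<dots> \<le> y powr (\<beta> - 1) * x" using that b False by (intro mult_right_mono powr_mono2') auto
    finally show ?thesis by (simp add: add_increasing)
  qed
  have "psum q s n \<le> (1 + C) * (\<theta> powr \<beta>) ^ n" for n
  proof -
    \<comment> \<open>This threshold balances the two terms: both become of order \<theta>^(\<beta>
      n).\<close>
    define y where "y = \<theta> ^ n"
    have y: "0 < y" using C by (simp add: y_def)
    have eq: "phi s I powr (1 - r) * pw I powr r = pw I * (pw I / phi s I) powr (r - 1)" for r I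
    proof -
      have pos: "0 < phi s I" "0 < pw I" using s sv_W_pos pw_pos by auto
      have "pw I * (pw I / phi s I) powr (r - 1) = pw I powr 1 * pw I powr (r - 1) / phi s I powr (r - 1)"
        using pos by (simp add: powr_divide)
      also have "\<dots> = pw I powr r / phi s I powr (r - 1)" by (simp only: powr_add[symmetric]) simp
      also have "\<dots> = phi s I powr (1 - r) * pw I powr r"
        using powr_minus_divide[of "phi s I" "r - 1"] by simp
      finally show ?thesis by simp
    qed
    have "psum q s n = (\<Sum>I | length I = n. pw I * ((pw I / phi s I) powr (q' - 1)) powr \<beta>)"
      unfolding psum_def eq using q by (simp add: powr_powr \<beta>_def)
    also have "\<dots> \<le> (\<Sum>I | length I = n. pw I * (y powr \<beta> + y powr (\<beta> - 1) * (pw I / phi s I) powr (q' - 1)))"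
      using s sv_W_pos[of s s] y by (intro sum_mono mult_left_mono young less_imp_le[OF pw_pos]) (auto simp: pw_pos less_imp_neq[symmetric])
    also have "\<dots> = y powr \<beta> * (\<Sum>I | length I = n. pw I) + y powr (\<beta> - 1) * psum q' s n"
      unfolding psum_def eq by (simp add: sum.distrib sum_distrib_left algebra_simps)
    also have "\<dots> \<le> y powr \<beta> * 1 + y powr (\<beta> - 1) * (C * y)"
      using C(3)[of n] by (intro add_mono mult_left_mono) (auto simp: sum_pw y_def)
    also have "y powr (\<beta> - 1) * (C * y) = C * y powr \<beta>" using y by (simp add: powr_diff)
    also have "y powr \<beta> = (\<theta> powr \<beta>) ^ n" using C by (simp add: y_def power_powr_swap)
    finally show ?thesis by (simp add: algebra_simps)
  qed
  moreover have "0 < \<theta> powr \<beta>" "\<theta> powr \<beta> < 1" using C b by (auto intro!: powr_less_1)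
  ultimately have "s < sdim q" using less_sdim_iff[OF q(1) s] by blast
  then show False by (simp add: s_def)
qed

text \<open>The product s (q-1) is kept fixed while q grows: for s' (q'-1) = s (q-1) the concavity
  of ln phi makes the power 1-q' of phi at s' at most the power 1-q of phi at s, and p_I^q' <=
  p_I^q, so the series is dominated term by term. The bound s < d is the range of that
  concavity.\<close>

lemma less_sdim_scale:
  assumes q: "1 < q" "q \<le> q'" and s: "0 < s" "s < sdim q" "s < DIM('a)"
  shows "s * (q - 1) / (q' - 1) < sdim q'"
proof -
  define s' where "s' = s * (q - 1) / (q' - 1)"
  have s': "0 < s'" "s' \<le> s" "s' * (q' - 1) = s * (q - 1)" using q s by (auto simp: s'_def divide_le_eq)
  obtain C \<theta> where C: "0 < \<theta>" "\<theta> < 1" "\<And>n. psum q s n \<le> C * \<theta> ^ n" using less_sdim_iff[of q s] q s by auto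
  have "psum q' s' n \<le> psum q s n" for n unfolding psum_def
  proof (intro sum_mono mult_mono)
    fix I :: "'m list"
    have pos: "0 < phi s I" "0 < phi s' I" using s s' sv_W_pos[of s s] sv_W_pos[of s' s'] by auto
    have "phi s I powr s' \<le> phi s' I powr s"
      using s s' singular_values_W by (intro sv_function_powr_le[OF linear_W]) auto
    then have "(phi s' I powr s) powr ((1 - q') / s) \<le> (phi s I powr s') powr ((1 - q') / s)"
      using pos q s by (intro powr_mono2') (auto simp: divide_le_0_iff)
    moreover have "s' * (1 - q') / s = 1 - q" using s'(3) s q by (simp add: field_simps)
    ultimately show "phi s' I powr (1 - q') \<le> phi s I powr (1 - q)"
      using s by (simp add: powr_powr)
    show "pw I powr q' \<le> pw I powr q" using pw_pos[of I] pw_le_1[of I] q by (intro powr_mono') auto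
  qed auto
  then have "\<exists>C \<theta>. 0 < \<theta> \<and> \<theta> < 1 \<and> (\<forall>n. psum q' s' n \<le> C * \<theta> ^ n)" using C order_trans by blast
  then show ?thesis using less_sdim_iff[of q' s'] q s' by (auto simp: s'_def)
qed

section \<open>Behaviour of tau in q and the ranges of q in the theorem\<close>

abbreviation "mdim q \<equiv> min (sdim q) (real DIM('a))"

lemma D_fun_eq: "1 < q \<Longrightarrow> D_fun T p q / (q - 1) = sdim q"
  by (simp add: D_fun_def sdim_def)

lemma tau_eq: "1 < q \<Longrightarrow> tau q = (q - 1) * mdim q"
  by (simp add: tau_fun_def D_fun_eq)

lemma mdim_pos: "1 < q \<Longrightarrow> 0 < mdim q"
  using sdim_pos by simp

text \<open>Not immediate from the definition, since q - 1 grows while the capped quotient is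
  nonincreasing. It lets the constraint tau <= D pass to smaller q.\<close>

lemma tau_mono:
  assumes "1 < q" "q \<le> q'"
  shows "tau q \<le> tau q'"
proof (rule ccontr)
  assume "\<not> tau q \<le> tau q'"
  then have "(q' - 1) * mdim q' < (q - 1) * mdim q" using assms by (simp add: tau_eq)
  then have "(q' - 1) * mdim q' / (q - 1) < mdim q" using assms by (subst pos_divide_less_eq) (auto simp only: diff_gt_0_iff_gt mult.commute[of _ "q - 1"])
  moreover have "0 < (q' - 1) * mdim q' / (q - 1)" using assms mdim_pos[of q'] by simp
  ultimately obtain s where s: "(q' - 1) * mdim q' / (q - 1) < s" "s < mdim q" "0 < s" 
    using dense[of "(q' - 1) * mdim q' / (q - 1)" "mdim q"] by fastforce
  then have "s * (q - 1) / (q' - 1) < sdim q'" using assms by (intro less_sdim_scale) auto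
  moreover have "mdim q' < s * (q - 1) / (q' - 1)" using s(1) assms by (simp add: field_simps)
  moreover have "s * (q - 1) / (q' - 1) < (real DIM('a))"
  proof -
    have "s * ((q - 1) / (q' - 1)) \<le> s * 1" using assms s by (intro mult_left_mono) auto
    then show ?thesis using s by simp
  qed
  ultimately show False by simp
qed

lemma tau_scale:
  assumes "1 < q'" "q' \<le> q"
  shows "(q' - 1) / (q - 1) * tau q \<le> tau q'"
proof -
  have "mdim q \<le> mdim q'" using sdim_antimono[OF assms] by auto
  then show ?thesis using assms by (simp add: tau_eq)
qed

text \<open>The scaling bound excludes an upward jump of tau at q, so estimates valid to the left of
  q survive at q. This is what puts the right end points into the intervals.\<close>

lemma tau_le_by_left:
  assumes "1 < q" "\<And>t. 1 < t \<Longrightarrow> t < q \<Longrightarrow> tau t \<le> K"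
  shows "tau q \<le> K"
proof -
  have "((\<lambda>t. (t - 1) / (q - 1) * tau q) \<longlongrightarrow> (q - 1) / (q - 1) * tau q) (at_left q)"
    using assms(1) by (intro tendsto_intros) auto
  moreover have "\<forall>\<^sub>F t in at_left q. (t - 1) / (q - 1) * tau q \<le> K"
    using eventually_at_left_real[OF assms(1)]
    by eventually_elim (rule order_trans[OF tau_scale assms(2)]; simp)
  ultimately have "(q - 1) / (q - 1) * tau q \<le> K"
    by (intro tendsto_upperbound) auto
  then show ?thesis using assms(1) by simp
qed

text \<open>With (q-1) s = d+1 fixed, the price of s does not depend on q, while the sum of the
  p_i^q tends to 0; for large q such an s is below the critical exponent. This bounds the set behind
  \<open>GREATEST\<close>.\<close>

lemma tau_exceeds: "\<exists>Q>1. tau Q > (real DIM('a))"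
proof -
  define m where "m = Max (range p)"
  have m: "\<And>i. p i \<le> m" "m < 1" "0 < m"
    using p_less_1 p_pos by (auto simp: m_def Max_gr_iff)
  have "(\<lambda>n. real CARD('m) * lower_ratio powr (- ((real DIM('a)) + 1)) * m ^ n) \<longlonglongrightarrow> real CARD('m) * lower_ratio powr (- ((real DIM('a)) + 1)) * 0"
    using m by (intro tendsto_intros LIMSEQ_power_zero) auto
  then have "\<forall>\<^sub>F n in sequentially. real CARD('m) * lower_ratio powr (- ((real DIM('a)) + 1)) * m ^ n < 1"
    by (rule order_tendstoD(2)) simp
  moreover have "\<forall>\<^sub>F n in sequentially. 3 \<le> n" by (rule eventually_ge_at_top)
  ultimately obtain n where n: "real CARD('m) * lower_ratio powr (- ((real DIM('a)) + 1)) * m ^ n < 1" "3 \<le> n"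
    using eventually_conj eventually_happens' sequentially_bot by blast
  define q where "q = real n"
  have q: "3 \<le> q" using n by (simp add: q_def)
  define s where "s = ((real DIM('a)) + 1) / (q - 1)"
  have s: "0 < s" "s * (1 - q) = - ((real DIM('a)) + 1)" using q by (auto simp: s_def field_simps)
  have "(\<Sum>i\<in>UNIV. p i powr q) \<le> (\<Sum>i\<in>(UNIV::'m set). m ^ n)"
    using m(1) p_pos by (intro sum_mono) (auto simp: q_def powr_realpow less_imp_le intro!: power_mono)
  then have le: "(\<Sum>i\<in>UNIV. p i powr q) \<le> real CARD('m) * m ^ n" by simp
  define \<theta> where "\<theta> = lower_ratio powr (- ((real DIM('a)) + 1)) * (\<Sum>i\<in>UNIV. p i powr q)"
  have "\<theta> \<le> lower_ratio powr (- ((real DIM('a)) + 1)) * (real CARD('m) * m ^ n)" unfolding \<theta>_def by (intro mult_left_mono le) auto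
  then have th: "0 < \<theta>" "\<theta> < 1" using n(1) lower_ratio(1) sum_p_powr_pos[of q] by (auto simp only: \<theta>_def mult_ac intro: mult_pos_pos) auto
  have "psum q s n \<le> 1 * \<theta> ^ n" for n
    using psum_ge[of q 0 s n] q s by (simp add: psum_0 \<theta>_def power_mult_distrib)
  then have "\<exists>C \<theta>. 0 < \<theta> \<and> \<theta> < 1 \<and> (\<forall>n. psum q s n \<le> C * \<theta> ^ n)" using th by blast
  then have "s < sdim q" using less_sdim_iff[of q s] q s by auto
  then have "(real DIM('a)) < (q - 1) * sdim q"
  proof -
    have "(q - 1) * s < (q - 1) * sdim q" using \<open>s < sdim q\<close> q by simp
    then show ?thesis using s by (simp add: algebra_simps)
  qed
  moreover have "(real DIM('a)) < (q - 1) * (real DIM('a))" using q by simp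
  ultimately have "(real DIM('a)) < tau q" using q by (auto simp: tau_eq min_def)
  then show ?thesis using q by (intro exI[of _ q]) auto
qed

lemma tau_1: "tau 1 = 0" by (simp add: tau_fun_def)

text \<open>\<open>GREATEST\<close> is meaningful only if a maximum is attained. The set is bounded
  because tau is nondecreasing on (1, infinity) and somewhere exceeds d, and its supremum belongs to
  it because tau has no upward jumps; members below 1 lie under the member 1.\<close>

lemma Greatest_tau:
  assumes "q \<le> (GREATEST q. 0 \<le> q \<and> tau q \<le> (real DIM('a)))" "1 < q"
  shows "tau q \<le> (real DIM('a))"
proof -
  obtain Q where Q: "1 < Q" "tau Q > (real DIM('a))" using tau_exceeds by blast
  define S where "S = {q. 1 \<le> q \<and> tau q \<le> (real DIM('a))}"
  have 1: "1 \<in> S" by (simp add: S_def tau_1)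
  have bd: "t \<le> Q" if "t \<in> S" for t
    using that Q tau_mono[of Q t] by (force simp: S_def)
  then have bdd: "bdd_above S" by (auto simp: bdd_above_def)
  define G where "G = Sup S"
  have G1: "1 \<le> G" unfolding G_def using 1 bdd by (rule cSup_upper)
  have GS: "G \<in> S"
  proof (cases "G = 1")
    case False
    have "tau G \<le> (real DIM('a))"
    proof (rule tau_le_by_left)
      show "1 < G" using G1 False by simp
      fix t assume t: "1 < t" "t < G"
      then obtain u where "u \<in> S" "t < u" using less_cSup_iff[of S t] 1 bdd by (auto simp: G_def)
      then show "tau t \<le> (real DIM('a))" using tau_mono[of t u] t by (auto simp: S_def)
    qed
    then show ?thesis using G1 by (simp add: S_def)
  qed (use 1 in simp)
  have "(GREATEST q. 0 \<le> q \<and> tau q \<le> (real DIM('a))) = G"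
  proof (rule Greatest_equality)
    show "0 \<le> G \<and> tau G \<le> (real DIM('a))" using GS by (auto simp: S_def)
    fix y assume y: "0 \<le> y \<and> tau y \<le> (real DIM('a))"
    show "y \<le> G"
    proof (cases "1 \<le> y")
      case True
      then have "y \<in> S" using y by (simp add: S_def)
      then show ?thesis unfolding G_def using bdd by (rule cSup_upper)
    qed (use G1 in simp)
  qed
  then show ?thesis using assms tau_mono[of q G] GS by (auto simp: S_def)
qed

text \<open>Every t in (1, q) lies below an admissible u, where tau(t) <= tau(u) <= 1; the point q
  itself may be a supremum that is not attained and is reached from the left.\<close>

lemma q_interval_tau:
  assumes "q \<in> q_interval T p"
  shows "2 \<le> q" "tau q \<le> 1"
proof -
  define A where "A = {t. 0 \<le> t \<and> t \<noteq> 1 \<and> D_fun T p t / (t - 1) \<le> 1 \<and> tau t \<le> 1}"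
  have q: "2 \<le> q" "ereal q \<le> (SUP t\<in>A. ereal t)" using assms unfolding q_interval_def A_def by auto
  show "2 \<le> q" by fact
  show "tau q \<le> 1"
  proof (rule tau_le_by_left)
    show "1 < q" using q by simp
    fix t assume t: "1 < t" "t < q"
    then have "ereal t < (SUP t\<in>A. ereal t)" using q(2) by (metis ereal_less(5) less_ereal.simps(1) order_less_le_trans)
    then obtain u where "u \<in> A" "t < u" by (auto simp: less_SUP_iff)
    then show "tau t \<le> 1" using tau_mono[of t u] t by (auto simp: A_def)
  qed
qed

text \<open>The difference quotient at 1 is the capped dimension \<open>mdim\<close> itself. It is
  nonincreasing in q, so its limit from the right is its supremum.\<close>

lemma right_derivative_tau:
  "\<exists>\<tau>'. (tau has_real_derivative \<tau>') (at_right 1) \<and> 0 < \<tau>' \<and> (\<forall>q>1. mdim q \<le> \<tau>')"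
proof -
  define f where "f q = mdim q" for q
  have anti: "f q' \<le> f q" if "1 < q" "q \<le> q'" for q q' using sdim_antimono[OF that] by (auto simp: f_def)
  define L where "L = (SUP q\<in>{1<..}. f q)"
  have bdd: "bdd_above (f ` {1<..})" unfolding f_def by (intro bdd_aboveI[of _ "real DIM('a)"]) auto
  have le: "f q \<le> L" if "1 < q" for q unfolding L_def using that bdd by (intro cSUP_upper) auto
  have "(f \<longlongrightarrow> L) (at_right 1)"
  proof (rule order_tendstoI)
    fix a assume "a < L"
    then obtain q where q: "1 < q" "a < f q" unfolding L_def using less_cSUP_iff[of "{1<..}" f a] bdd by auto
    show "\<forall>\<^sub>F x in at_right 1. a < f x"
      using eventually_at_right_real[OF q(1)] by eventually_elim (rule less_le_trans[OF q(2) anti]; simp)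
  next
    fix a assume "L < a"
    show "\<forall>\<^sub>F x in at_right 1. f x < a"
      using eventually_at_right_less by eventually_elim (use le \<open>L < a\<close> in force)
  qed
  moreover have "\<forall>\<^sub>F q in at_right 1. (tau q - tau 1) / (q - 1) = f q"
    using eventually_at_right_less by eventually_elim (simp add: tau_eq tau_1 f_def)
  ultimately have "((\<lambda>q. (tau q - tau 1) / (q - 1)) \<longlongrightarrow> L) (at_right 1)"
    by (simp add: tendsto_cong)
  then have "(tau has_real_derivative L) (at_right 1)"
    by (simp add: has_field_derivative_iff)
  moreover have "0 < L" using less_le_trans[OF mdim_pos[of 2] le[of 2, unfolded f_def]] by simp
  ultimately show ?thesis using le by (auto simp: f_def)
qed

text \<open>The end point t = 1 + 1/tau' is itself admissible, since tau(t) = \<open>mdim t\<close>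
  / tau' <= 1.\<close>

lemma q_interval_contains:
  assumes tau': "0 < \<tau>'" "\<And>q. 1 < q \<Longrightarrow> mdim q \<le> \<tau>'" "\<tau>' \<le> 1" "DIM('a) = 1 \<Longrightarrow> \<tau>' = 1 \<Longrightarrow> D_fun T p 2 \<le> 1"
  shows "q_interval T p \<noteq> {}" "is_interval (q_interval T p)" "{2..1 + 1 / \<tau>'} \<subseteq> q_interval T p"
proof -
  define t where "t = 1 + 1 / \<tau>'"
  have t: "2 \<le> t" using tau' by (simp add: t_def)
  define A where "A = {t. 0 \<le> t \<and> t \<noteq> 1 \<and> D_fun T p t / (t - 1) \<le> 1 \<and> tau t \<le> 1}"
  have eq: "q_interval T p = {q. 2 \<le> q \<and> ereal q \<le> (SUP t\<in>A. ereal t)}" by (simp add: q_interval_def A_def)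
  have tau: "tau t \<le> 1"
  proof -
    have "tau t = (1 / \<tau>') * mdim t" using t by (simp add: tau_eq) (simp add: t_def)
    also have "\<dots> \<le> (1 / \<tau>') * \<tau>'" using tau' t by (intro mult_left_mono) auto
    finally show ?thesis using tau' by simp
  qed
  \<comment> \<open>The uncapped condition needs the cap to be inactive. It is when tau' < d; the
    exception d = tau' = 1 has t = 2, where the extra hypothesis applies.\<close>
  have "sdim t \<le> 1"
  proof (cases "DIM('a) = 1 \<and> \<tau>' = 1")
    case True
    then have "t = 2" by (simp add: t_def)
    then show ?thesis using tau'(4) True D_fun_eq[of 2] by simp
  next
    case False
    have m: "mdim t \<le> \<tau>'" using tau'(2) t by simp
    have "1 \<le> real DIM('a)" using DIM_positive[where 'a='a] by linarith
    then have "\<tau>' < (real DIM('a))" using False tau'(3) by (cases "\<tau>' = 1") (auto simp: order_le_less)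
    then show ?thesis using m tau' by auto
  qed
  then have "t \<in> A" using t tau by (simp add: A_def D_fun_eq)
  then have up: "ereal t \<le> (SUP t\<in>A. ereal t)" by (rule SUP_upper)
  show sub: "{2..1 + 1 / \<tau>'} \<subseteq> q_interval T p"
  proof
    fix q assume q: "q \<in> {2..1 + 1 / \<tau>'}"
    then have "ereal q \<le> ereal t" by (simp add: t_def)
    from order_trans[OF this up] show "q \<in> q_interval T p" using q unfolding eq by simp
  qed
  show "q_interval T p \<noteq> {}" using sub t by (auto simp: t_def)
  show "is_interval (q_interval T p)"
    unfolding is_interval_1 eq by (auto intro: order_trans[rotated])
qed

end

section \<open>Packing sums and energies\<close>

lemma content_cball_scale:
  fixes x :: "'a::euclidean_space"
  assumes "0 \<le> r"
  shows "measure lborel (cball x r) = r ^ DIM('a) * measure lborel (cball (0::'a) 1)"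
  using content_cball[of r x] content_cball[of 1 "0::'a"] assms by simp

text \<open>Volume comparison: the balls of radius r/2 around the points are disjoint and lie in a
  ball of radius R + r/2.\<close>

lemma card_separated_le:
  fixes Y :: "'a::euclidean_space set"
  assumes Y: "finite Y" "pairwise (\<lambda>x y. r < dist x y) Y" "Y \<subseteq> cball z R" and r: "0 < r" "0 \<le> R"
  shows "real (card Y) \<le> (2 * R / r + 1) ^ DIM('a)"
proof -
  let ?v = "measure lborel (cball (0::'a) 1)"
  have v: "0 < ?v" using content_cball_pos[of 1 "0::'a"] by simp
  have dj: "disjoint_family_on (\<lambda>y. cball y (r/2)) Y"
    unfolding disjoint_family_on_def
  proof (intro ballI impI)
    fix x y assume "x \<in> Y" "y \<in> Y" "x \<noteq> y"
    then have "r < dist x y" using Y(2) by (auto simp: pairwise_def)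
    then show "cball x (r/2) \<inter> cball y (r/2) = {}" by (intro disjoint_cballI) simp
  qed
  have "real (card Y) * ((r/2) ^ DIM('a) * ?v) = (\<Sum>y\<in>Y. measure lborel (cball y (r/2)))"
    using r by (simp add: content_cball_scale[where r = "r/2"])
  also have "\<dots> = measure lborel (\<Union>y\<in>Y. cball y (r/2))"
    using Y(1) dj by (intro measure_finite_Union[symmetric]) (auto simp: less_imp_neq[OF emeasure_lborel_cball_finite, simplified])
  also have "\<dots> \<le> measure lborel (cball z (R + r/2))"
  proof (intro measure_mono_fmeasurable)
    show "(\<Union>y\<in>Y. cball y (r/2)) \<subseteq> cball z (R + r/2)"
    proof clarify
      fix y x assume "y \<in> Y" "x \<in> cball y (r/2)"
      then show "x \<in> cball z (R + r/2)" using Y(3) dist_triangle[of z x y] by auto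
    qed
  qed (use Y in \<open>auto intro!: fmeasurableI simp: emeasure_lborel_cball_finite[simplified]\<close>)
  also have "\<dots> = (R + r/2) ^ DIM('a) * ?v" using r by (intro content_cball_scale) simp
  finally have "real (card Y) * (r/2) ^ DIM('a) \<le> (R + r/2) ^ DIM('a)" using v by (simp add: mult.assoc[symmetric])
  then have "real (card Y) \<le> (R + r/2) ^ DIM('a) / (r/2) ^ DIM('a)" using r by (simp add: pos_le_divide_eq)
  also have "\<dots> = (2 * R / r + 1) ^ DIM('a)" 
  proof -
    have "(R + r/2) / (r/2) = 2 * R / r + 1" using r by (simp add: field_simps)
    then show ?thesis by (simp add: power_divide[symmetric])
  qed
  finally show ?thesis .
qed

text \<open>A separated subset of largest cardinality, which exists by the volume bound, cannot be
  enlarged and hence is a net.\<close>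

lemma separated_net:
  fixes S :: "'a::euclidean_space set"
  assumes S: "S \<subseteq> cball 0 R" and r: "0 < r" "0 \<le> R"
  obtains Y where "finite Y" "Y \<subseteq> S" "pairwise (\<lambda>x y. r < dist x y) Y" "S \<subseteq> (\<Union>y\<in>Y. cball y r)"
    "real (card Y) \<le> (2 * R / r + 1) ^ DIM('a)"
proof -
  define P where "P Y \<longleftrightarrow> finite Y \<and> Y \<subseteq> S \<and> pairwise (\<lambda>x y. r < dist x y) Y" for Y
  have le: "real (card Y) \<le> (2 * R / r + 1) ^ DIM('a)" if "P Y" for Y
    using that S r by (intro card_separated_le[where z = 0]) (auto simp: P_def)
  have "P {}" by (simp add: P_def)
  moreover have "\<forall>Y. P Y \<longrightarrow> card Y \<le> nat \<lfloor>(2 * R / r + 1) ^ DIM('a)\<rfloor>" using le by (auto simp: le_nat_floor)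
  ultimately obtain Y where Y: "P Y" "\<And>Z. P Z \<Longrightarrow> card Z \<le> card Y" using ex_has_greatest_nat[of P "{}" card "Suc (nat \<lfloor>(2 * R / r + 1) ^ DIM('a)\<rfloor>)"] by (metis le_imp_less_Suc)
  have "S \<subseteq> (\<Union>y\<in>Y. cball y r)"
  proof
    fix x assume x: "x \<in> S"
    show "x \<in> (\<Union>y\<in>Y. cball y r)"
    proof (rule ccontr)
      assume n: "x \<notin> (\<Union>y\<in>Y. cball y r)"
      then have far: "r < dist y x" if "y \<in> Y" for y using that by force
      have "x \<notin> Y" using n r by auto
      moreover have "P (insert x Y)" using Y(1) x far
        by (auto simp: P_def pairwise_insert dist_commute)
      ultimately show False using Y(2)[of "insert x Y"] Y(1) by (simp add: P_def)
    qed
  qed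
  then show ?thesis using that[of Y] Y(1) le by (auto simp: P_def)
qed

text \<open>Take a point with largest f, discard its at most K related points, repeat. Discarded
  values are charged to the chosen point, which loses only the factor K. It serves to turn a net
  into a packing.\<close>

lemma greedy_selection:
  fixes f :: "'b \<Rightarrow> real"
  assumes "finite Y" "\<And>y. y \<in> Y \<Longrightarrow> 0 \<le> f y" "\<And>x. x \<in> Y \<Longrightarrow> R x x" "symp R"
    and "\<And>x. x \<in> Y \<Longrightarrow> real (card {y\<in>Y. R x y}) \<le> K" "0 \<le> K"
  shows "\<exists>X\<subseteq>Y. pairwise (\<lambda>x y. \<not> R x y) X \<and> sum f Y \<le> K * sum f X"
  using assms
proof (induction "card Y" arbitrary: Y rule: less_induct)
  case (less Y)
  show ?case
  proof (cases "Y = {}")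
    case False
    then obtain x where x: "x \<in> Y" and xmax: "\<And>y. y \<in> Y \<Longrightarrow> f y \<le> f x"
      using Max_in[of "f ` Y"] Max_ge[of "f ` Y"] less.prems(1) by fastforce
    define Z where "Z = {y\<in>Y. \<not> R x y}"
    have Z: "Z \<subset> Y" using x less.prems(3) by (auto simp: Z_def)
    have "real (card {y\<in>Z. R z y}) \<le> K" if "z \<in> Z" for z
    proof -
      have "card {y\<in>Z. R z y} \<le> card {y\<in>Y. R z y}" using Z less.prems(1) by (intro card_mono) auto
      then show ?thesis using less.prems(5)[of z] that Z by force
    qed
    moreover have "card Z < card Y" using Z less.prems(1) psubset_card_mono by blast
    moreover have "finite Z" using Z less.prems(1) finite_subset by blast
    ultimately obtain X where X: "X \<subseteq> Z" "pairwise (\<lambda>x y. \<not> R x y) X" "sum f Z \<le> K * sum f X"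
      using less.hyps[of Z] less.prems Z by blast
    have "sum f Y = sum f {y\<in>Y. R x y} + sum f Z"
      using less.prems(1) by (subst sum.union_disjoint[symmetric]) (auto simp: Z_def intro!: sum.cong)
    also have "\<dots> \<le> real (card {y\<in>Y. R x y}) * f x + K * sum f X"
      using X xmax sum_bounded_above[of "{y\<in>Y. R x y}" f "f x"] by auto
    also have "\<dots> \<le> K * f x + K * sum f X"
      using less.prems(5)[OF x] less.prems(2)[OF x] by (intro add_mono mult_right_mono order_refl)
    also have "\<dots> = K * sum f (insert x X)"
    proof -
      have "x \<notin> X" "finite X" using X(1) x less.prems(1,3) by (auto simp: Z_def intro: finite_subset)
      then show ?thesis by (simp add: algebra_simps)
    qed
    finally have "sum f Y \<le> K * sum f (insert x X)" .
    moreover have "pairwise (\<lambda>x y. \<not> R x y) (insert x X)"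
      using X(1,2) less.prems(4) by (auto simp: pairwise_insert Z_def dest: sympD)
    moreover have "insert x X \<subseteq> Y" using x X(1) Z by auto
    ultimately show ?thesis by blast
  qed simp
qed

section \<open>Energies against packing sums\<close>

definition corr_integral :: "'a::euclidean_space measure \<Rightarrow> real \<Rightarrow> real \<Rightarrow> ennreal" where
  "corr_integral \<mu> q r = (\<integral>\<^sup>+x. ennreal (measure \<mu> (cball x r) powr (q - 1)) \<partial>\<mu>)"

definition packing_sup :: "'a::euclidean_space measure \<Rightarrow> real \<Rightarrow> real \<Rightarrow> real" where
  "packing_sup \<mu> q r = (SUP X\<in>ball_packings \<mu> r. \<Sum>x\<in>X. measure \<mu> (cball x r) powr q)"

text \<open>A power law for the energy with a uniform constant. For q >= 1 and bounded support it
  lies between t < \<open>Lq_spectrum\<close> and t <= \<open>Lq_spectrum\<close>.\<close>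

definition corr_decay :: "'a::euclidean_space measure \<Rightarrow> real \<Rightarrow> real \<Rightarrow> bool" where
  "corr_decay \<mu> q t \<longleftrightarrow> (\<exists>C>0. \<exists>r0>0. \<forall>r. 0 < r \<longrightarrow> r < r0 \<longrightarrow> corr_integral \<mu> q r \<le> ennreal (C * r powr t))"

lemma corr_decayI:
  "0 < C \<Longrightarrow> 0 < r0 \<Longrightarrow> (\<And>r. 0 < r \<Longrightarrow> r < r0 \<Longrightarrow> corr_integral \<mu> q r \<le> ennreal (C * r powr t)) \<Longrightarrow> corr_decay \<mu> q t"
  unfolding corr_decay_def by blast

lemma cball_subset_cball: "dist x y \<le> s \<Longrightarrow> s + r \<le> R \<Longrightarrow> cball x r \<subseteq> cball (y :: 'a::metric_space) R"
proof
  fix z assume "dist x y \<le> s" "s + r \<le> R" "z \<in> cball x r"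
  then show "z \<in> cball y R" using dist_triangle[of y z x] by (simp add: dist_commute)
qed

locale borel_prob = prob_space \<mu> for \<mu> :: "'a::euclidean_space measure" +
  assumes sets_eq [measurable_cong, simp]: "sets \<mu> = sets borel"
begin

lemma space_eq [simp]: "space \<mu> = UNIV"
  using sets_eq_imp_space_eq[OF sets_eq] by simp

text \<open>The complement of the support is covered by the null sets of a countable basis.\<close>

lemma AE_support: "AE x in \<mu>. x \<in> measure_support \<mu>"
proof -
  obtain B :: "'a set set" where B: "countable B" "topological_basis B"
    using ex_countable_basis by blast
  define N where "N = {b\<in>B. emeasure \<mu> b = 0}"
  have "\<Union>N \<in> null_sets \<mu>"
  proof (rule null_sets_UN'[of N id, simplified])
    show "countable N" using B(1) by (simp add: N_def)
    show "b \<in> null_sets \<mu>" if "b \<in> N" for b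
      using that topological_basis_open[OF B(2)] by (auto simp: N_def null_sets_def)
  qed
  moreover have "{x \<in> space \<mu>. x \<notin> measure_support \<mu>} \<subseteq> \<Union>N"
  proof
    fix x assume "x \<in> {x \<in> space \<mu>. x \<notin> measure_support \<mu>}"
    then obtain U where U: "open U" "x \<in> U" "emeasure \<mu> U = 0" by (auto simp: measure_support_def)
    then obtain b where b: "b \<in> B" "x \<in> b" "b \<subseteq> U" using topological_basisE[OF B(2)] by metis
    have "emeasure \<mu> b \<le> emeasure \<mu> U" using b U by (intro emeasure_mono) auto
    then show "x \<in> \<Union>N" using b U by (auto simp: N_def)
  qed
  ultimately show ?thesis by (rule AE_I')
qed

lemma support_cball_pos: "x \<in> measure_support \<mu> \<Longrightarrow> 0 < r \<Longrightarrow> 0 < prob (cball x r)"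
proof -
  assume x: "x \<in> measure_support \<mu>" "0 < r"
  then have "0 < emeasure \<mu> (ball x r)" by (auto simp: measure_support_def)
  also have "\<dots> \<le> emeasure \<mu> (cball x r)" by (intro emeasure_mono) auto
  finally show ?thesis by (simp add: emeasure_eq_measure)
qed

lemma support_nonempty: "measure_support \<mu> \<noteq> {}"
proof
  assume "measure_support \<mu> = {}"
  then have "AE x in \<mu>. False" using AE_support by simp
  then show False by (simp add: AE_False)
qed

lemma measurable_prob_cball [measurable]: "(\<lambda>x. prob (cball x r)) \<in> borel_measurable borel"
proof -
  have "closed {z :: 'a \<times> 'a. dist (fst z) (snd z) \<le> r}"
    by (intro closed_Collect_le continuous_intros)
  then have "{z :: 'a \<times> 'a. dist (fst z) (snd z) \<le> r} \<in> sets borel" by (rule borel_closed)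
  moreover have "sets (borel \<Otimes>\<^sub>M \<mu>) = sets (borel :: ('a \<times> 'a) measure)"
    unfolding borel_prod[symmetric] by (intro sets_pair_measure_cong) simp_all
  ultimately have "{z :: 'a \<times> 'a. dist (fst z) (snd z) \<le> r} \<in> sets (borel \<Otimes>\<^sub>M \<mu>)" by simp
  then have "(\<lambda>x. emeasure \<mu> (Pair x -` {z :: 'a \<times> 'a. dist (fst z) (snd z) \<le> r})) \<in> borel_measurable borel"
    by (rule measurable_emeasure_Pair)
  also have "(\<lambda>x. Pair x -` {z :: 'a \<times> 'a. dist (fst z) (snd z) \<le> r}) = (\<lambda>x. cball x r)" by auto
  finally have "(\<lambda>x. emeasure \<mu> (cball x r)) \<in> borel_measurable borel" .
  then show ?thesis unfolding measure_def by (rule borel_measurable_enn2real)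
qed

text \<open>For y in B(x,r) the ball B(y,2r) contains B(x,r); as the balls B(x,r) are disjoint, the
  integrals over them add up to at most one energy.\<close>

lemma packing_sum_le_corr:
  assumes "1 \<le> q" "X \<in> ball_packings \<mu> r"
  shows "ennreal (\<Sum>x\<in>X. prob (cball x r) powr q) \<le> corr_integral \<mu> q (2 * r)"
proof -
  have X: "finite X" "disjoint_family_on (\<lambda>x. cball x r) X" using assms(2) by (auto simp: ball_packings_def)
  have "ennreal (\<Sum>x\<in>X. prob (cball x r) powr q) = (\<Sum>x\<in>X. ennreal (prob (cball x r) powr (q - 1)) * emeasure \<mu> (cball x r))"
  proof -
    have "prob (cball x r) powr q = prob (cball x r) powr (q - 1) * prob (cball x r)" for x
      by (cases "prob (cball x r) = 0") (auto simp: powr_diff)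
    then show ?thesis by (simp add: sum_ennreal[symmetric] ennreal_mult emeasure_eq_measure)
  qed
  also have "\<dots> = (\<Sum>x\<in>X. \<integral>\<^sup>+y. ennreal (prob (cball x r) powr (q - 1)) * indicator (cball x r) y \<partial>\<mu>)"
    by (simp add: nn_integral_cmult_indicator)
  also have "\<dots> \<le> (\<Sum>x\<in>X. \<integral>\<^sup>+y. ennreal (prob (cball y (2 * r)) powr (q - 1)) * indicator (cball x r) y \<partial>\<mu>)"
  proof (intro sum_mono nn_integral_mono)
    fix x y
    show "ennreal (prob (cball x r) powr (q - 1)) * indicator (cball x r) y
       \<le> ennreal (prob (cball y (2 * r)) powr (q - 1)) * indicator (cball x r) y"
    proof (cases "y \<in> cball x r")
      case True
      then have "prob (cball x r) \<le> prob (cball y (2 * r))"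
        by (intro finite_measure_mono cball_subset_cball[of _ _ r]) auto
      then show ?thesis using assms(1) by (intro mult_right_mono ennreal_leI powr_mono2) auto
    qed simp
  qed
  also have "\<dots> = (\<integral>\<^sup>+y. ennreal (prob (cball y (2 * r)) powr (q - 1)) * indicator (\<Union>x\<in>X. cball x r) y \<partial>\<mu>)"
    using X by (subst nn_integral_sum[symmetric]) (measurable, auto simp: sum_distrib_left[symmetric] indicator_UN_disjoint)
  also have "\<dots> \<le> corr_integral \<mu> q (2 * r)" unfolding corr_integral_def
    by (intro nn_integral_mono) (auto simp: indicator_def)
  finally show ?thesis .
qed

lemma corr_integral_le_1: "1 \<le> q \<Longrightarrow> corr_integral \<mu> q r \<le> 1"
proof -
  assume q: "1 \<le> q"
  have "corr_integral \<mu> q r \<le> (\<integral>\<^sup>+x. 1 \<partial>\<mu>)" unfolding corr_integral_def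
    using q by (intro nn_integral_mono) (auto intro!: powr_le1)
  then show ?thesis using emeasure_space_1 by simp
qed

text \<open>The bound 1 for all packing sums is what makes the real-valued \<open>SUP\<close> in
  \<open>packing_sup\<close> a true supremum.\<close>

lemma packing_sup_upper:
  assumes "1 \<le> q" "X \<in> ball_packings \<mu> r"
  shows "(\<Sum>x\<in>X. prob (cball x r) powr q) \<le> packing_sup \<mu> q r"
  unfolding packing_sup_def
proof (rule cSUP_upper[OF assms(2)])
  show "bdd_above ((\<lambda>X. \<Sum>x\<in>X. prob (cball x r) powr q) ` ball_packings \<mu> r)"
  proof (intro bdd_aboveI[of _ 1]; clarify)
    fix X assume "X \<in> ball_packings \<mu> r"
    then have "ennreal (\<Sum>x\<in>X. prob (cball x r) powr q) \<le> 1"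
      using packing_sum_le_corr[OF assms(1)] corr_integral_le_1[OF assms(1)] order_trans by blast
    then show "(\<Sum>x\<in>X. prob (cball x r) powr q) \<le> 1" by (simp add: ennreal_le_1)
  qed
qed

lemma packing_sup_le_corr:
  assumes "1 \<le> q" "corr_integral \<mu> q (2 * r) \<le> ennreal K" "0 \<le> K"
  shows "packing_sup \<mu> q r \<le> K"
  unfolding packing_sup_def
proof (rule cSUP_least)
  have "{} \<in> ball_packings \<mu> r" by (simp add: ball_packings_def disjoint_family_on_def)
  then show "ball_packings \<mu> r \<noteq> {}" by blast
  fix X assume "X \<in> ball_packings \<mu> r"
  then have "ennreal (\<Sum>x\<in>X. prob (cball x r) powr q) \<le> ennreal K"
    using packing_sum_le_corr[OF assms(1)] assms(2) order_trans by blast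
  then show "(\<Sum>x\<in>X. prob (cball x r) powr q) \<le> K" using assms(3) by (simp add: ennreal_le_iff)
qed

lemma packing_sup_pos: "1 \<le> q \<Longrightarrow> 0 < r \<Longrightarrow> 0 < packing_sup \<mu> q r"
proof -
  assume qr: "1 \<le> q" "0 < r"
  obtain x where x: "x \<in> measure_support \<mu>" using support_nonempty by blast
  have "0 < prob (cball x r)" using support_cball_pos[OF x qr(2)] .
  then have "0 < (\<Sum>x\<in>{x}. prob (cball x r) powr q)" by simp
  also have "\<dots> \<le> packing_sup \<mu> q r"
    using x by (intro packing_sup_upper[OF qr(1)]) (auto simp: ball_packings_def disjoint_family_on_def)
  finally show ?thesis .
qed

text \<open>The energy is bounded by a sum over an r-net whose 2r-balls may overlap; a greedy choice
  of points more than 4r apart makes them disjoint. Within distance 4r of a point the net has at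
  most (2 * 4 + 1)^d = 9^d points.\<close>

lemma corr_le_packing_sup:
  assumes q: "1 \<le> q" and r: "0 < r" and supp: "measure_support \<mu> \<subseteq> cball 0 R" "0 \<le> R"
  shows "corr_integral \<mu> q r \<le> ennreal (9 ^ DIM('a) * packing_sup \<mu> q (2 * r))"
proof -
  obtain Y where Y: "finite Y" "Y \<subseteq> measure_support \<mu>" "pairwise (\<lambda>x y. r < dist x y) Y" "measure_support \<mu> \<subseteq> (\<Union>y\<in>Y. cball y r)"
    using separated_net[OF supp(1) r supp(2)] by metis
  let ?f = "\<lambda>y. prob (cball y (2 * r)) powr q"
  have "corr_integral \<mu> q r \<le> (\<integral>\<^sup>+x. (\<Sum>y\<in>Y. ennreal (prob (cball y (2 * r)) powr (q - 1)) * indicator (cball y r) x) \<partial>\<mu>)"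
    unfolding corr_integral_def
  proof (intro nn_integral_mono_AE)
    show "AE x in \<mu>. ennreal (prob (cball x r) powr (q - 1)) \<le> (\<Sum>y\<in>Y. ennreal (prob (cball y (2 * r)) powr (q - 1)) * indicator (cball y r) x)"
      using AE_support
    proof eventually_elim
      case (elim x)
      then obtain y where y: "y \<in> Y" "x \<in> cball y r" using Y(4) by blast
      then have "prob (cball x r) \<le> prob (cball y (2 * r))"
        by (intro finite_measure_mono cball_subset_cball[of _ _ r]) (auto simp: dist_commute)
      then have "ennreal (prob (cball x r) powr (q - 1)) \<le> ennreal (prob (cball y (2 * r)) powr (q - 1)) * indicator (cball y r) x"
        using q y by (auto intro!: ennreal_leI powr_mono2)
      also have "\<dots> \<le> (\<Sum>y\<in>Y. ennreal (prob (cball y (2 * r)) powr (q - 1)) * indicator (cball y r) x)"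
        using y Y(1) by (intro member_le_sum) auto
      finally show ?case .
    qed
  qed
  also have "\<dots> = (\<Sum>y\<in>Y. \<integral>\<^sup>+x. ennreal (prob (cball y (2 * r)) powr (q - 1)) * indicator (cball y r) x \<partial>\<mu>)"
    by (intro nn_integral_sum borel_measurable_times_ennreal borel_measurable_const borel_measurable_indicator) simp
  also have "\<dots> = (\<Sum>y\<in>Y. ennreal (prob (cball y (2 * r)) powr (q - 1)) * emeasure \<mu> (cball y r))"
    by (intro sum.cong refl nn_integral_cmult_indicator) simp
  also have "\<dots> \<le> (\<Sum>y\<in>Y. ennreal (?f y))"
  proof (intro sum_mono)
    fix y
    have "prob (cball y (2 * r)) powr (q - 1) * prob (cball y r) \<le> prob (cball y (2 * r)) powr (q - 1) * prob (cball y (2 * r))"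
      using r by (intro mult_left_mono finite_measure_mono) auto
    also have "\<dots> = ?f y" by (cases "prob (cball y (2 * r)) = 0") (auto simp: powr_diff)
    finally show "ennreal (prob (cball y (2 * r)) powr (q - 1)) * emeasure \<mu> (cball y r) \<le> ennreal (?f y)"
      by (simp add: emeasure_eq_measure ennreal_mult[symmetric] ennreal_leI)
  qed
  also have "\<dots> = ennreal (\<Sum>y\<in>Y. ?f y)" by (simp add: sum_ennreal)
  also have "(\<Sum>y\<in>Y. ?f y) \<le> 9 ^ DIM('a) * packing_sup \<mu> q (2 * r)"
  proof -
    have "\<exists>X\<subseteq>Y. pairwise (\<lambda>x y. \<not> dist x y \<le> 4 * r) X \<and> sum ?f Y \<le> 9 ^ DIM('a) * sum ?f X"
    proof (rule greedy_selection[OF Y(1)])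
      show "symp (\<lambda>x y. dist x y \<le> 4 * r)" by (auto simp: symp_def dist_commute)
      show "real (card {y\<in>Y. dist x y \<le> 4 * r}) \<le> 9 ^ DIM('a)" if "x \<in> Y" for x
      proof -
        have "{y\<in>Y. dist x y \<le> 4 * r} \<subseteq> cball x (4 * r)" by auto
        then show ?thesis using card_separated_le[of "{y\<in>Y. dist x y \<le> 4 * r}" r x "4 * r"] Y(1,3) r
          by (simp add: pairwise_def)
      qed
    qed (use r in auto)
    then obtain X where X: "X \<subseteq> Y" "pairwise (\<lambda>x y. \<not> dist x y \<le> 4 * r) X" "sum ?f Y \<le> 9 ^ DIM('a) * sum ?f X" by blast
    have "X \<in> ball_packings \<mu> (2 * r)" unfolding ball_packings_def disjoint_family_on_def
    proof (intro CollectI conjI ballI impI)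
      show "finite X" "X \<subseteq> measure_support \<mu>" using X(1) Y finite_subset by auto
      show "cball x (2 * r) \<inter> cball y (2 * r) = {}" if "x \<in> X" "y \<in> X" "x \<noteq> y" for x y
        using X(2) that by (intro disjoint_cballI) (force simp: pairwise_def not_le)
    qed
    then have "sum ?f X \<le> packing_sup \<mu> q (2 * r)" by (rule packing_sup_upper[OF q])
    then show ?thesis using X(3) by (smt (verit) mult_left_mono zero_le_power)
  qed
  finally show ?thesis by (simp add: ennreal_leI)
qed

text \<open>Points whose ball has mass below 1/(2N) carry at most half of the measure, because at
  most N balls of radius r/2 cover the support; on the rest the integrand is at least
  (1/(2N))^(q-1).\<close>

lemma corr_integral_ge:
  assumes q: "1 \<le> q" and r: "0 < r" "r \<le> 1" and supp: "measure_support \<mu> \<subseteq> cball 0 R" "0 \<le> R"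
  defines "N \<equiv> ((4 * R + 1) / r) ^ DIM('a)"
  shows "ennreal (1 / 2 * (1 / (2 * N)) powr (q - 1)) \<le> corr_integral \<mu> q r"
proof -
  have N: "0 < N" unfolding N_def using r supp by (intro zero_less_power) auto
  obtain Y where Y: "finite Y" "measure_support \<mu> \<subseteq> (\<Union>y\<in>Y. cball y (r/2))" "real (card Y) \<le> (2 * R / (r/2) + 1) ^ DIM('a)"
    using separated_net[OF supp(1), of "r/2"] r supp(2) by (metis half_gt_zero)
  have "(2 * R / (r/2) + 1) ^ DIM('a) \<le> N" unfolding N_def
    using r supp(2) by (intro power_mono) (auto simp: field_simps)
  then have cY: "real (card Y) \<le> N" using Y(3) by simp
  define A where "A = {x. prob (cball x r) < 1 / (2 * N)}"
  have A[measurable]: "A \<in> sets borel" unfolding A_def by measurable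
  define Z where "Z = {y\<in>Y. cball y (r/2) \<inter> A \<noteq> {}}"
  have Z: "finite Z" "card Z \<le> card Y" using Y(1) by (auto simp: Z_def card_mono)
  have "prob A \<le> prob (\<Union>y\<in>Z. cball y (r/2))"
  proof (rule finite_measure_mono_AE)
    show "AE x in \<mu>. x \<in> A \<longrightarrow> x \<in> (\<Union>y\<in>Z. cball y (r/2))"
      using AE_support by eventually_elim (use Y(2) in \<open>fastforce simp: Z_def\<close>)
  qed (use Z in auto)
  also have "\<dots> \<le> (\<Sum>y\<in>Z. prob (cball y (r/2)))"
    using Z by (intro finite_measure_subadditive_finite) auto
  also have "\<dots> \<le> (\<Sum>y\<in>Z. 1 / (2 * N))"
  proof (intro sum_mono)
    fix y assume "y \<in> Z"
    then obtain x where x: "x \<in> cball y (r/2)" "x \<in> A" by (auto simp: Z_def)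
    then have "prob (cball y (r/2)) \<le> prob (cball x r)"
      by (intro finite_measure_mono cball_subset_cball[of _ _ "r/2"]) auto
    then show "prob (cball y (r/2)) \<le> 1 / (2 * N)" using x(2) by (simp add: A_def)
  qed
  also have "\<dots> \<le> 1 / 2" using cY Z(2) N by (simp add: divide_le_eq)
  finally have "1 / 2 \<le> prob (UNIV - A)" using prob_compl[of A] by simp
  then have "1 / 2 * (1 / (2 * N)) powr (q - 1) \<le> prob (UNIV - A) * (1 / (2 * N)) powr (q - 1)"
    by (rule mult_right_mono) simp
  then have "ennreal (1 / 2 * (1 / (2 * N)) powr (q - 1)) \<le> emeasure \<mu> (UNIV - A) * ennreal ((1 / (2 * N)) powr (q - 1))"
    unfolding emeasure_eq_measure by (subst ennreal_mult[symmetric]) (simp_all only: ennreal_leI measure_nonneg powr_ge_zero)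
  also have "\<dots> = (\<integral>\<^sup>+x. ennreal ((1 / (2 * N)) powr (q - 1)) * indicator (UNIV - A) x \<partial>\<mu>)"
    by (subst nn_integral_cmult_indicator) (simp_all add: mult.commute)
  also have "\<dots> \<le> corr_integral \<mu> q r" unfolding corr_integral_def
    using N q by (intro nn_integral_mono) (auto simp: A_def indicator_def intro!: ennreal_leI powr_mono2)
  finally show ?thesis .
qed

lemma Lq_spectrum_eq: "Lq_spectrum \<mu> q = Liminf (at_right 0) (\<lambda>r. ereal (ln (packing_sup \<mu> q r) / ln r))"
  by (simp add: Lq_spectrum_def packing_sup_def)

text \<open>The constant and the factor 2 in the radius disappear in ln K / ln r, which tends to
  0.\<close>

lemma Lq_spectrum_ge:
  assumes q: "1 \<le> q" and dec: "corr_decay \<mu> q t"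
  shows "ereal t \<le> Lq_spectrum \<mu> q"
proof -
  from dec obtain C r0 where C: "0 < C" "0 < r0" "\<And>r. 0 < r \<Longrightarrow> r < r0 \<Longrightarrow> corr_integral \<mu> q r \<le> ennreal (C * r powr t)"
    unfolding corr_decay_def by blast
  define K where "K = C * 2 powr t"
  have K: "0 < K" using C by (simp add: K_def)
  have "((\<lambda>r. t + ln K / ln r) \<longlongrightarrow> t + 0) (at_right 0)"
    by (intro tendsto_intros tendsto_divide_0[OF tendsto_const] filterlim_at_infinity_imp_norm_at_top
        filterlim_mono[OF ln_at_0 at_bot_le_at_infinity order_refl])
  then have "((\<lambda>r. ereal (t + ln K / ln r)) \<longlongrightarrow> ereal t) (at_right 0)" by simp
  then have "ereal t = Liminf (at_right 0) (\<lambda>r. ereal (t + ln K / ln r))"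
    by (intro lim_imp_Liminf[symmetric]) auto
  also have "\<dots> \<le> Lq_spectrum \<mu> q" unfolding Lq_spectrum_eq
  proof (rule Liminf_mono)
    have "\<forall>\<^sub>F r in at_right (0::real). 0 < r \<and> r < min 1 (r0 / 2)"
      using C by (intro eventually_conj eventually_at_right_less eventually_at_rightI[of 0 "min 1 (r0/2)"]) auto
    then show "\<forall>\<^sub>F r in at_right 0. ereal (t + ln K / ln r) \<le> ereal (ln (packing_sup \<mu> q r) / ln r)"
    proof eventually_elim
      case (elim r)
      then have r: "0 < r" "r < 1" "2 * r < r0" by auto
      have "packing_sup \<mu> q r \<le> C * (2 * r) powr t"
        using C(1) C(3)[of "2 * r"] r by (intro packing_sup_le_corr[OF q]) auto
      also have "\<dots> = K * r powr t" using r by (simp add: K_def powr_mult)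
      finally have "ln (packing_sup \<mu> q r) \<le> ln (K * r powr t)"
        using packing_sup_pos[OF q r(1)] K r by (subst ln_le_cancel_iff) auto
      also have "\<dots> = ln K + t * ln r" using K r by (simp add: ln_mult ln_powr)
      finally have "(ln K + t * ln r) / ln r \<le> ln (packing_sup \<mu> q r) / ln r"
        using r by (intro divide_right_mono_neg) auto
      moreover have "(ln K + t * ln r) / ln r = t + ln K / ln r" using r by (simp add: field_simps)
      ultimately show ?case by simp
    qed
  qed
  finally show ?thesis .
qed

text \<open>A strict bound on the lower limit holds for all small r, where ln r < 0 turns it into
  \<open>packing_sup\<close> <= r^t; the net estimate then passes to the energy at half the
  radius.\<close>

lemma corr_decay_of_less_Lq:
  assumes q: "1 \<le> q" and less: "ereal t < Lq_spectrum \<mu> q" and supp: "measure_support \<mu> \<subseteq> cball 0 R" "0 \<le> R"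
  shows "corr_decay \<mu> q t"
proof -
  have "\<forall>\<^sub>F r in at_right 0. ereal t < ereal (ln (packing_sup \<mu> q r) / ln r)"
    using less unfolding Lq_spectrum_eq by (rule less_LiminfD)
  then obtain r1 where r1: "0 < r1" "\<And>r. 0 < r \<Longrightarrow> r < r1 \<Longrightarrow> t < ln (packing_sup \<mu> q r) / ln r"
    unfolding eventually_at_right_field by auto
  have ps: "packing_sup \<mu> q r \<le> r powr t" if r: "0 < r" "r < r1" "r < 1" for r
  proof -
    have "ln (packing_sup \<mu> q r) < t * ln r"
      using r1(2)[OF r(1,2)] r by (simp add: neg_less_divide_eq)
    then have "ln (packing_sup \<mu> q r) \<le> ln (r powr t)" using r by (simp add: ln_powr)
    then show ?thesis using packing_sup_pos[OF q r(1)] r ln_le_cancel_iff[of "packing_sup \<mu> q r" "r powr t"] by simp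
  qed
  show ?thesis
  proof (rule corr_decayI[of "9 ^ DIM('a) * 2 powr t" "min (r1/2) (1/2)"])
    show "0 < min (r1/2) (1/2)" using r1(1) by simp
    fix r :: real assume r: "0 < r" "r < min (r1/2) (1/2)"
    have "corr_integral \<mu> q r \<le> ennreal (9 ^ DIM('a) * packing_sup \<mu> q (2 * r))"
      by (rule corr_le_packing_sup[OF q r(1) supp])
    also have "\<dots> \<le> ennreal (9 ^ DIM('a) * (2 * r) powr t)"
      using ps[of "2 * r"] r by (intro ennreal_leI mult_left_mono) auto
    also have "\<dots> = ennreal (9 ^ DIM('a) * 2 powr t * r powr t)" using r by (simp add: powr_mult mult.assoc)
    finally show "corr_integral \<mu> q r \<le> ennreal (9 ^ DIM('a) * 2 powr t * r powr t)" .
  qed simp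
qed

text \<open>Masses are at most 1, so the integrand decreases in q; this carries almost sure decay
  from rational q to larger real q.\<close>

lemma corr_decay_mono:
  assumes "1 \<le> q" "q \<le> q'" "corr_decay \<mu> q t"
  shows "corr_decay \<mu> q' t"
proof -
  have "corr_integral \<mu> q' r \<le> corr_integral \<mu> q r" for r unfolding corr_integral_def
    using assms(1,2) by (intro nn_integral_mono ennreal_leI powr_mono') auto
  then show ?thesis using assms(3) unfolding corr_decay_def by (meson order_trans)
qed

text \<open>The energy of a boundedly supported measure is at least of order r^(d(q-1)), so it
  cannot decay faster. This accounts for the cap d in tau.\<close>

lemma corr_decay_upper:
  assumes q: "1 < q" and dec: "corr_decay \<mu> q t" and supp: "measure_support \<mu> \<subseteq> cball 0 R" "0 \<le> R"
  shows "t \<le> real DIM('a) * (q - 1)"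
proof (rule ccontr)
  assume "\<not> t \<le> real DIM('a) * (q - 1)"
  then have pos: "0 < t - real DIM('a) * (q - 1)" by simp
  from dec obtain C r0 where C: "0 < C" "0 < r0" "\<And>r. 0 < r \<Longrightarrow> r < r0 \<Longrightarrow> corr_integral \<mu> q r \<le> ennreal (C * r powr t)"
    unfolding corr_decay_def by blast
  define c where "c = 1 / 2 * (1 / (2 * (4 * R + 1) ^ DIM('a))) powr (q - 1)"
  have c: "0 < c" using supp(2) by (auto simp: c_def intro!: mult_pos_pos divide_pos_pos)
  have "c \<le> C * r powr (t - real DIM('a) * (q - 1))" if r: "0 < r" "r < r0" "r \<le> 1" for r
  proof -
    have "1 / (2 * ((4 * R + 1) / r) ^ DIM('a)) = 1 / (2 * (4 * R + 1) ^ DIM('a)) * r powr real DIM('a)"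
      using r by (simp add: power_divide powr_realpow)
    moreover have "0 \<le> 1 / (2 * (4 * R + 1) ^ DIM('a))" using supp(2) by simp
    ultimately have "1 / 2 * (1 / (2 * ((4 * R + 1) / r) ^ DIM('a))) powr (q - 1) = c * (r powr real DIM('a)) powr (q - 1)"
      unfolding c_def by (simp only: powr_mult mult.assoc)
    then have eq: "1 / 2 * (1 / (2 * ((4 * R + 1) / r) ^ DIM('a))) powr (q - 1) = c * r powr (real DIM('a) * (q - 1))"
      by (simp add: powr_powr)
    have "ennreal (c * r powr (real DIM('a) * (q - 1))) \<le> ennreal (C * r powr t)"
      using corr_integral_ge[OF _ r(1,3) supp, of q] C(3)[OF r(1,2)] q unfolding eq by (auto intro: order_trans)
    then have "c * r powr (real DIM('a) * (q - 1)) \<le> C * r powr t" using C(1) by (simp add: ennreal_le_iff)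
    then have "c \<le> C * r powr t / r powr (real DIM('a) * (q - 1))" using r by (simp add: pos_le_divide_eq)
    then show ?thesis using r by (simp add: powr_diff)
  qed
  then have ev: "\<forall>\<^sub>F r in at_right 0. c \<le> C * r powr (t - real DIM('a) * (q - 1))"
    using C(2) by (intro eventually_at_rightI[of 0 "min r0 1"]) auto
  have "((\<lambda>r. C * r powr (t - real DIM('a) * (q - 1))) \<longlongrightarrow> C * 0 powr (t - real DIM('a) * (q - 1))) (at_right 0)"
    using pos by (intro tendsto_intros tendsto_powr') (auto simp: eventually_at_right_less less_imp_le intro: eventually_mono[OF eventually_at_right_less])
  then have "c \<le> C * 0 powr (t - real DIM('a) * (q - 1))"
    by (rule tendsto_lowerbound[OF _ ev]) simp
  then show False using c by simp
qed

end

section \<open>Coding map and self-affine measure\<close>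

lemma borel_measure_eqI_closed:
  fixes \<mu> \<nu> :: "'a::topological_space measure"
  assumes "sets \<mu> = sets borel" "sets \<nu> = sets borel" "finite_measure \<mu>"
    and "\<And>F. closed F \<Longrightarrow> emeasure \<mu> F = emeasure \<nu> F"
  shows "\<mu> = \<nu>"
proof (rule measure_eqI_generator_eq[of "Collect closed" UNIV _ _ "\<lambda>_. UNIV"])
  show "Int_stable (Collect closed :: 'a set set)" by (auto simp: Int_stable_def)
  show "sets \<mu> = sigma_sets UNIV (Collect closed)" "sets \<nu> = sigma_sets UNIV (Collect closed)"
    using assms(1,2) unfolding borel_eq_closed by auto
  show "emeasure \<mu> UNIV \<noteq> \<infinity>" for i :: nat using finite_measure.emeasure_finite[OF assms(3)] by simp
qed (use assms(4) in auto)

context affine_ifs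
begin

definition contr :: real where "contr = Max (range (\<lambda>i. onorm (T i)))"

lemma contr: "onorm (T i) \<le> contr" "0 \<le> contr" "contr < 1 / 2"
proof -
  show 1: "onorm (T i) \<le> contr" for i by (auto simp: contr_def intro: Max_ge)
  show "0 \<le> contr" using order_trans[OF onorm_pos_le[OF bounded_linear_T] 1] .
  show "contr < 1 / 2" unfolding contr_def by (subst Max_less_iff) (auto simp: onorm_T[simplified])
qed

lemma norm_T_le_contr: "norm (T i v) \<le> contr * norm v"
  by (rule order_trans[OF onorm[OF bounded_linear_T] mult_right_mono]) (use contr in auto)

lemma norm_W_le: "norm (W I v) \<le> contr ^ length I * norm v"
proof (induction I)
  case (Cons i I)
  have "norm (W (i # I) v) \<le> contr * norm (W I v)" using norm_T_le_contr by simp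
  also have "\<dots> \<le> contr * (contr ^ length I * norm v)" using Cons contr by (intro mult_left_mono) auto
  finally show ?case by simp
qed simp

text \<open>The point with address \<omega>, written as a series rather than as a limit of
  compositions so that its linearity in the translations a is visible.\<close>

definition coding :: "'a ^ 'm \<Rightarrow> 'm stream \<Rightarrow> 'a" where
  "coding a \<omega> = (\<Sum>k. W (stake k \<omega>) (a $ (\<omega> !! k)))"

lemma norm_coding_term:
  assumes "\<And>i. norm (a $ i) \<le> M"
  shows "norm (W (stake k \<omega>) (a $ (\<omega> !! k))) \<le> contr ^ k * M"
  using order_trans[OF norm_W_le[of "stake k \<omega>"] mult_left_mono[OF assms]] contr by simp

lemma summable_coding_bound: "summable (\<lambda>k. contr ^ k * M)"
  using contr by (intro summable_mult2 summable_geometric) auto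

lemma summable_coding: "summable (\<lambda>k. W (stake k \<omega>) (a $ (\<omega> !! k)))"
  by (rule summable_comparison_test'[OF summable_coding_bound norm_coding_term[OF Finite_Cartesian_Product.norm_nth_le]])

text \<open>The bound M concerns the components of a, not its norm: the perturbations used for
  transversality have components u and -u, each of norm |u|, while their norm as a vector is
  larger.\<close>

lemma norm_coding_le:
  assumes "\<And>i. norm (a $ i) \<le> M"
  shows "norm (coding a \<omega>) \<le> M / (1 - contr)"
proof -
  have "norm (coding a \<omega>) \<le> (\<Sum>k. contr ^ k * M)"
    unfolding coding_def by (rule norm_suminf_le[OF norm_coding_term[OF assms] summable_coding_bound])
  also have "\<dots> = M / (1 - contr)"
    using contr suminf_mult2[of "\<lambda>k. contr ^ k" M] summable_geometric[of contr] suminf_geometric[of contr] by auto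
  finally show ?thesis .
qed

lemma norm_coding: "norm (coding a \<omega>) \<le> 2 * norm a"
proof -
  have "norm (coding a \<omega>) \<le> norm a / (1 - contr)" by (rule norm_coding_le[OF Finite_Cartesian_Product.norm_nth_le])
  also have "\<dots> \<le> norm a / (1 / 2)" using contr by (intro divide_left_mono) auto
  finally show ?thesis by simp
qed

lemma coding_SCons: "coding a (i ## \<omega>) = T i (coding a \<omega>) + a $ i"
proof -
  have "coding a (i ## \<omega>) = (\<Sum>k. W (stake (Suc k) (i ## \<omega>)) (a $ ((i ## \<omega>) !! Suc k))) + a $ i"
    unfolding coding_def by (subst suminf_split_head[OF summable_coding]) simp
  also have "\<dots> = (\<Sum>k. T i (W (stake k \<omega>) (a $ (\<omega> !! k)))) + a $ i" by simp
  also have "\<dots> = T i (coding a \<omega>) + a $ i"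
    unfolding coding_def by (simp add: bounded_linear.suminf[OF bounded_linear_T summable_coding])
  finally show ?thesis .
qed

lemma coding_add: "coding (a + b) \<omega> = coding a \<omega> + coding b \<omega>"
  unfolding coding_def using linear_add[OF linear_W] by (simp add: suminf_add[OF summable_coding summable_coding])

text \<open>On a common prefix all translations cancel: only the linear part \<open>W I\<close> acts
  on the difference of the points coded by the tails.\<close>

lemma coding_shift_diff: "coding a (I @- x) - coding a (I @- y) = W I (coding a x - coding a y)"
  by (induction I) (auto simp: coding_SCons linear_diff[OF linear_T, symmetric])

section \<open>Bernoulli measure on streams and its image under the coding\<close>

definition bernoulli :: "'m stream measure" where
  "bernoulli = stream_space (measure_pmf (embed_pmf p))"

lemma pmf_embed_p: "pmf (embed_pmf p) i = p i"
  using p_pos sum_p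
  by (intro pmf_embed_pmf) (auto simp: less_imp_le nn_integral_count_space_finite sum_ennreal)

lemma sets_bernoulli [measurable_cong]: "sets bernoulli = sets (stream_space (count_space UNIV))"
  unfolding bernoulli_def by (intro sets_stream_space_cong) simp

lemma space_bernoulli [simp]: "space bernoulli = UNIV"
  by (simp add: bernoulli_def space_stream_space)

lemma prob_space_bernoulli: "prob_space bernoulli"
  unfolding bernoulli_def by (rule prob_space.prob_space_stream_space[OF prob_space_measure_pmf])

sublocale B: prob_space bernoulli
  by (rule prob_space_bernoulli)

lemma nn_integral_bernoulli:
  assumes "f \<in> borel_measurable bernoulli"
  shows "(\<integral>\<^sup>+\<omega>. f \<omega> \<partial>bernoulli) = (\<Sum>i\<in>UNIV. ennreal (p i) * (\<integral>\<^sup>+\<omega>. f (i ## \<omega>) \<partial>bernoulli))"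
proof -
  have "(\<integral>\<^sup>+\<omega>. f \<omega> \<partial>bernoulli) = (\<integral>\<^sup>+i. (\<integral>\<^sup>+\<omega>. f (i ## \<omega>) \<partial>bernoulli) \<partial>measure_pmf (embed_pmf p))"
    unfolding bernoulli_def
    by (rule prob_space.nn_integral_stream_space[OF prob_space_measure_pmf]) (use assms in \<open>simp add: bernoulli_def\<close>)
  also have "\<dots> = (\<Sum>i\<in>UNIV. ennreal (p i) * (\<integral>\<^sup>+\<omega>. f (i ## \<omega>) \<partial>bernoulli))"
    by (simp add: nn_integral_measure_pmf nn_integral_count_space_finite pmf_embed_p)
  finally show ?thesis .
qed

lemma measurable_SCons_bernoulli [measurable]: "(\<lambda>\<omega>. i ## \<omega>) \<in> measurable bernoulli bernoulli"
  by measurable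

lemma measurable_shift_bernoulli [measurable]: "(\<lambda>\<omega>. I @- \<omega>) \<in> measurable bernoulli bernoulli"
proof (induction I)
  case (Cons i I)
  show ?case using measurable_compose[OF Cons measurable_SCons_bernoulli[of i]] by simp
qed simp

lemma nn_integral_bernoulli_words:
  assumes "f \<in> borel_measurable bernoulli"
  shows "(\<integral>\<^sup>+\<omega>. f \<omega> \<partial>bernoulli) = (\<Sum>I | length I = n. ennreal (pw I) * (\<integral>\<^sup>+\<omega>. f (I @- \<omega>) \<partial>bernoulli))"
  using assms
proof (induction n arbitrary: f)
  case 0
  have "{I :: 'm list. length I = 0} = {[]}" by auto
  then show ?case by simp
next
  case (Suc n)
  have m: "(\<lambda>\<omega>. f (i ## \<omega>)) \<in> borel_measurable bernoulli" for i
    by (rule measurable_compose[OF measurable_SCons_bernoulli Suc.prems])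
  have "(\<integral>\<^sup>+\<omega>. f \<omega> \<partial>bernoulli) = (\<Sum>i\<in>UNIV. ennreal (p i) * (\<Sum>I | length I = n. ennreal (pw I) * (\<integral>\<^sup>+\<omega>. f (i ## (I @- \<omega>)) \<partial>bernoulli)))"
    by (simp add: nn_integral_bernoulli[OF Suc.prems] Suc.IH[OF m])
  also have "\<dots> = (\<Sum>I | length I = Suc n. ennreal (pw I) * (\<integral>\<^sup>+\<omega>. f (I @- \<omega>) \<partial>bernoulli))"
    by (simp add: sum_words_Suc sum_distrib_left mult.assoc[symmetric] ennreal_mult less_imp_le[OF p_pos] less_imp_le[OF pw_pos])
  finally show ?case .
qed

lemma nn_integral_bernoulli_stake:
  "(\<integral>\<^sup>+\<omega>. f (stake n \<omega>) \<partial>bernoulli) = (\<Sum>I | length I = n. ennreal (pw I) * f I)"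
proof -
  have [measurable]: "(\<lambda>\<omega>. f (stake n \<omega>)) \<in> borel_measurable bernoulli"
    by (rule measurable_compose[where N = "count_space UNIV"]) measurable
  have "(\<integral>\<^sup>+\<omega>. f (stake n \<omega>) \<partial>bernoulli) = (\<Sum>I | length I = n. ennreal (pw I) * (\<integral>\<^sup>+\<omega>. f (stake n (I @- \<omega>)) \<partial>bernoulli))"
    by (rule nn_integral_bernoulli_words) measurable
  also have "\<dots> = (\<Sum>I | length I = n. ennreal (pw I) * f I)"
    by (intro sum.cong refl) (auto simp: stake_shift B.emeasure_space_1[simplified])
  finally show ?thesis .
qed

text \<open>Joint measurability in translation and stream is what Fubini needs. Each term of the
  series depends on the stream through a finite prefix, that is, through countably many
  values.\<close>

lemma measurable_coding_pair [measurable]: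
  "(\<lambda>z. coding (fst z) (snd z)) \<in> borel_measurable (borel \<Otimes>\<^sub>M bernoulli)"
proof -
  have 1: "(\<lambda>a. W I (a $ j)) \<in> borel_measurable borel" for I j
    by (intro borel_measurable_continuous_onI continuous_intros
        linear_continuous_on_compose[OF _ linear_W] )
  have 2: "(\<lambda>z. W I (fst z $ j)) \<in> borel_measurable (borel \<Otimes>\<^sub>M bernoulli)" for I j
    by (rule measurable_compose[OF measurable_fst 1])
  have 3: "(\<lambda>z. W I (fst z $ (snd z !! k))) \<in> borel_measurable (borel \<Otimes>\<^sub>M bernoulli)" for I k
    by (rule measurable_compose_countable[OF 2]) measurable
  have 4: "(\<lambda>z. W (stake k (snd z)) (fst z $ (snd z !! k))) \<in> borel_measurable (borel \<Otimes>\<^sub>M bernoulli)" for k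
    by (rule measurable_compose_countable[OF 3]) measurable
  show ?thesis unfolding coding_def by (rule borel_measurable_suminf[OF 4])
qed

lemma measurable_coding [measurable]: "coding a \<in> borel_measurable bernoulli"
  using measurable_compose[OF measurable_Pair1' measurable_coding_pair, of a] by simp

text \<open>The image of the Bernoulli measure under the coding;
  \<open>self_affine_measure_eq\<close> identifies it with the measure that
  \<open>self_affine_measure\<close> selects by \<open>THE\<close>.\<close>

definition sam :: "'a ^ 'm \<Rightarrow> 'a measure" where
  "sam a = distr bernoulli borel (coding a)"

lemma borel_prob_sam: "borel_prob (sam a)"
  unfolding sam_def borel_prob_def borel_prob_axioms_def
  by (simp add: B.prob_space_distr)

abbreviation ifs_map :: "'a ^ 'm \<Rightarrow> 'm \<Rightarrow> 'a \<Rightarrow> 'a" where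
  "ifs_map a i \<equiv> \<lambda>x. T i x + a $ i"

lemma continuous_ifs_map: "continuous_on UNIV (ifs_map a i)"
  by (intro continuous_intros linear_continuous_on bounded_linear_T)

lemma measurable_ifs_map [measurable]: "ifs_map a i \<in> borel_measurable borel"
  by (rule borel_measurable_continuous_onI[OF continuous_ifs_map])

section \<open>Self-affinity determines the measure\<close>

definition self_affine :: "'a ^ 'm \<Rightarrow> 'a measure \<Rightarrow> bool" where
  "self_affine a \<mu> \<longleftrightarrow> sets \<mu> = sets borel \<and> prob_space \<mu> \<and>
     (\<forall>A\<in>sets borel. measure \<mu> A = (\<Sum>i\<in>UNIV. p i * measure \<mu> (ifs_map a i -` A)))"

lemma self_affine_sam: "self_affine a (sam a)"
  unfolding self_affine_def
proof (intro conjI ballI)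
  interpret M: borel_prob "sam a" by (rule borel_prob_sam)
  show "sets (sam a) = sets borel" "prob_space (sam a)" using M.sets_eq M.prob_space_axioms by auto
  fix A :: "'a set" assume A[measurable]: "A \<in> sets borel"
  have eq: "emeasure (sam a) C = (\<integral>\<^sup>+\<omega>. indicator C (coding a \<omega>) \<partial>bernoulli)" if [measurable]: "C \<in> sets borel" for C
  proof -
    have "emeasure (sam a) C = (\<integral>\<^sup>+x. indicator C x \<partial>sam a)" by (simp add: sam_def)
    also have "\<dots> = (\<integral>\<^sup>+\<omega>. indicator C (coding a \<omega>) \<partial>bernoulli)" unfolding sam_def by (rule nn_integral_distr) auto
    finally show ?thesis .
  qed
  have [measurable]: "ifs_map a i -` A \<in> sets borel" for i
    using measurable_sets[OF measurable_ifs_map A] by simp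
  have "emeasure (sam a) A = (\<Sum>i\<in>UNIV. ennreal (p i) * emeasure (sam a) (ifs_map a i -` A))"
    by (subst eq, simp, subst nn_integral_bernoulli) (simp_all add: eq coding_SCons indicator_def)
  also have "\<dots> = ennreal (\<Sum>i\<in>UNIV. p i * measure (sam a) (ifs_map a i -` A))"
    by (simp add: M.emeasure_eq_measure ennreal_mult[symmetric] less_imp_le[OF p_pos] sum_ennreal)
  finally show "measure (sam a) A = (\<Sum>i\<in>UNIV. p i * measure (sam a) (ifs_map a i -` A))"
    by (simp add: M.emeasure_eq_measure sum_nonneg less_imp_le[OF p_pos])
qed

definition word_ifs :: "'a ^ 'm \<Rightarrow> 'm list \<Rightarrow> 'a \<Rightarrow> 'a" where
  "word_ifs a I = foldr (\<lambda>i f. ifs_map a i \<circ> f) I id"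

lemma word_ifs_simps [simp]:
  "word_ifs a [] = id" "word_ifs a (i # I) = ifs_map a i \<circ> word_ifs a I"
  by (simp_all add: word_ifs_def)

lemma word_ifs_vimage: "closed F \<Longrightarrow> closed (word_ifs a I -` F)"
proof (induction I arbitrary: F)
  case (Cons i I)
  have "closed (ifs_map a i -` F)" 
    using continuous_closed_vimage[OF Cons.prems, of "ifs_map a i"] continuous_ifs_map[of i a]
    by (simp only: continuous_on_eq_continuous_at[OF open_UNIV] ball_UNIV)
  from Cons.IH[OF this] show ?case by (simp only: word_ifs_simps vimage_comp)
qed simp

lemma dist_word_ifs: "dist (word_ifs a I x) (word_ifs a I y) \<le> (1 / 2) ^ length I * dist x y"
proof (induction I)
  case (Cons i I)
  have "dist (word_ifs a (i # I) x) (word_ifs a (i # I) y) \<le> dist (word_ifs a I x) (word_ifs a I y) / 2"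
    using norm_T_le[of i "word_ifs a I x - word_ifs a I y"] by (simp add: dist_norm linear_diff[OF linear_T])
  then show ?case using Cons by simp
qed simp

lemma self_affine_words:
  assumes "self_affine a \<mu>" "closed F"
  shows "measure \<mu> F = (\<Sum>I | length I = n. pw I * measure \<mu> (word_ifs a I -` F))"
  using assms(2)
proof (induction n arbitrary: F)
  case 0
  have "{I :: 'm list. length I = 0} = {[]}" by auto
  then show ?case by simp
next
  case (Suc n)
  have cl: "closed (ifs_map a i -` F)" for i using word_ifs_vimage[OF Suc.prems, of a "[i]"] by (simp add: o_def)
  have "measure \<mu> F = (\<Sum>i\<in>UNIV. p i * measure \<mu> (ifs_map a i -` F))"
    using assms(1) Suc.prems by (simp add: self_affine_def)
  also have "\<dots> = (\<Sum>I | length I = Suc n. pw I * measure \<mu> (word_ifs a I -` F))"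
    by (simp add: Suc.IH[OF cl] sum_words_Suc sum_distrib_left mult.assoc vimage_comp[symmetric])
  finally show ?case .
qed

text \<open>The competitors may have unbounded support, so tails of small mass are cut off. A word
  map of length n sends a ball of radius R into a set of diameter at most 2^-n * 2R; if the preimage
  of F meets the ball, the preimage of the neighbourhood \<open>F' n\<close> contains all of it.
  Summing over words and letting n grow gives the inequality. F must be nonempty because
  \<open>infdist\<close> to the empty set is 0, which would make \<open>F' n\<close> the whole
  space.\<close>

lemma self_affine_le:
  assumes mu: "self_affine a \<mu>" and nu: "self_affine a \<nu>" and F: "closed F" "F \<noteq> {}"
  shows "measure \<mu> F \<le> measure \<nu> F"
proof (rule field_le_epsilon)
  fix e :: real assume "0 < e"
  define \<epsilon> where "\<epsilon> = min 1 (e / 3)"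
  have e: "0 < \<epsilon>" "\<epsilon> \<le> 1" using \<open>0 < e\<close> by (auto simp: \<epsilon>_def)
  interpret M: borel_prob \<mu> using mu by (simp add: self_affine_def borel_prob_def borel_prob_axioms_def)
  interpret N: borel_prob \<nu> using nu by (simp add: self_affine_def borel_prob_def borel_prob_axioms_def)
  have tail: "\<exists>R>0. 1 - \<epsilon> < measure \<rho> (cball 0 R)" if "borel_prob \<rho>" for \<rho> :: "'a measure"
  proof -
    interpret R: borel_prob \<rho> by fact
    have U: "(\<Union>n. cball (0::'a) (real n)) = UNIV" using real_arch_simple by auto
    have "(\<lambda>n. R.prob (cball 0 (real n))) \<longlonglongrightarrow> R.prob (\<Union>n. cball (0::'a) (real n))"
      by (rule R.finite_Lim_measure_incseq) (auto simp: incseq_def)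
    then have "(\<lambda>n. R.prob (cball 0 (real n))) \<longlonglongrightarrow> 1" using U R.prob_space by simp
    then have "\<forall>\<^sub>F n in sequentially. 1 - \<epsilon> < R.prob (cball 0 (real n))" using e by (intro order_tendstoD(1)) auto
    moreover have "\<forall>\<^sub>F n in sequentially. 0 < n" by (rule eventually_gt_at_top)
    ultimately obtain n where "1 - \<epsilon> < R.prob (cball 0 (real n))" "0 < n"
      using eventually_conj eventually_happens' sequentially_bot by blast
    then show ?thesis by (intro exI[of _ "real n"]) auto
  qed
  obtain R1 R2 where R1: "0 < R1" "1 - \<epsilon> < M.prob (cball 0 R1)" and R2: "0 < R2" "1 - \<epsilon> < N.prob (cball 0 R2)"
    using tail[OF M.borel_prob_axioms] tail[OF N.borel_prob_axioms] by blast
  define R where "R = max R1 R2"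
  have R: "0 < R" "1 - \<epsilon> \<le> M.prob (cball 0 R)" "1 - \<epsilon> \<le> N.prob (cball 0 R)"
  proof -
    have "M.prob (cball 0 R1) \<le> M.prob (cball 0 R)" "N.prob (cball 0 R2) \<le> N.prob (cball 0 R)"
      by (auto simp: R_def intro!: M.finite_measure_mono N.finite_measure_mono)
    then show "0 < R" "1 - \<epsilon> \<le> M.prob (cball 0 R)" "1 - \<epsilon> \<le> N.prob (cball 0 R)" using R1 R2 by (auto simp: R_def)
  qed
  define F' where "F' n = {x. infdist x F \<le> (1/2) ^ n * (2 * R)}" for n
  have F'[simp]: "closed (F' n)" for n unfolding F'_def by (intro closed_Collect_le continuous_intros)
  have step: "M.prob F \<le> N.prob (F' n) + 2 * \<epsilon>" for n
  proof -
    have "pw I * M.prob (word_ifs a I -` F) \<le> pw I * (N.prob (word_ifs a I -` F' n) + 2 * \<epsilon>)" if I: "length I = n" for I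
    proof (intro mult_left_mono less_imp_le[OF pw_pos])
      have [measurable]: "word_ifs a I -` F \<in> sets borel" "word_ifs a I -` F' n \<in> sets borel"
        using word_ifs_vimage[OF F(1)] word_ifs_vimage[OF F'] by auto
      show "M.prob (word_ifs a I -` F) \<le> N.prob (word_ifs a I -` F' n) + 2 * \<epsilon>"
      proof (cases "word_ifs a I -` F \<inter> cball 0 R = {}")
        case True
        then have "M.prob (word_ifs a I -` F) \<le> M.prob (UNIV - cball 0 R)" by (intro M.finite_measure_mono) auto
        also have "\<dots> \<le> \<epsilon>" using M.prob_compl[of "cball 0 R"] R by simp
        finally show ?thesis using e by (simp add: add_increasing)
      next
        case False
        then obtain x where x: "word_ifs a I x \<in> F" "norm x \<le> R" by auto
        have "cball 0 R \<subseteq> word_ifs a I -` F' n"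
        proof
          fix y :: 'a assume "y \<in> cball 0 R"
          then have "dist y x \<le> 2 * R" using x(2) dist_triangle[of y x 0] by simp
          have "infdist (word_ifs a I y) F \<le> dist (word_ifs a I y) (word_ifs a I x)" by (rule infdist_le[OF x(1)])
          also have "\<dots> \<le> (1/2) ^ n * dist y x" using dist_word_ifs[of a I y x] I by simp
          also have "\<dots> \<le> (1/2) ^ n * (2 * R)" using \<open>dist y x \<le> 2 * R\<close> by (intro mult_left_mono) auto
          finally show "y \<in> word_ifs a I -` F' n" by (simp add: F'_def)
        qed
        then have "N.prob (cball 0 R) \<le> N.prob (word_ifs a I -` F' n)" by (intro N.finite_measure_mono) auto
        then have "1 \<le> N.prob (word_ifs a I -` F' n) + 2 * \<epsilon>" using R(3) e by simp
        then show ?thesis using M.prob_le_1 order_trans by blast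
      qed
    qed
    then have "(\<Sum>I | length I = n. pw I * M.prob (word_ifs a I -` F)) \<le> (\<Sum>I | length I = n. pw I * (N.prob (word_ifs a I -` F' n) + 2 * \<epsilon>))"
      by (intro sum_mono) auto
    also have "\<dots> = (\<Sum>I | length I = n. pw I * N.prob (word_ifs a I -` F' n)) + 2 * \<epsilon>"
      by (simp add: distrib_left sum.distrib sum_distrib_right[symmetric] sum_pw)
    finally show ?thesis
      using self_affine_words[OF mu F(1), of n] self_affine_words[OF nu F', of n n] by simp
  qed
  have "decseq F'" unfolding decseq_def F'_def
  proof (intro allI impI subsetI; clarify)
    fix m n x assume mn: "m \<le> n" "infdist x F \<le> (1/2) ^ n * (2 * R)"
    have "(1/2::real) ^ n * (2 * R) \<le> (1/2) ^ m * (2 * R)" using mn R by (intro mult_right_mono power_decreasing) auto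
    then show "infdist x F \<le> (1/2) ^ m * (2 * R)" using mn by simp
  qed
  then have "(\<lambda>n. N.prob (F' n)) \<longlonglongrightarrow> N.prob (\<Inter>n. F' n)" by (intro N.finite_Lim_measure_decseq) auto
  moreover have "(\<Inter>n. F' n) = F"
  proof (intro equalityI subsetI)
    fix x assume x: "x \<in> (\<Inter>n. F' n)"
    have "(\<lambda>n. (1/2::real) ^ n * (2 * R)) \<longlonglongrightarrow> 0 * (2 * R)" by (intro tendsto_intros LIMSEQ_power_zero) auto
    then have "infdist x F \<le> 0" using x by (intro LIMSEQ_le_const[where X = "\<lambda>n. (1/2::real) ^ n * (2 * R)"]) (auto simp: F'_def)
    then show "x \<in> F" using in_closed_iff_infdist_zero[OF F] infdist_nonneg[of x F] by simp
  next
    fix x assume "x \<in> F" then show "x \<in> (\<Inter>n. F' n)" using R by (auto simp: F'_def)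
  qed
  ultimately have "(\<lambda>n. N.prob (F' n) + 2 * \<epsilon>) \<longlonglongrightarrow> N.prob F + 2 * \<epsilon>" by (intro tendsto_intros) simp
  then have "M.prob F \<le> N.prob F + 2 * \<epsilon>" by (rule LIMSEQ_le_const) (use step in auto)
  then show "M.prob F \<le> N.prob F + e" using \<open>0 < e\<close> by (simp add: \<epsilon>_def)
qed

lemma self_affine_unique:
  assumes "self_affine a \<mu>" "self_affine a \<nu>"
  shows "\<mu> = \<nu>"
proof (rule borel_measure_eqI_closed)
  interpret M: borel_prob \<mu> using assms by (simp add: self_affine_def borel_prob_def borel_prob_axioms_def)
  interpret N: borel_prob \<nu> using assms by (simp add: self_affine_def borel_prob_def borel_prob_axioms_def)
  show "sets \<mu> = sets borel" "sets \<nu> = sets borel" "finite_measure \<mu>" by (auto simp: M.finite_measure_axioms)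
  fix F :: "'a set" assume "closed F"
  then show "emeasure \<mu> F = emeasure \<nu> F"
    using self_affine_le[OF assms] self_affine_le[OF assms(2,1)]
    by (cases "F = {}") (auto simp: M.emeasure_eq_measure N.emeasure_eq_measure intro: antisym)
qed

lemma self_affine_measure_eq: "self_affine_measure T p a = sam a"
  unfolding self_affine_measure_def self_affine_def[symmetric]
  by (rule the_equality) (auto intro: self_affine_sam self_affine_unique[OF _ self_affine_sam])

text \<open>The complement of the ball is open and contains no coded point.\<close>

lemma support_sam: "measure_support (sam a) \<subseteq> cball 0 (2 * norm a)"
proof
  fix x assume x: "x \<in> measure_support (sam a)"
  show "x \<in> cball 0 (2 * norm a)"
  proof (rule ccontr)
    assume "x \<notin> cball 0 (2 * norm a)"
    then have "0 < emeasure (sam a) (- cball 0 (2 * norm a))" using x by (auto simp: measure_support_def open_Compl)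
    moreover have "coding a -` (- cball 0 (2 * norm a)) = {}" using norm_coding[of a] by auto
    ultimately show False by (simp add: sam_def emeasure_distr)
  qed
qed

end

section \<open>Transversality\<close>

lemma cball_fmeasurable: "cball (x::'b::euclidean_space) r \<in> fmeasurable lborel"
  using emeasure_lborel_cball_finite by (intro fmeasurableI) auto

text \<open>Shifting S does not change its volume. Averaging over the shifts V u with u in the unit
  ball and exchanging the integrals leaves, for each a, the volume of a slice in the directions of
  V; only a within distance \<rho> + K of 0 contribute.\<close>

lemma translation_average:
  fixes V :: "'b::euclidean_space \<Rightarrow> 'c::euclidean_space"
  assumes V: "linear V" and S: "S \<in> sets borel" "S \<subseteq> cball 0 \<rho>"
    and K: "\<And>u. norm u \<le> 1 \<Longrightarrow> norm (V u) \<le> K"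
    and slice: "\<And>a. emeasure lborel {u \<in> cball 0 1. a + V u \<in> S} \<le> \<kappa>"
  shows "emeasure lborel (cball (0::'b) 1) * emeasure lborel S \<le> \<kappa> * emeasure lborel (cball (0::'c) (\<rho> + K))"
proof -
  have [measurable]: "V \<in> borel_measurable borel"
    by (intro borel_measurable_continuous_onI linear_continuous_on) (use V linear_conv_bounded_linear in blast)
  note [measurable] = S(1)
  have [measurable]: "cball (0::'b) 1 \<in> sets borel" by simp
  have shift: "(\<integral>\<^sup>+a. indicator S (a + t) \<partial>lborel) = emeasure lborel S" for t
  proof -
    have "emeasure lborel S = (\<integral>\<^sup>+a. indicator S a \<partial>distr lborel borel ((+) t))" using S(1) by (simp add: lborel_distr_plus)
    also have "\<dots> = (\<integral>\<^sup>+a. indicator S (t + a) \<partial>lborel)" by (rule nn_integral_distr) auto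
    finally show ?thesis by (simp add: add.commute)
  qed
  have "emeasure lborel (cball (0::'b) 1) * emeasure lborel S = (\<integral>\<^sup>+u. emeasure lborel S * indicator (cball 0 1) (u::'b) \<partial>lborel)"
    by (subst nn_integral_cmult_indicator) (auto simp: mult.commute)
  also have "\<dots> = (\<integral>\<^sup>+u. \<integral>\<^sup>+a. indicator S (a + V u) * indicator (cball 0 1) u \<partial>lborel \<partial>lborel)"
    by (intro nn_integral_cong) (subst nn_integral_multc, measurable, simp add: shift)
  also have "\<dots> = (\<integral>\<^sup>+a. \<integral>\<^sup>+u. indicator S (a + V u) * indicator (cball 0 1) u \<partial>lborel \<partial>lborel)"
    by (rule lborel_pair.Fubini'[symmetric]) measurable
  also have "\<dots> \<le> (\<integral>\<^sup>+a. \<kappa> * indicator (cball 0 (\<rho> + K)) (a::'c) \<partial>lborel)"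
  proof (intro nn_integral_mono)
    fix a :: 'c
    have "(\<integral>\<^sup>+u. indicator S (a + V u) * indicator (cball 0 1) u \<partial>lborel) = (\<integral>\<^sup>+u. indicator {u \<in> cball 0 1. a + V u \<in> S} u \<partial>lborel)"
      by (intro nn_integral_cong) (auto simp: indicator_def)
    also have "\<dots> = emeasure lborel {u \<in> cball 0 1. a + V u \<in> S}" by (intro nn_integral_indicator) measurable
    also have "\<dots> \<le> \<kappa> * indicator (cball 0 (\<rho> + K)) a"
    proof (cases "a \<in> cball 0 (\<rho> + K)")
      case False
      have "a + V u \<notin> S" if "u \<in> cball 0 1" for u
      proof
        assume "a + V u \<in> S"
        then have "norm (a + V u) \<le> \<rho>" using S(2) by auto
        moreover have "norm (V u) \<le> K" using K that by simp
        ultimately have "norm a \<le> \<rho> + K" using norm_triangle_ineq4[of "a + V u" "V u"] by simp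
        then show False using False by simp
      qed
      then have "{u \<in> cball 0 1. a + V u \<in> S} = {}" by auto
      then show ?thesis by (metis emeasure_empty zero_le)
    qed (use slice[of a] in simp)
    finally show "(\<integral>\<^sup>+u. indicator S (a + V u) * indicator (cball 0 1) u \<partial>lborel) \<le> \<kappa> * indicator (cball 0 (\<rho> + K)) a" .
  qed
  also have "\<dots> = \<kappa> * emeasure lborel (cball (0::'c) (\<rho> + K))" by (simp add: nn_integral_cmult_indicator)
  finally show ?thesis .
qed

text \<open>Interpolation between a trivial bound A, used for t >= 1, and the bound at exponent D,
  used for t < 1. It supplies all exponents s in [0, D] at once.\<close>

lemma min_powr_bound:
  fixes t :: real
  assumes "0 < t" "0 \<le> s" "s \<le> D" "0 \<le> A" "0 \<le> B" "x \<le> A" "x \<le> B * t powr D"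
  shows "x \<le> (A + B) * t powr s"
proof (cases "1 \<le> t")
  case True
  then have "A * 1 \<le> (A + B) * t powr s" using assms by (intro mult_mono) (auto simp: ge_one_powr_ge_zero)
  then show ?thesis using assms by simp
next
  case False
  then have "B * t powr D \<le> (A + B) * t powr s" using assms by (intro mult_mono powr_mono') auto
  then show ?thesis using assms by simp
qed

context affine_ifs
begin

lemma linear_coding: "linear (\<lambda>a. coding a \<omega>)"
proof (rule linearI)
  show "coding (c *\<^sub>R a) \<omega> = c *\<^sub>R coding a \<omega>" for c a
    unfolding coding_def by (simp add: linear_scale[OF linear_W] suminf_scaleR_right[OF summable_coding])
qed (rule coding_add)

section \<open>Effect of opposite shifts of two letters on the coding\<close>

definition opp :: "'m \<Rightarrow> 'm \<Rightarrow> 'a \<Rightarrow> 'a ^ 'm" where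
  "opp i j u = axis i u - axis j u"

lemma axis_nth': "axis i u $ k = (if k = i then u else 0)"
  by (simp add: axis_def)

lemma linear_opp: "linear (opp i j)"
  by (rule linearI) (auto simp: opp_def vec_eq_iff axis_nth' scaleR_diff_right)

lemma norm_axis_eq: "norm (axis i u :: 'a ^ 'm) = norm u"
  by (simp add: norm_vec_def L2_set_def axis_nth' if_distrib[of norm] if_distrib[of "\<lambda>x. x\<^sup>2"] sum.delta cong: if_cong)

lemma norm_opp: "norm (opp i j u) \<le> 2 * norm u"
  using norm_triangle_ineq4[of "axis i u" "axis j u"] by (simp add: opp_def norm_axis_eq)

text \<open>The coefficient 2 produced by the two first letters minus the largest possible
  contribution of all later letters; it is positive since \<open>contr\<close> < 1/2.\<close>

definition gap :: real where "gap = 2 - 2 * contr / (1 - contr)"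

lemma gap_pos: "0 < gap"
  using contr by (simp add: gap_def divide_less_eq)

text \<open>Moving \<open>a\<close> in the directions of both first letters at once makes the leading coefficient 2; this beats the
  remaining terms as soon as the norms are below \<open>1/2\<close>, while one letter alone would require \<open>1/3\<close>.\<close>

lemma coding_opp:
  assumes "shd x \<noteq> shd y"
  shows "norm (coding (opp (shd x) (shd y) u) x - coding (opp (shd x) (shd y) u) y - 2 *\<^sub>R u) \<le> 2 * contr / (1 - contr) * norm u"
proof -
  define b where "b = opp (shd x) (shd y) u"
  \<comment> \<open>As the first letters differ, u and -u sit in different components, and no
    component of b has norm above |u|.\<close>
  have comp: "norm (b $ k) \<le> norm u" for k using assms by (auto simp: b_def opp_def axis_nth')
  have tl: "norm (T i (coding b z)) \<le> contr / (1 - contr) * norm u" for i z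
  proof -
    have "norm (T i (coding b z)) \<le> contr * norm (coding b z)" by (rule norm_T_le_contr)
    also have "\<dots> \<le> contr * (norm u / (1 - contr))" using contr by (intro mult_left_mono norm_coding_le comp) auto
    finally show ?thesis by simp
  qed
  have "coding b x = T (shd x) (coding b (stl x)) + b $ shd x" "coding b y = T (shd y) (coding b (stl y)) + b $ shd y"
    using coding_SCons[of b "shd x" "stl x"] coding_SCons[of b "shd y" "stl y"] by simp_all
  moreover have "b $ shd x = u" "b $ shd y = - u" using assms by (auto simp: b_def opp_def axis_nth')
  ultimately have "coding b x - coding b y - 2 *\<^sub>R u = T (shd x) (coding b (stl x)) - T (shd y) (coding b (stl y))"
    by (simp add: scaleR_2)
  also have "norm \<dots> \<le> contr / (1 - contr) * norm u + contr / (1 - contr) * norm u"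
    by (rule order_trans[OF norm_triangle_ineq4 add_mono[OF tl tl]])
  also have "\<dots> = 2 * contr / (1 - contr) * norm u" unfolding mult_2[symmetric] by simp
  finally show ?thesis unfolding b_def .
qed

text \<open>The difference of the two coded points has component at least \<open>gap\<close> * |u|
  in the direction of u itself; the estimate for D = 1 controls only one direction and needs this
  form.\<close>

lemma coding_opp_inner:
  assumes "shd x \<noteq> shd y"
  shows "gap * (norm u)\<^sup>2 \<le> (coding (opp (shd x) (shd y) u) x - coding (opp (shd x) (shd y) u) y) \<bullet> u"
proof -
  let ?L = "coding (opp (shd x) (shd y) u) x - coding (opp (shd x) (shd y) u) y"
  have "- ((?L - 2 *\<^sub>R u) \<bullet> u) \<le> norm (?L - 2 *\<^sub>R u) * norm u" using Cauchy_Schwarz_ineq2[of "?L - 2 *\<^sub>R u" u] by simp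
  also have "\<dots> \<le> 2 * contr / (1 - contr) * norm u * norm u" by (intro mult_right_mono coding_opp assms) auto
  finally show ?thesis by (simp add: gap_def inner_diff_left power2_eq_square algebra_simps dot_square_norm)
qed

lemma coding_opp_norm:
  assumes "shd x \<noteq> shd y"
  shows "gap * norm u \<le> norm (coding (opp (shd x) (shd y) u) x - coding (opp (shd x) (shd y) u) y)"
proof (cases "u = 0")
  case False
  let ?L = "coding (opp (shd x) (shd y) u) x - coding (opp (shd x) (shd y) u) y"
  have "gap * norm u * norm u \<le> norm ?L * norm u"
    using coding_opp_inner[OF assms, of u] norm_cauchy_schwarz[of ?L u] by (simp add: power2_eq_square)
  then show ?thesis using False by simp
qed simp

text \<open>By \<open>coding_shift_diff\<close> these are the translations in a ball for which the
  streams with prefix I and tails x, y code points at distance at most r.\<close>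

definition close_set :: "real \<Rightarrow> 'm list \<Rightarrow> 'm stream \<Rightarrow> 'm stream \<Rightarrow> real \<Rightarrow> ('a ^ 'm) set" where
  "close_set \<rho> I x y r = {a \<in> cball 0 \<rho>. norm (W I (coding a x - coding a y)) \<le> r}"

lemma close_set_borel [measurable]: "close_set \<rho> I x y r \<in> sets borel"
proof -
  have "linear (\<lambda>a. W I (coding a x - coding a y))"
    using linear_compose[OF linear_compose_sub[OF linear_coding linear_coding] linear_W] by (simp add: o_def)
  then have "continuous_on UNIV (\<lambda>a. W I (coding a x - coding a y))"
    using linear_continuous_on linear_conv_bounded_linear by blast
  then have "closed {a. norm (W I (coding a x - coding a y)) \<le> r}"
    by (intro closed_Collect_le continuous_intros)
  then have "closed (cball 0 \<rho> \<inter> {a. norm (W I (coding a x - coding a y)) \<le> r})" by blast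
  moreover have "close_set \<rho> I x y r = cball 0 \<rho> \<inter> {a. norm (W I (coding a x - coding a y)) \<le> r}"
    by (auto simp: close_set_def)
  ultimately show ?thesis by (simp add: borel_closed)
qed

text \<open>The estimate that makes the \<open>L\<^sup>q\<close> energies integrable in \<open>a\<close>, for exponents up to \<open>D\<close>.\<close>

definition transversal :: "real \<Rightarrow> bool" where
  "transversal D \<longleftrightarrow> (\<forall>\<rho>. \<exists>C>0. \<forall>I x y r s. shd x \<noteq> shd y \<longrightarrow> 0 < r \<longrightarrow> 0 \<le> s \<longrightarrow> s \<le> D \<longrightarrow>
     emeasure lborel (close_set \<rho> I x y r) \<le> ennreal (C * (r / onorm (W I)) powr s))"

text \<open>Reduction to slices: the volume of \<open>close_set\<close> is bounded by averaging over
  perturbations V u, which may be adapted to the two first letters and to the prefix I but not to a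
  or r.\<close>

lemma transversalI:
  fixes V :: "'m \<Rightarrow> 'm \<Rightarrow> 'm list \<Rightarrow> 'b::euclidean_space \<Rightarrow> 'a ^ 'm"
  assumes V: "\<And>i j I. linear (V i j I)" "\<And>i j I u. norm u \<le> 1 \<Longrightarrow> norm (V i j I u) \<le> 2"
    and B: "0 \<le> B"
    and slice: "\<And>I x y r \<rho> a. shd x \<noteq> shd y \<Longrightarrow> 0 < r \<Longrightarrow>
      measure lborel {u \<in> cball 0 1. a + V (shd x) (shd y) I u \<in> close_set \<rho> I x y r} \<le> B * (r / onorm (W I)) powr D"
  shows "transversal D"
  unfolding transversal_def
proof (intro allI)
  fix \<rho>
  define v where "v = measure lborel (cball (0::'b) 1)"
  define \<Lambda> where "\<Lambda> = measure lborel (cball (0::'a ^ 'm) (\<rho> + 2))"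
  \<comment> \<open>The \<open>+ 1\<close> keeps C positive when \<open>\<Lambda>\<close> vanishes,
    which happens for \<rho> <= -2.\<close>
  define C where "C = (v + B) * \<Lambda> / v + 1"
  have v: "0 < v" unfolding v_def using content_cball_pos[of 1 "0::'b"] by simp
  have C: "0 < C" using v B by (auto simp: C_def \<Lambda>_def intro!: add_nonneg_pos divide_nonneg_pos mult_nonneg_nonneg)
  have "emeasure lborel (close_set \<rho> I x y r) \<le> ennreal (C * (r / onorm (W I)) powr s)"
    if h: "shd x \<noteq> shd y" "0 < r" "0 \<le> s" "s \<le> D" for I x y r s
  proof -
    define t where "t = r / onorm (W I)"
    have t: "0 < t" using h onorm_W_pos by (simp add: t_def)
    define V' where "V' = V (shd x) (shd y) I"
    have Vb: "V' \<in> borel_measurable borel" unfolding V'_def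
      by (intro borel_measurable_continuous_onI linear_continuous_on) (use V(1) linear_conv_bounded_linear in blast)
    have sl: "emeasure lborel {u \<in> cball 0 1. a + V' u \<in> close_set \<rho> I x y r} \<le> ennreal ((v + B) * t powr s)" for a
    proof -
      let ?S = "{u \<in> cball 0 1. a + V' u \<in> close_set \<rho> I x y r}"
      note [measurable] = Vb
      have [measurable]: "?S \<in> sets borel" by measurable
      have fin: "cball (0::'b) 1 \<in> fmeasurable lborel" by (rule cball_fmeasurable)
      have "?S \<in> fmeasurable lborel" by (rule fmeasurableI2[OF fin]) auto
      have "measure lborel ?S \<le> (v + B) * t powr s"
      proof (rule min_powr_bound[OF t h(3,4) _ B])
        show "measure lborel ?S \<le> v" unfolding v_def by (intro measure_mono_fmeasurable fin) auto
        show "measure lborel ?S \<le> B * t powr D" using slice[OF h(1,2)] by (simp add: t_def V'_def)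
      qed (use v in simp)
      then show ?thesis using \<open>?S \<in> fmeasurable lborel\<close> by (simp add: emeasure_eq_measure2 ennreal_leI)
    qed
    have "close_set \<rho> I x y r \<subseteq> cball 0 \<rho>" by (auto simp: close_set_def)
    then have finS: "close_set \<rho> I x y r \<in> fmeasurable lborel"
      by (rule fmeasurableI2[OF cball_fmeasurable]) (simp add: close_set_borel)
    have "emeasure lborel (cball (0::'b) 1) * emeasure lborel (close_set \<rho> I x y r)
        \<le> ennreal ((v + B) * t powr s) * emeasure lborel (cball (0::'a ^ 'm) (\<rho> + 2))"
      by (rule translation_average[OF V(1)[of "shd x" "shd y" I, folded V'_def] close_set_borel])
        (use V(2) sl in \<open>auto simp: V'_def close_set_def\<close>)
    then have "ennreal (v * measure lborel (close_set \<rho> I x y r)) \<le> ennreal ((v + B) * t powr s * \<Lambda>)"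
      using finS v B by (simp add: v_def \<Lambda>_def emeasure_eq_measure2 emeasure_eq_measure2[OF cball_fmeasurable] ennreal_mult)
    then have "v * measure lborel (close_set \<rho> I x y r) \<le> (v + B) * t powr s * \<Lambda>"
      using v B by (subst (asm) ennreal_le_iff) (auto simp: \<Lambda>_def)
    then have "measure lborel (close_set \<rho> I x y r) \<le> (v + B) * \<Lambda> / v * t powr s"
      using v by (simp add: pos_le_divide_eq mult_ac)
    also have "\<dots> \<le> C * t powr s" by (intro mult_right_mono) (auto simp: C_def)
    finally show ?thesis using finS by (simp add: emeasure_eq_measure2 ennreal_leI t_def)
  qed
  then show "\<exists>C>0. \<forall>I x y r s. shd x \<noteq> shd y \<longrightarrow> 0 < r \<longrightarrow> 0 \<le> s \<longrightarrow> s \<le> D \<longrightarrow>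
     emeasure lborel (close_set \<rho> I x y r) \<le> ennreal (C * (r / onorm (W I)) powr s)"
    using C by blast
qed

text \<open>If S is not Borel, \<open>measure\<close> returns 0 and the bound is trivial.\<close>

lemma measure_le_cball:
  fixes S :: "'b::euclidean_space set"
  assumes "S \<subseteq> cball z R" "0 \<le> R" 
  shows "measure lborel S \<le> R ^ DIM('b) * measure lborel (cball (0::'b) 1)"
proof (cases "S \<in> sets borel")
  case True
  then have "measure lborel S \<le> measure lborel (cball z R)"
    using assms by (intro measure_mono_fmeasurable cball_fmeasurable) auto
  then show ?thesis using content_cball_scale[OF assms(2), of z] by simp
qed (use assms in \<open>simp add: measure_notin_sets\<close>)

text \<open>Let e be a unit vector stretched most by \<open>W I\<close>. As e is an eigenvector of
  the adjoint composed with the map, the image of w has norm at least \<open>onorm (W I)\<close> *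
  |w . e|, so closeness confines the component along e to an interval. Shifting along e moves that
  component at speed at least \<open>gap\<close>, so the admissible shifts lie in an interval of
  length 2 r / (gap * \<open>onorm (W I)\<close>).\<close>

lemma transversal_1: "transversal 1"
proof -
  have "\<exists>e. norm e = 1 \<and> (\<forall>w. onorm (W I) * \<bar>w \<bullet> e\<bar> \<le> norm (W I w))" for I
  proof -
    obtain e where e: "norm e = 1" "adjoint (W I) (W I e) = (onorm (W I))\<^sup>2 *\<^sub>R e" "norm (W I e) = onorm (W I)"
      using onorm_eigenvector[OF linear_W] by blast
    have "onorm (W I) * \<bar>w \<bullet> e\<bar> \<le> norm (W I w)" for w
    proof -
      have "onorm (W I) * (onorm (W I) * \<bar>w \<bullet> e\<bar>) = \<bar>w \<bullet> adjoint (W I) (W I e)\<bar>"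
        using e(2) by (simp add: abs_mult power2_eq_square)
      also have "w \<bullet> adjoint (W I) (W I e) = W I w \<bullet> W I e" by (simp add: adjoint_works[OF linear_W])
      also have "\<bar>\<dots>\<bar> \<le> norm (W I w) * onorm (W I)" using Cauchy_Schwarz_ineq2[of "W I w" "W I e"] e(3) by simp
      finally show ?thesis using onorm_W_pos[of I] by (simp add: mult.commute)
    qed
    then show ?thesis using e(1) by blast
  qed
  then obtain e where e: "\<And>I. norm (e I) = 1" "\<And>I w. onorm (W I) * \<bar>w \<bullet> e I\<bar> \<le> norm (W I w)" by metis
  define V where "V i j I h = opp i j (h *\<^sub>R e I)" for i j I and h :: real
  show ?thesis
  proof (rule transversalI[where V = V and B = "2 / gap"])
    show "linear (V i j I)" for i j I
      unfolding V_def by (intro linearI) (simp_all add: linear_add[OF linear_opp] linear_scale[OF linear_opp] scaleR_left_distrib)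
    show "norm (V i j I h) \<le> 2" if "norm h \<le> 1" for i j I h
      using norm_opp[of i j "h *\<^sub>R e I"] that by (simp add: V_def e(1))
    fix I and x y :: "'m stream" and r \<rho> :: real and a :: "'a ^ 'm" assume h: "shd x \<noteq> shd y" "0 < r"
    define L where "L = coding (opp (shd x) (shd y) (e I)) x - coding (opp (shd x) (shd y) (e I)) y"
    define z where "z = coding a x - coding a y"
    define s where "s = L \<bullet> e I"
    have s: "gap \<le> s" using coding_opp_inner[OF h(1), of "e I"] e(1) by (simp add: s_def L_def)
    define t where "t = r / onorm (W I)"
    have t: "0 < t" using h onorm_W_pos by (simp add: t_def)
    have "{u \<in> cball 0 1. a + V (shd x) (shd y) I u \<in> close_set \<rho> I x y r} \<subseteq> cball (- (z \<bullet> e I) / s) (t / gap)"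
    proof
      fix k assume k: "k \<in> {u \<in> cball 0 1. a + V (shd x) (shd y) I u \<in> close_set \<rho> I x y r}"
      have "coding (a + V (shd x) (shd y) I k) x - coding (a + V (shd x) (shd y) I k) y = z + k *\<^sub>R L"
        by (simp add: V_def z_def L_def coding_add linear_scale[OF linear_opp] linear_scale[OF linear_coding] scaleR_diff_right)
      then have "norm (W I (z + k *\<^sub>R L)) \<le> r" using k by (simp add: close_set_def)
      then have "onorm (W I) * \<bar>(z + k *\<^sub>R L) \<bullet> e I\<bar> \<le> r" using e(2)[of I "z + k *\<^sub>R L"] by simp
      then have "\<bar>z \<bullet> e I + k * s\<bar> \<le> t" using onorm_W_pos[of I] by (simp add: t_def s_def inner_add_left pos_le_divide_eq mult.commute)
      moreover have "\<bar>- (z \<bullet> e I) / s - k\<bar> = \<bar>z \<bullet> e I + k * s\<bar> / s"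
      proof -
        have "- (z \<bullet> e I) / s - k = - (z \<bullet> e I + k * s) / s" using s gap_pos by (simp add: field_simps)
        then show ?thesis using s gap_pos by simp
      qed
      ultimately have "\<bar>- (z \<bullet> e I) / s - k\<bar> \<le> t / s" using s gap_pos by (simp add: divide_right_mono)
      also have "\<dots> \<le> t / gap" using s gap_pos t by (intro divide_left_mono) auto
      finally show "k \<in> cball (- (z \<bullet> e I) / s) (t / gap)" by (simp add: dist_real_def)
    qed
    then have "measure lborel {u \<in> cball 0 1. a + V (shd x) (shd y) I u \<in> close_set \<rho> I x y r}
        \<le> (t / gap) ^ DIM(real) * measure lborel (cball (0::real) 1)"
      using t gap_pos by (intro measure_le_cball) auto
    then show "measure lborel {u \<in> cball 0 1. a + V (shd x) (shd y) I u \<in> close_set \<rho> I x y r} \<le> 2 / gap * (r / onorm (W I)) powr 1"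
      using t by (simp add: cball_eq_atLeastAtMost t_def[symmetric] mult.commute)
  qed (use gap_pos in simp)
qed

text \<open>For a conformal \<open>W I\<close> closeness controls all d coordinates. The shift u
  acts with expansion at least \<open>gap\<close>, so the admissible u lie in one d-dimensional ball
  of radius 2 r / (gap * \<open>onorm (W I)\<close>).\<close>

lemma transversal_conformal:
  assumes conf: "\<And>I w. norm (W I w) = onorm (W I) * norm w"
  shows "transversal (real DIM('a))"
proof (rule transversalI[where V = "\<lambda>i j I. opp i j" and B = "(2 / gap) ^ DIM('a) * measure lborel (cball (0::'a) 1)"])
  show "linear (opp i j)" for i j by (rule linear_opp)
  show "norm (opp i j u) \<le> 2" if "norm u \<le> 1" for i j u using norm_opp[of i j u] that by simp
  fix I and x y :: "'m stream" and r \<rho> :: real and a :: "'a ^ 'm" assume h: "shd x \<noteq> shd y" "0 < r"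
  define L where "L u = coding (opp (shd x) (shd y) u) x - coding (opp (shd x) (shd y) u) y" for u
  define z where "z = coding a x - coding a y"
  define t where "t = r / onorm (W I)"
  have t: "0 < t" using h onorm_W_pos by (simp add: t_def)
  let ?S = "{u \<in> cball 0 1. a + opp (shd x) (shd y) u \<in> close_set \<rho> I x y r}"
  have near: "norm (z + L u) \<le> t" if "u \<in> ?S" for u
  proof -
    have "coding (a + opp (shd x) (shd y) u) x - coding (a + opp (shd x) (shd y) u) y = z + L u"
      by (simp add: z_def L_def coding_add)
    then have "norm (W I (z + L u)) \<le> r" using that by (simp add: close_set_def)
    then show ?thesis unfolding conf using onorm_W_pos[of I] by (simp add: t_def pos_le_divide_eq mult.commute)
  qed
  have "\<exists>u0. ?S \<subseteq> cball u0 (2 / gap * t)"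
  proof (cases "?S = {}")
    case False
    then obtain u0 where u0: "u0 \<in> ?S" by blast
    have "?S \<subseteq> cball u0 (2 / gap * t)"
    proof
      fix u assume u: "u \<in> ?S"
      have Ld: "L (u0 - u) = (z + L u0) - (z + L u)"
        by (simp add: L_def linear_diff[OF linear_opp] linear_diff[OF linear_coding])
      have "gap * norm (u0 - u) \<le> norm (L (u0 - u))" unfolding L_def by (rule coding_opp_norm[OF h(1)])
      also have "\<dots> \<le> t + t" unfolding Ld by (rule order_trans[OF norm_triangle_ineq4 add_mono[OF near[OF u0] near[OF u]]])
      finally show "u \<in> cball u0 (2 / gap * t)" using gap_pos by (simp add: dist_norm pos_le_divide_eq mult.commute)
    qed
    then show ?thesis by blast
  qed auto
  then have "measure lborel ?S \<le> (2 / gap * t) ^ DIM('a) * measure lborel (cball (0::'a) 1)"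
    using measure_le_cball[of ?S _ "2 / gap * t"] gap_pos t by fastforce
  also have "\<dots> = (2 / gap) ^ DIM('a) * measure lborel (cball (0::'a) 1) * t powr real DIM('a)"
    using t by (simp only: power_mult_distrib powr_realpow mult_ac)
  finally show "measure lborel ?S \<le> (2 / gap) ^ DIM('a) * measure lborel (cball (0::'a) 1) * (r / onorm (W I)) powr real DIM('a)"
    by (simp add: t_def)
qed (use gap_pos in simp)

end

section \<open>Energies averaged over the translations\<close>

text \<open>Every summand is at most the largest one. The crude factor costs only a power of the
  scale number N in the application.\<close>

lemma sum_powr_le:
  fixes x :: "'b \<Rightarrow> real"
  assumes "finite A" "\<And>i. i \<in> A \<Longrightarrow> 0 \<le> x i" "0 \<le> t"
  shows "(\<Sum>i\<in>A. x i) powr t \<le> real (card A) powr t * (\<Sum>i\<in>A. x i powr t)"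
proof (cases "A = {}")
  case False
  then obtain j where j: "j \<in> A" "\<And>i. i \<in> A \<Longrightarrow> x i \<le> x j"
    using Max_in[of "x ` A"] Max_ge[of "x ` A"] assms(1) by fastforce
  have "(\<Sum>i\<in>A. x i) \<le> real (card A) * x j" using j(2) by (rule sum_bounded_above)
  then have "(\<Sum>i\<in>A. x i) powr t \<le> (real (card A) * x j) powr t" using assms by (intro powr_mono2 sum_nonneg) auto
  also have "\<dots> = real (card A) powr t * x j powr t" by (simp add: powr_mult)
  also have "x j powr t \<le> (\<Sum>i\<in>A. x i powr t)" using j(1) assms(1) by (intro member_le_sum) auto
  finally show ?thesis by (simp add: mult_left_mono)
qed simp

lemma summable_poly_geometric:
  fixes \<theta> q :: real
  assumes "0 < \<theta>" "\<theta> < 1"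
  shows "summable (\<lambda>n. (real n + 1) powr q * \<theta> ^ n)"
proof (rule summable_comparison_test_bigo)
  show "summable (\<lambda>n. norm (1 / real n ^ 2))" using inverse_power_summable[of 2, where 'a=real] by (simp add: field_simps)
  show "(\<lambda>n. (real n + 1) powr q * \<theta> ^ n) \<in> O(\<lambda>n. 1 / real n ^ 2)" using assms by real_asymp
qed

lemma dyadic_scale:
  assumes "0 < (r::real)" "r \<le> (1/2) ^ n"
  obtains k where "n \<le> k" "(1/2) ^ Suc k < r" "r \<le> (1/2) ^ k"
proof -
  obtain N where N: "(1/2) ^ N < r" using assms(1) real_arch_pow_inv[of r "1/2"] by auto
  define k where "k = (LEAST k. (1/2) ^ Suc k < r)"
  have ex: "\<exists>k. (1/2) ^ Suc k < r"
  proof -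
    have "(1/2::real) ^ Suc N \<le> (1/2) ^ N" by simp
    then show ?thesis using N le_less_trans by blast
  qed
  have k1: "(1/2) ^ Suc k < r" unfolding k_def by (rule LeastI_ex[OF ex])
  have lt: "r \<le> (1/2) ^ Suc j" if "j < k" for j using not_less_Least[of j "\<lambda>k. (1/2) ^ Suc k < r"] that by (simp add: k_def not_less)
  have nk: "n \<le> k"
  proof (rule ccontr)
    assume "\<not> n \<le> k"
    then have "(1/2::real) ^ n \<le> (1/2) ^ Suc k" by (intro power_decreasing) auto
    then show False using k1 assms(2) by linarith
  qed
  have "r \<le> (1/2) ^ k"
  proof (cases k)
    case 0
    have "(1/2::real) ^ n \<le> 1" by (intro power_le_one) auto
    then show ?thesis using 0 assms(2) by simp
  qed (use lt in simp)
  then show ?thesis using that nk k1 by blast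
qed

context affine_ifs
begin

lemma measurable_coding_raw [measurable (raw)]:
  assumes "f \<in> borel_measurable M" "g \<in> measurable M bernoulli"
  shows "(\<lambda>x. coding (f x) (g x)) \<in> borel_measurable M"
  using measurable_compose[OF measurable_Pair[OF assms] measurable_coding_pair] by simp

lemma measurable_stake_bernoulli [measurable]: "stake n \<in> measurable bernoulli (count_space UNIV)"
  by measurable

abbreviation cyl :: "nat \<Rightarrow> 'm stream \<Rightarrow> 'm stream set" where
  "cyl n \<omega> \<equiv> {\<omega>'. stake n \<omega>' = stake n \<omega>}"

lemma cyl_sets [measurable]: "cyl n \<omega> \<in> sets bernoulli"
  using measurable_sets[OF measurable_stake_bernoulli, of "{stake n \<omega>}" n] by (simp add: vimage_def)

lemma prob_cylinder: "B.prob (cyl n \<omega>0) = pw (stake n \<omega>0)"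
proof -
  have "emeasure bernoulli (cyl n \<omega>0) = (\<integral>\<^sup>+\<omega>. indicator {stake n \<omega>0} (stake n \<omega>) \<partial>bernoulli)"
  proof -
    have "emeasure bernoulli (cyl n \<omega>0) = (\<integral>\<^sup>+\<omega>. indicator (cyl n \<omega>0) \<omega> \<partial>bernoulli)"
      by (rule nn_integral_indicator[symmetric]) measurable
    then show ?thesis by (simp add: indicator_def)
  qed
  also have "\<dots> = (\<Sum>I | length I = n. ennreal (pw I) * indicator {stake n \<omega>0} I)" by (rule nn_integral_bernoulli_stake)
  also have "\<dots> = (\<Sum>I\<in>{stake n \<omega>0}. ennreal (pw I) * indicator {stake n \<omega>0} I)"
    by (rule sum.mono_neutral_right) (auto simp: indicator_def)
  finally show ?thesis by (simp add: B.emeasure_eq_measure less_imp_le[OF pw_pos])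
qed

lemma prob_sam_cball: "measure (sam a) (cball x r) = B.prob {\<omega>'. dist x (coding a \<omega>') \<le> r}"
  unfolding sam_def by (subst measure_distr) (auto simp: vimage_def)

lemma nn_integral_sam:
  "f \<in> borel_measurable borel \<Longrightarrow> (\<integral>\<^sup>+x. f x \<partial>sam a) = (\<integral>\<^sup>+\<omega>. f (coding a \<omega>) \<partial>bernoulli)"
  unfolding sam_def by (rule nn_integral_distr) auto

lemma corr_integral_sam:
  "corr_integral (sam a) q r = (\<integral>\<^sup>+\<omega>. ennreal (B.prob {\<omega>'. dist (coding a \<omega>) (coding a \<omega>') \<le> r} powr (q - 1)) \<partial>bernoulli)"
proof -
  interpret M: borel_prob "sam a" by (rule borel_prob_sam)
  have "corr_integral (sam a) q r = (\<integral>\<^sup>+\<omega>. ennreal (M.prob (cball (coding a \<omega>) r) powr (q - 1)) \<partial>bernoulli)"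
    unfolding corr_integral_def by (rule nn_integral_sam) measurable
  then show ?thesis by (simp add: prob_sam_cball)
qed

text \<open>The symbolic majorant of the energy at scale \<open>2\<^sup>-\<^sup>N\<close>: pairs are sorted by the length \<open>n\<close> of their common prefix.\<close>

abbreviation branch :: "real \<Rightarrow> nat \<Rightarrow> 'a ^ 'm \<Rightarrow> 'm stream \<Rightarrow> 'm stream set" where
  "branch r n a \<omega> \<equiv> {\<omega>'. stake n \<omega>' = stake n \<omega> \<and> \<omega>' !! n \<noteq> \<omega> !! n \<and> dist (coding a \<omega>) (coding a \<omega>') \<le> r}"

text \<open>An integral rather than a probability, so that joint measurability and Fubini apply to
  it directly; \<open>branch_mass_eq\<close> translates back.\<close>

definition branch_mass :: "real \<Rightarrow> nat \<Rightarrow> 'a ^ 'm \<Rightarrow> 'm stream \<Rightarrow> ennreal" where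
  "branch_mass r n a \<omega> = (\<integral>\<^sup>+\<omega>'. indicator (branch r n a \<omega>) \<omega>' \<partial>bernoulli)"

definition branch_energy :: "real \<Rightarrow> real \<Rightarrow> nat \<Rightarrow> 'a ^ 'm \<Rightarrow> ennreal" where
  "branch_energy q r n a = (\<integral>\<^sup>+\<omega>. ennreal (pw (stake n \<omega>) powr (q - 2)) * branch_mass r n a \<omega> \<partial>bernoulli)"

text \<open>The N + 1 groups of pairs are the N branches and the pairs agreeing on N letters. The
  latter enter with their full mass whatever their distance, and the prefactor is the price of
  \<open>sum_powr_le\<close> for N + 1 summands.\<close>

definition majorant :: "real \<Rightarrow> nat \<Rightarrow> 'a ^ 'm \<Rightarrow> ennreal" where
  "majorant q N a = ennreal (real (Suc N) powr (q - 1)) *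
     ((\<Sum>n<N. branch_energy q ((1/2) ^ N) n a)
      + (\<integral>\<^sup>+\<omega>. ennreal (pw (stake N \<omega>) powr (q - 1)) \<partial>bernoulli))"

lemma branch_pred [measurable]:
  "Measurable.pred ((lborel \<Otimes>\<^sub>M bernoulli) \<Otimes>\<^sub>M bernoulli)
    (\<lambda>z. stake n (snd z) = stake n (snd (fst z)) \<and> snd z !! n \<noteq> snd (fst z) !! n \<and>
         dist (coding (fst (fst z)) (snd (fst z))) (coding (fst (fst z)) (snd z)) \<le> r)"
  by measurable

lemma measurable_branch_mass [measurable]:
  "(\<lambda>z. branch_mass r n (fst z) (snd z)) \<in> borel_measurable (lborel \<Otimes>\<^sub>M bernoulli)"
proof -
  have "(\<lambda>z. indicator {z. stake n (snd z) = stake n (snd (fst z)) \<and> snd z !! n \<noteq> snd (fst z) !! n \<and>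
         dist (coding (fst (fst z)) (snd (fst z))) (coding (fst (fst z)) (snd z)) \<le> r} z :: ennreal)
      \<in> borel_measurable ((lborel \<Otimes>\<^sub>M bernoulli) \<Otimes>\<^sub>M bernoulli)"
    using branch_pred[of n r] by (intro borel_measurable_indicator) (simp add: pred_def space_pair_measure)
  then have "(\<lambda>z. \<integral>\<^sup>+\<omega>'. indicator {z. stake n (snd z) = stake n (snd (fst z)) \<and> snd z !! n \<noteq> snd (fst z) !! n \<and>
         dist (coding (fst (fst z)) (snd (fst z))) (coding (fst (fst z)) (snd z)) \<le> r} (z, \<omega>') \<partial>bernoulli) \<in> borel_measurable (lborel \<Otimes>\<^sub>M bernoulli)"
    by (intro B.borel_measurable_nn_integral) (simp add: split_def)
  then show ?thesis by (simp add: branch_mass_def indicator_def)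
qed

lemma measurable_branch_mass_raw [measurable (raw)]:
  assumes "f \<in> measurable M lborel" "g \<in> measurable M bernoulli"
  shows "(\<lambda>x. branch_mass r n (f x) (g x)) \<in> borel_measurable M"
  using measurable_compose[OF measurable_Pair[OF assms] measurable_branch_mass] by simp

lemma branch_set [measurable]:
  "branch r n a \<omega> \<in> sets bernoulli"
proof -
  have "Measurable.pred bernoulli (\<lambda>\<omega>'. stake n \<omega>' = stake n \<omega> \<and> \<omega>' !! n \<noteq> \<omega> !! n \<and> dist (coding a \<omega>) (coding a \<omega>') \<le> r)"
    by measurable
  then show ?thesis by (simp add: pred_def)
qed

lemma branch_mass_eq:
  "branch_mass r n a \<omega> = ennreal (B.prob (branch r n a \<omega>))"
  unfolding branch_mass_def by (simp add: nn_integral_indicator[OF branch_set] B.emeasure_eq_measure)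

lemma first_difference:
  assumes "stake N x \<noteq> stake N y"
  obtains n where "n < N" "stake n x = stake n y" "x !! n \<noteq> y !! n"
proof -
  have "\<exists>n<N. stake n x = stake n y \<and> x !! n \<noteq> y !! n" using assms
  proof (induction N)
    case (Suc N)
    show ?case
    proof (cases "stake N x = stake N y")
      case True
      have "stake N x @ [x !! N] \<noteq> stake N y @ [y !! N]" using Suc.prems by (simp only: stake_Suc not_False_eq_True)
      then have "x !! N \<noteq> y !! N" using True by simp
      then show ?thesis using True by blast
    next
      case False
      then show ?thesis using Suc.IH less_SucI by blast
    qed
  qed simp
  then show ?thesis using that by blast
qed

lemma corr_integral_le_majorant:
  assumes q: "2 \<le> q"
  shows "corr_integral (sam a) q ((1/2) ^ N) \<le> majorant q N a"
proof -
  define r where "r = (1/2::real) ^ N"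
  define \<nu> where "\<nu> n \<omega> = B.prob (branch r n a \<omega>)" for n \<omega>
  have nu0: "0 \<le> \<nu> n \<omega>" for n \<omega> by (simp add: \<nu>_def)
  have \<nu>_le: "\<nu> n \<omega> \<le> pw (stake n \<omega>)" for n \<omega>
    unfolding \<nu>_def prob_cylinder[symmetric] by (intro B.finite_measure_mono cyl_sets) auto
  have pt: "B.prob {\<omega>'. dist (coding a \<omega>) (coding a \<omega>') \<le> r} powr (q - 1)
     \<le> real (Suc N) powr (q - 1) * ((\<Sum>n<N. pw (stake n \<omega>) powr (q - 2) * \<nu> n \<omega>) + pw (stake N \<omega>) powr (q - 1))" for \<omega>
  proof -
    define x where "x n = (if n < N then \<nu> n \<omega> else pw (stake N \<omega>))" for n
    have xn: "0 \<le> x n" for n by (simp add: x_def \<nu>_def less_imp_le[OF pw_pos])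
    have "B.prob {\<omega>'. dist (coding a \<omega>) (coding a \<omega>') \<le> r}
        \<le> B.prob ((\<Union>n<N. branch r n a \<omega>) \<union> cyl N \<omega>)"
      by (intro B.finite_measure_mono sets.Un sets.finite_UN branch_set cyl_sets) (auto elim: first_difference)
    also have "\<dots> \<le> B.prob (\<Union>n<N. branch r n a \<omega>) + B.prob (cyl N \<omega>)"
      by (intro measure_Un_le sets.finite_UN branch_set cyl_sets) auto
    also have "\<dots> \<le> (\<Sum>n<N. \<nu> n \<omega>) + pw (stake N \<omega>)" unfolding prob_cylinder \<nu>_def
      by (intro add_mono order_refl B.finite_measure_subadditive_finite) auto
    also have "\<dots> = (\<Sum>n<Suc N. x n)" by (simp add: x_def)
    finally have "B.prob {\<omega>'. dist (coding a \<omega>) (coding a \<omega>') \<le> r} powr (q - 1) \<le> (\<Sum>n<Suc N. x n) powr (q - 1)"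
      using q by (intro powr_mono2) auto
    also have "\<dots> \<le> real (card {..<Suc N}) powr (q - 1) * (\<Sum>n<Suc N. x n powr (q - 1))"
      using q xn by (intro sum_powr_le) auto
    also have "(\<Sum>n<Suc N. x n powr (q - 1)) = (\<Sum>n<N. \<nu> n \<omega> powr (q - 1)) + pw (stake N \<omega>) powr (q - 1)" by (simp add: x_def)
    also have "(\<Sum>n<N. \<nu> n \<omega> powr (q - 1)) \<le> (\<Sum>n<N. pw (stake n \<omega>) powr (q - 2) * \<nu> n \<omega>)"
    proof (intro sum_mono)
      fix n
      \<comment> \<open>Splitting off one factor keeps the bound linear in \<open>\<nu>\<close>, the
        quantity that depends on a and has to be averaged.\<close>
      have "\<nu> n \<omega> powr (q - 1) = \<nu> n \<omega> powr (q - 2) * \<nu> n \<omega>"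
      proof (cases "\<nu> n \<omega> = 0")
        case False
        then have "0 < \<nu> n \<omega>" using nu0[of n \<omega>] by simp
        then have "\<nu> n \<omega> powr (q - 2) * \<nu> n \<omega> powr 1 = \<nu> n \<omega> powr (q - 1)" unfolding powr_add[symmetric] by simp
        then show ?thesis using \<open>0 < \<nu> n \<omega>\<close> by simp
      qed simp
      also have "\<dots> \<le> pw (stake n \<omega>) powr (q - 2) * \<nu> n \<omega>"
        using \<nu>_le[of n \<omega>] q by (intro mult_right_mono powr_mono2) (auto simp: \<nu>_def)
      finally show "\<nu> n \<omega> powr (q - 1) \<le> pw (stake n \<omega>) powr (q - 2) * \<nu> n \<omega>" .
    qed
    finally show ?thesis by (simp add: mult_left_mono)
  qed
  have bm: "branch_mass r n a \<omega> = ennreal (\<nu> n \<omega>)" for n \<omega> unfolding \<nu>_def by (rule branch_mass_eq)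
  have "corr_integral (sam a) q r \<le> (\<integral>\<^sup>+\<omega>. ennreal (real (Suc N) powr (q - 1)) *
     ((\<Sum>n<N. ennreal (pw (stake n \<omega>) powr (q - 2)) * branch_mass r n a \<omega>) + ennreal (pw (stake N \<omega>) powr (q - 1))) \<partial>bernoulli)"
    unfolding corr_integral_sam
  proof (intro nn_integral_mono)
    fix \<omega>
    have "ennreal (B.prob {\<omega>'. dist (coding a \<omega>) (coding a \<omega>') \<le> r} powr (q - 1))
      \<le> ennreal (real (Suc N) powr (q - 1) * ((\<Sum>n<N. pw (stake n \<omega>) powr (q - 2) * \<nu> n \<omega>) + pw (stake N \<omega>) powr (q - 1)))"
      by (rule ennreal_leI[OF pt])
    also have "\<dots> = ennreal (real (Suc N) powr (q - 1)) *
      ((\<Sum>n<N. ennreal (pw (stake n \<omega>) powr (q - 2)) * branch_mass r n a \<omega>) + ennreal (pw (stake N \<omega>) powr (q - 1)))"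
    proof -
      have "(\<Sum>n<N. ennreal (pw (stake n \<omega>) powr (q - 2)) * branch_mass r n a \<omega>) = ennreal (\<Sum>n<N. pw (stake n \<omega>) powr (q - 2) * \<nu> n \<omega>)"
        unfolding bm by (simp only: ennreal_mult[symmetric] powr_ge_zero nu0 sum_ennreal mult_nonneg_nonneg)
      moreover have "0 \<le> (\<Sum>n<N. pw (stake n \<omega>) powr (q - 2) * \<nu> n \<omega>)" using nu0 by (intro sum_nonneg) simp
      ultimately show ?thesis by (simp only: ennreal_mult ennreal_plus powr_ge_zero add_nonneg_nonneg)
    qed
    finally show "ennreal (B.prob {\<omega>'. dist (coding a \<omega>) (coding a \<omega>') \<le> r} powr (q - 1)) \<le> ennreal (real (Suc N) powr (q - 1)) *
      ((\<Sum>n<N. ennreal (pw (stake n \<omega>) powr (q - 2)) * branch_mass r n a \<omega>) + ennreal (pw (stake N \<omega>) powr (q - 1)))" .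
  qed
  also have "\<dots> = majorant q N a"
  proof -
    have [measurable]: "(\<lambda>\<omega>. ennreal (pw (stake n \<omega>) powr q')) \<in> borel_measurable bernoulli" for n q'
      by (rule measurable_compose[OF measurable_stake_bernoulli]) simp
    show ?thesis unfolding majorant_def branch_energy_def r_def[symmetric]
      by (subst nn_integral_cmult, measurable, subst nn_integral_add, measurable, subst nn_integral_sum, measurable)
  qed
  finally show ?thesis by (simp add: r_def)
qed

end

section \<open>Averaging the majorant over the translations\<close>

context affine_ifs
begin

text \<open>The level sums of the defining series with phi^s replaced by the s-th power of the norm
  and \<sigma> = (q - 1) s, bounded uniformly in the level.\<close>

definition moment_bound :: "real \<Rightarrow> real \<Rightarrow> real \<Rightarrow> bool" where
  "moment_bound q \<sigma> M \<longleftrightarrow> (\<forall>n. (\<Sum>I | length I = n. pw I powr q * onorm (W I) powr - \<sigma>) \<le> M)"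

lemma moment_bound_nonneg: "moment_bound q \<sigma> M \<Longrightarrow> 0 \<le> M"
  unfolding moment_bound_def by (meson order_trans sum_nonneg mult_nonneg_nonneg powr_ge_zero)

text \<open>For fixed streams with a common prefix of length n and different next letters, the
  translations that count form a \<open>close_set\<close>. Transversality bounds its volume, and
  integrating over the second stream gives the mass of the cylinder.\<close>

lemma nn_integral_branch_mass_le:
  assumes C: "\<And>I x y. shd x \<noteq> shd y \<Longrightarrow> emeasure lborel (close_set \<rho> I x y r) \<le> ennreal (C * (r / onorm (W I)) powr \<sigma>)"
    and "0 \<le> C"
  shows "(\<integral>\<^sup>+a\<in>cball 0 \<rho>. branch_mass r n a \<omega> \<partial>lborel)
    \<le> ennreal (pw (stake n \<omega>)) * ennreal (C * (r / onorm (W (stake n \<omega>))) powr \<sigma>)"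
proof -
  interpret P: pair_sigma_finite "lborel :: ('a ^ 'm) measure" bernoulli ..
  define E where "E a = branch r n a \<omega>" for a
  have [measurable]: "cball (0::'a ^ 'm) \<rho> \<in> sets borel" by simp
  have mE: "(\<lambda>z. indicator (E (fst z)) (snd z) * indicator (cball 0 \<rho>) (fst z) :: ennreal) \<in> borel_measurable (lborel \<Otimes>\<^sub>M bernoulli)"
  proof -
    have "Measurable.pred (lborel \<Otimes>\<^sub>M bernoulli) (\<lambda>z. stake n (snd z) = stake n \<omega> \<and> snd z !! n \<noteq> \<omega> !! n \<and>
        dist (coding (fst z) \<omega>) (coding (fst z) (snd z)) \<le> r)" by measurable
    then have "(\<lambda>z. indicator {z. stake n (snd z) = stake n \<omega> \<and> snd z !! n \<noteq> \<omega> !! n \<and>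
        dist (coding (fst z) \<omega>) (coding (fst z) (snd z)) \<le> r} z :: ennreal) \<in> borel_measurable (lborel \<Otimes>\<^sub>M bernoulli)"
      by (intro borel_measurable_indicator) (simp add: pred_def space_pair_measure)
    then have [measurable]: "(\<lambda>z. indicator (E (fst z)) (snd z) :: ennreal) \<in> borel_measurable (lborel \<Otimes>\<^sub>M bernoulli)"
      by (simp add: E_def indicator_def)
    show ?thesis by measurable
  qed
  have "(\<integral>\<^sup>+a\<in>cball 0 \<rho>. branch_mass r n a \<omega> \<partial>lborel)
      = (\<integral>\<^sup>+a. \<integral>\<^sup>+\<omega>'. indicator (E a) \<omega>' * indicator (cball 0 \<rho>) a \<partial>bernoulli \<partial>lborel)"
    unfolding branch_mass_def E_def by (intro nn_integral_cong nn_integral_multc[symmetric] borel_measurable_indicator branch_set)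
  also have "\<dots> = (\<integral>\<^sup>+\<omega>'. (\<integral>\<^sup>+a\<in>cball 0 \<rho>. indicator (E a) \<omega>' \<partial>lborel) \<partial>bernoulli)"
    using mE by (intro P.Fubini'[symmetric]) (simp add: split_def)
  also have "\<dots> \<le> (\<integral>\<^sup>+\<omega>'. ennreal (C * (r / onorm (W (stake n \<omega>))) powr \<sigma>) * indicator (cyl n \<omega>) \<omega>' \<partial>bernoulli)"
  proof (intro nn_integral_mono)
    fix \<omega>'
    show "(\<integral>\<^sup>+a\<in>cball 0 \<rho>. indicator (E a) \<omega>' \<partial>lborel) \<le> ennreal (C * (r / onorm (W (stake n \<omega>))) powr \<sigma>) * indicator (cyl n \<omega>) \<omega>'"
    proof (cases "stake n \<omega>' = stake n \<omega> \<and> \<omega>' !! n \<noteq> \<omega> !! n")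
      case True
      \<comment> \<open>The tails behind the common prefix start with different letters, as
        transversality requires.\<close>
      define x y where "x = sdrop n \<omega>" "y = sdrop n \<omega>'"
      have ne: "shd x \<noteq> shd y" using True by (metis x_y_def sdrop_simps(1))
      have "\<omega> = stake n \<omega> @- x" "\<omega>' = stake n \<omega> @- y" using True stake_sdrop[of n \<omega>'] by (simp_all add: x_y_def stake_sdrop)
      then have d: "dist (coding a \<omega>) (coding a \<omega>') = norm (W (stake n \<omega>) (coding a x - coding a y))" for a
        unfolding dist_norm using coding_shift_diff by metis
      have "(\<integral>\<^sup>+a\<in>cball 0 \<rho>. indicator (E a) \<omega>' \<partial>lborel) = (\<integral>\<^sup>+a. indicator (close_set \<rho> (stake n \<omega>) x y r) a \<partial>lborel)"
        using True by (intro nn_integral_cong) (auto simp: E_def close_set_def d indicator_def)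
      also have "\<dots> = emeasure lborel (close_set \<rho> (stake n \<omega>) x y r)" by (intro nn_integral_indicator) simp
      also have "\<dots> \<le> ennreal (C * (r / onorm (W (stake n \<omega>))) powr \<sigma>)" by (rule C[OF ne])
      finally show ?thesis using True by simp
    next
      case False
      then have "indicator (E a) \<omega>' = (0::ennreal)" for a by (auto simp: E_def indicator_def)
      then show ?thesis by simp
    qed
  qed
  also have "\<dots> = ennreal (C * (r / onorm (W (stake n \<omega>))) powr \<sigma>) * emeasure bernoulli (cyl n \<omega>)"
    by (rule nn_integral_cmult_indicator[OF cyl_sets])
  also have "emeasure bernoulli (cyl n \<omega>) = ennreal (pw (stake n \<omega>))" by (simp add: B.emeasure_eq_measure prob_cylinder)
  finally show ?thesis by (simp add: mult.commute)
qed

lemma measurable_word_fun [measurable]: "(\<lambda>\<omega>. f (stake n \<omega>) :: ennreal) \<in> borel_measurable bernoulli"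
  by (rule measurable_compose[OF measurable_stake_bernoulli]) simp

text \<open>The exponent q of p_I is made up of q - 2 from the weight, 1 from the cylinder of the
  second stream and 1 from integrating over the first.\<close>

lemma branch_term_le:
  assumes tr: "\<And>I x y. shd x \<noteq> shd y \<Longrightarrow> emeasure lborel (close_set \<rho> I x y r) \<le> ennreal (C * (r / onorm (W I)) powr \<sigma>)"
    and C: "0 \<le> C" and r: "0 < r" and M: "moment_bound q \<sigma> M"
  shows "(\<integral>\<^sup>+a\<in>cball 0 \<rho>. branch_energy q r n a \<partial>lborel)
     \<le> ennreal (C * M * r powr \<sigma>)"
proof -
  interpret P: pair_sigma_finite "lborel :: ('a ^ 'm) measure" bernoulli ..
  have [measurable]: "cball (0::'a ^ 'm) \<rho> \<in> sets borel" by simp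
  have [measurable]: "(\<lambda>\<omega>. branch_mass r n a \<omega>) \<in> borel_measurable bernoulli" for a by measurable
  have [measurable]: "(\<lambda>a. branch_mass r n a \<omega>) \<in> borel_measurable lborel" for \<omega> by measurable
  have m: "(\<lambda>(a, \<omega>). ennreal (pw (stake n \<omega>) powr (q - 2)) * branch_mass r n a \<omega> * indicator (cball 0 \<rho>) a)
      \<in> borel_measurable (lborel \<Otimes>\<^sub>M bernoulli)"
  proof -
    have "(\<lambda>z. ennreal (pw (stake n (snd z)) powr (q - 2))) \<in> borel_measurable ((lborel :: ('a^'m) measure) \<Otimes>\<^sub>M bernoulli)"
      by (rule measurable_compose[OF measurable_snd measurable_word_fun])
    then show ?thesis using measurable_branch_mass[of r n] by (simp add: split_def)
  qed
  define f where "f I = ennreal (pw I powr (q - 1) * (C * (r / onorm (W I)) powr \<sigma>))" for I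
  have "(\<integral>\<^sup>+a\<in>cball 0 \<rho>. branch_energy q r n a \<partial>lborel)
     = (\<integral>\<^sup>+a. \<integral>\<^sup>+\<omega>. ennreal (pw (stake n \<omega>) powr (q - 2)) * branch_mass r n a \<omega> * indicator (cball 0 \<rho>) a \<partial>bernoulli \<partial>lborel)"
    unfolding branch_energy_def by (intro nn_integral_cong nn_integral_multc[symmetric]) measurable
  also have "\<dots> = (\<integral>\<^sup>+\<omega>. (\<integral>\<^sup>+a\<in>cball 0 \<rho>. ennreal (pw (stake n \<omega>) powr (q - 2)) * branch_mass r n a \<omega> \<partial>lborel) \<partial>bernoulli)"
    by (rule P.Fubini'[OF m, symmetric])
  also have "\<dots> = (\<integral>\<^sup>+\<omega>. ennreal (pw (stake n \<omega>) powr (q - 2)) * (\<integral>\<^sup>+a\<in>cball 0 \<rho>. branch_mass r n a \<omega> \<partial>lborel) \<partial>bernoulli)"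
    by (intro nn_integral_cong) (simp add: mult.assoc nn_integral_cmult)
  also have "\<dots> \<le> (\<integral>\<^sup>+\<omega>. f (stake n \<omega>) \<partial>bernoulli)"
  proof (intro nn_integral_mono)
    fix \<omega> :: "'m stream"
    let ?I = "stake n \<omega>"
    have "pw ?I powr (q - 2) * pw ?I = pw ?I powr (q - 1)"
      using powr_add[of "pw ?I" "q - 2" 1] pw_pos[of ?I] by simp
    then have "ennreal (pw ?I powr (q - 2)) * (ennreal (pw ?I) * ennreal (C * (r / onorm (W ?I)) powr \<sigma>)) = f ?I"
      unfolding f_def using C pw_pos[of ?I] by (simp add: ennreal_mult[symmetric] mult.assoc[symmetric] less_imp_le)
    then show "ennreal (pw ?I powr (q - 2)) * (\<integral>\<^sup>+a\<in>cball 0 \<rho>. branch_mass r n a \<omega> \<partial>lborel) \<le> f ?I"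
      using mult_left_mono[OF nn_integral_branch_mass_le[OF tr C], of "ennreal (pw ?I powr (q - 2))" n \<omega>] by simp
  qed
  also have "\<dots> = (\<Sum>I | length I = n. ennreal (pw I) * f I)" by (rule nn_integral_bernoulli_stake)
  also have "\<dots> = (\<Sum>I | length I = n. ennreal (C * r powr \<sigma> * (pw I powr q * onorm (W I) powr - \<sigma>)))"
  proof (intro sum.cong refl)
    fix I :: "'m list"
    have "pw I * pw I powr (q - 1) = pw I powr q" using powr_add[of "pw I" 1 "q - 1"] pw_pos[of I] by simp
    moreover have "(r / onorm (W I)) powr \<sigma> = r powr \<sigma> * onorm (W I) powr - \<sigma>"
      using r onorm_W_pos[of I] by (simp add: powr_divide powr_minus_divide)
    ultimately have "pw I * (pw I powr (q - 1) * (C * (r / onorm (W I)) powr \<sigma>)) = C * r powr \<sigma> * (pw I powr q * onorm (W I) powr - \<sigma>)"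
      by (simp add: mult_ac)
    then show "ennreal (pw I) * f I = ennreal (C * r powr \<sigma> * (pw I powr q * onorm (W I) powr - \<sigma>))"
      unfolding f_def using C pw_pos[of I] by (simp add: ennreal_mult[symmetric] less_imp_le)
  qed
  also have "\<dots> = ennreal (C * r powr \<sigma> * (\<Sum>I | length I = n. pw I powr q * onorm (W I) powr - \<sigma>))"
    using C by (subst sum_ennreal) (auto simp: sum_distrib_left)
  also have "\<dots> \<le> ennreal (C * r powr \<sigma> * M)"
    using C M by (intro ennreal_leI mult_left_mono) (auto simp: moment_bound_def)
  finally show ?thesis by (simp add: mult_ac)
qed

text \<open>Words of length N have norm at most 2^-N, so p_I^q may be multiplied by (2^-N /
  \<open>onorm (W I)\<close>)^\<sigma> >= 1.\<close>

lemma tail_term_le: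
  assumes M: "moment_bound q \<sigma> M" and "0 \<le> \<sigma>"
  shows "(\<integral>\<^sup>+\<omega>. ennreal (pw (stake N \<omega>) powr (q - 1)) \<partial>bernoulli) \<le> ennreal (M * ((1/2) ^ N) powr \<sigma>)"
proof -
  have "(\<integral>\<^sup>+\<omega>. ennreal (pw (stake N \<omega>) powr (q - 1)) \<partial>bernoulli) = (\<Sum>I | length I = N. ennreal (pw I) * ennreal (pw I powr (q - 1)))"
    by (rule nn_integral_bernoulli_stake)
  also have "\<dots> \<le> (\<Sum>I | length I = N. ennreal (((1/2) ^ N) powr \<sigma> * (pw I powr q * onorm (W I) powr - \<sigma>)))"
  proof (intro sum_mono)
    fix I :: "'m list" assume I: "I \<in> {I. length I = N}"
    have "pw I * pw I powr (q - 1) = pw I powr q" using powr_add[of "pw I" 1 "q - 1"] pw_pos[of I] by simp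
    also have "\<dots> = onorm (W I) powr \<sigma> * (pw I powr q * onorm (W I) powr - \<sigma>)"
      using onorm_W_pos[of I] by (simp add: powr_minus)
    also have "\<dots> \<le> ((1/2) ^ N) powr \<sigma> * (pw I powr q * onorm (W I) powr - \<sigma>)"
      using onorm_W_le[of I] onorm_W_pos[of I] I assms(2) by (intro mult_right_mono powr_mono2) auto
    finally show "ennreal (pw I) * ennreal (pw I powr (q - 1)) \<le> ennreal (((1/2) ^ N) powr \<sigma> * (pw I powr q * onorm (W I) powr - \<sigma>))"
      using pw_pos[of I] by (simp add: ennreal_mult[symmetric] ennreal_leI less_imp_le)
  qed
  also have "\<dots> = ennreal (((1/2) ^ N) powr \<sigma> * (\<Sum>I | length I = N. pw I powr q * onorm (W I) powr - \<sigma>))"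
    by (subst sum_ennreal) (auto simp: sum_distrib_left)
  also have "\<dots> \<le> ennreal (((1/2) ^ N) powr \<sigma> * M)"
    using M by (intro ennreal_leI mult_left_mono) (auto simp: moment_bound_def)
  finally show ?thesis by (simp add: mult.commute)
qed

lemma measurable_branch_energy [measurable]: "branch_energy q r n \<in> borel_measurable lborel"
proof -
  have [measurable]: "(\<lambda>z. ennreal (pw (stake n (snd z)) powr (q - 2))) \<in> borel_measurable ((lborel :: ('a^'m) measure) \<Otimes>\<^sub>M bernoulli)"
    by (rule measurable_compose[OF measurable_snd measurable_word_fun])
  show ?thesis unfolding branch_energy_def[abs_def]
    using measurable_branch_mass[of r n] by (intro B.borel_measurable_nn_integral) (simp add: split_def)
qed

lemma measurable_majorant [measurable]: "majorant q N \<in> borel_measurable lborel"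
  unfolding majorant_def[abs_def] by measurable

text \<open>At most N + 1 contributions of order 2^(-\<sigma> N), times the prefactor (N+1)^(q-1),
  give (N+1)^q; in terms of the radius this loss is logarithmic.\<close>

lemma nn_integral_majorant_le:
  assumes D: "transversal D" and \<sigma>: "0 \<le> \<sigma>" "\<sigma> \<le> D" and M: "moment_bound q \<sigma> M"
  shows "\<exists>C\<ge>0. \<forall>N. (\<integral>\<^sup>+a\<in>cball 0 \<rho>. majorant q N a \<partial>lborel) \<le> ennreal (C * (real N + 1) powr q * ((1/2) powr \<sigma>) ^ N)"
proof -
  obtain C where C: "0 < C" "\<And>I x y r s. shd x \<noteq> shd y \<Longrightarrow> 0 < r \<Longrightarrow> 0 \<le> s \<Longrightarrow> s \<le> D \<Longrightarrow>
     emeasure lborel (close_set \<rho> I x y r) \<le> ennreal (C * (r / onorm (W I)) powr s)"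
    using D unfolding transversal_def by metis
  define \<Lambda> where "\<Lambda> = measure lborel (cball (0::'a ^ 'm) \<rho>)"
  have M0: "0 \<le> M" using moment_bound_nonneg[OF M] .
  have L0: "0 \<le> \<Lambda>" by (simp add: \<Lambda>_def)
  have [measurable]: "cball (0::'a ^ 'm) \<rho> \<in> sets borel" by simp
  have "(\<integral>\<^sup>+a\<in>cball 0 \<rho>. majorant q N a \<partial>lborel) \<le> ennreal ((C + \<Lambda>) * M * (real N + 1) powr q * ((1/2) powr \<sigma>) ^ N)" for N
  proof -
    define g where "g = ((1/2::real) ^ N) powr \<sigma>"
    define b where "b = branch_energy q ((1/2) ^ N)"
    have [measurable]: "b n \<in> borel_measurable lborel" for n by (simp add: b_def measurable_branch_energy)
    define w where "w = (\<integral>\<^sup>+\<omega>. ennreal (pw (stake N \<omega>) powr (q - 1)) \<partial>bernoulli)"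
    have bi: "(\<integral>\<^sup>+a\<in>cball 0 \<rho>. b n a \<partial>lborel) \<le> ennreal (C * M * g)" for n
      unfolding b_def g_def using C \<sigma> by (intro branch_term_le M) auto
    have wi: "w \<le> ennreal (M * g)" unfolding w_def g_def by (rule tail_term_le[OF M \<sigma>(1)])
    have "(\<integral>\<^sup>+a\<in>cball 0 \<rho>. majorant q N a \<partial>lborel)
       = (\<integral>\<^sup>+a. ennreal (real (Suc N) powr (q - 1)) * ((\<Sum>n<N. b n a * indicator (cball 0 \<rho>) a) + w * indicator (cball 0 \<rho>) a) \<partial>lborel)"
      unfolding majorant_def b_def w_def by (intro nn_integral_cong) (simp add: sum_distrib_right distrib_right mult.assoc)
    also have "\<dots> = ennreal (real (Suc N) powr (q - 1)) * ((\<Sum>n<N. \<integral>\<^sup>+a\<in>cball 0 \<rho>. b n a \<partial>lborel) + w * emeasure lborel (cball (0::'a^'m) \<rho>))"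
      by (subst nn_integral_cmult, measurable, subst nn_integral_add, measurable, subst nn_integral_sum, measurable, subst nn_integral_cmult_indicator, measurable)
    also have "\<dots> \<le> ennreal (real (Suc N) powr (q - 1)) * ((\<Sum>n<N. ennreal (C * M * g)) + ennreal (M * g) * ennreal \<Lambda>)"
      unfolding \<Lambda>_def using emeasure_eq_measure2[OF cball_fmeasurable, of "0::'a^'m" \<rho>]
      by (intro mult_left_mono add_mono sum_mono bi mult_mono wi) auto
    also have "\<dots> = ennreal (real (Suc N) powr (q - 1) * (real N * (C * M * g) + M * g * \<Lambda>))"
    proof -
      have n: "0 \<le> C * M * g" "0 \<le> M * g" using C M0 by (auto simp: g_def)
      have "(\<Sum>n<N. ennreal (C * M * g)) = ennreal (real N * (C * M * g))" using n by (subst sum_ennreal) auto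
      moreover have "ennreal (M * g) * ennreal \<Lambda> = ennreal (M * g * \<Lambda>)" by (rule ennreal_mult[OF n(2) L0, symmetric])
      moreover have "0 \<le> real N * (C * M * g)" "0 \<le> M * g * \<Lambda>" using n L0 by auto
      ultimately show ?thesis by (simp only: ennreal_plus[symmetric] ennreal_mult[symmetric] powr_ge_zero add_nonneg_nonneg)
    qed
    also have "\<dots> \<le> ennreal ((C + \<Lambda>) * M * (real N + 1) powr q * g)"
    proof (intro ennreal_leI)
      have g0: "0 \<le> g" by (simp add: g_def)
      have "real N * (C * M * g) + M * g * \<Lambda> \<le> (real N + 1) * ((C + \<Lambda>) * M * g)"
      proof -
        have "(real N + 1) * ((C + \<Lambda>) * M * g) - (real N * (C * M * g) + M * g * \<Lambda>) = C * M * g + real N * (\<Lambda> * M * g)"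
          by (simp add: algebra_simps)
        moreover have "0 \<le> C * M * g + real N * (\<Lambda> * M * g)" using C M0 L0 g0 by (intro add_nonneg_nonneg mult_nonneg_nonneg) auto
        ultimately show ?thesis by linarith
      qed
      then have "real (Suc N) powr (q - 1) * (real N * (C * M * g) + M * g * \<Lambda>) \<le> real (Suc N) powr (q - 1) * ((real N + 1) * ((C + \<Lambda>) * M * g))"
        by (intro mult_left_mono) auto
      also have "\<dots> = (real (Suc N) powr (q - 1) * real (Suc N) powr 1) * ((C + \<Lambda>) * M * g)" by (simp add: add.commute)
      also have "\<dots> = (C + \<Lambda>) * M * (real N + 1) powr q * g" unfolding powr_add[symmetric] by (simp add: add.commute mult_ac)
      finally show "real (Suc N) powr (q - 1) * (real N * (C * M * g) + M * g * \<Lambda>) \<le> (C + \<Lambda>) * M * (real N + 1) powr q * g" .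
    qed
    also have "g = ((1/2) powr \<sigma>) ^ N" unfolding g_def by (simp add: power_powr_swap)
    finally show ?thesis .
  qed
  moreover have "0 \<le> (C + \<Lambda>) * M" using C M0 L0 by auto
  ultimately show ?thesis by blast
qed

text \<open>An argument of Borel-Cantelli type: weighting scale N by 2^(\<sigma>' N) leaves a
  convergent series of integrals, so the weighted sum is finite almost everywhere, and it bounds
  each of its terms.\<close>

lemma AE_majorant_decay:
  assumes D: "transversal D" and \<sigma>: "0 \<le> \<sigma>" "\<sigma> \<le> D" and M: "moment_bound q \<sigma> M" and \<sigma>': "\<sigma>' < \<sigma>"
  shows "AE a in lborel. a \<in> cball 0 \<rho> \<longrightarrow> (\<exists>K>0. \<forall>N. majorant q N a \<le> ennreal (K * ((1/2) ^ N) powr \<sigma>'))"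
proof -
  obtain C where C: "0 \<le> C" "\<And>N. (\<integral>\<^sup>+a\<in>cball 0 \<rho>. majorant q N a \<partial>lborel) \<le> ennreal (C * (real N + 1) powr q * ((1/2) powr \<sigma>) ^ N)"
    using nn_integral_majorant_le[OF D \<sigma> M] by blast
  have [measurable]: "cball (0::'a ^ 'm) \<rho> \<in> sets borel" by simp
  define \<theta> where "\<theta> = (1/2::real) powr (\<sigma> - \<sigma>')"
  have th: "0 < \<theta>" "\<theta> < 1" using \<sigma>' unfolding \<theta>_def by (auto intro!: powr_less_1)
  define c where "c N = (2 powr \<sigma>') ^ N" for N :: nat
  have c: "0 < c N" "((1/2) powr \<sigma>) ^ N * c N = \<theta> ^ N" "((1/2) ^ N) powr \<sigma>' * c N = 1" for N
  proof -
    show "0 < c N" by (simp add: c_def)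
    have "(1/2::real) powr s * 2 powr \<sigma>' = (1/2) powr (s - \<sigma>')" for s by (simp add: powr_divide powr_diff)
    then show "((1/2) powr \<sigma>) ^ N * c N = \<theta> ^ N" "((1/2) ^ N) powr \<sigma>' * c N = 1"
      by (simp_all add: c_def \<theta>_def power_mult_distrib[symmetric] power_powr_swap)
  qed
  define S where "S a = (\<Sum>N. majorant q N a * indicator (cball 0 \<rho>) a * ennreal (c N))" for a
  have [measurable]: "S \<in> borel_measurable lborel" unfolding S_def by measurable
  have "(\<integral>\<^sup>+a. S a \<partial>lborel) = (\<Sum>N. \<integral>\<^sup>+a. majorant q N a * indicator (cball 0 \<rho>) a * ennreal (c N) \<partial>lborel)"
    unfolding S_def by (rule nn_integral_suminf) measurable
  also have "\<dots> = (\<Sum>N. (\<integral>\<^sup>+a\<in>cball 0 \<rho>. majorant q N a \<partial>lborel) * ennreal (c N))"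
    by (intro suminf_cong nn_integral_multc) measurable
  also have "\<dots> \<le> (\<Sum>N. ennreal (C * ((real N + 1) powr q * \<theta> ^ N)))"
  proof (intro suminf_le summableI allI)
    fix N
    have "(\<integral>\<^sup>+a\<in>cball 0 \<rho>. majorant q N a \<partial>lborel) * ennreal (c N) \<le> ennreal (C * (real N + 1) powr q * ((1/2) powr \<sigma>) ^ N) * ennreal (c N)"
      by (rule mult_right_mono[OF C(2)]) simp
    also have "\<dots> = ennreal (C * ((real N + 1) powr q * \<theta> ^ N))"
      using C(1) c(1)[of N] by (simp add: ennreal_mult[symmetric] mult.assoc c(2)[symmetric])
    finally show "(\<integral>\<^sup>+a\<in>cball 0 \<rho>. majorant q N a \<partial>lborel) * ennreal (c N) \<le> ennreal (C * ((real N + 1) powr q * \<theta> ^ N))" .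
  qed
  also have "\<dots> = ennreal (\<Sum>N. C * ((real N + 1) powr q * \<theta> ^ N))"
    using C(1) th summable_poly_geometric[OF th] by (intro suminf_ennreal2) (auto intro: summable_mult)
  finally have "(\<integral>\<^sup>+a. S a \<partial>lborel) \<noteq> \<infinity>" by (auto simp: top_unique)
  then have "AE a in lborel. S a \<noteq> \<infinity>" by (intro nn_integral_PInf_AE) measurable
  then show ?thesis
  proof eventually_elim
    case (elim a)
    show ?case
    proof
      assume a: "a \<in> cball 0 \<rho>"
      obtain K where K: "S a = ennreal K" "0 \<le> K" using elim by (cases "S a") auto
      have "majorant q N a \<le> ennreal ((K + 1) * ((1/2) ^ N) powr \<sigma>')" for N
      proof -
        have "majorant q N a * indicator (cball 0 \<rho>) a * ennreal (c N) \<le> S a"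
          unfolding S_def using sum_le_suminf[OF summableI, of "{N}" "\<lambda>N. majorant q N a * indicator (cball 0 \<rho>) a * ennreal (c N)"] by simp
        then have "majorant q N a * ennreal (c N) \<le> ennreal K" using a K by simp
        then have "majorant q N a * ennreal (c N) * ennreal (((1/2) ^ N) powr \<sigma>') \<le> ennreal K * ennreal (((1/2) ^ N) powr \<sigma>')"
          by (rule mult_right_mono) simp
        moreover have "ennreal (c N) * ennreal (((1/2) ^ N) powr \<sigma>') = 1"
          using c(1,3)[of N] by (simp add: ennreal_mult[symmetric] mult.commute)
        ultimately have "majorant q N a \<le> ennreal K * ennreal (((1/2) ^ N) powr \<sigma>')" by (simp add: mult.assoc)
        also have "\<dots> = ennreal (K * ((1/2) ^ N) powr \<sigma>')" using K by (simp add: ennreal_mult)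
        also have "\<dots> \<le> ennreal ((K + 1) * ((1/2) ^ N) powr \<sigma>')" by (intro ennreal_leI mult_right_mono) auto
        finally show ?thesis .
      qed
      then show "\<exists>K>0. \<forall>N. majorant q N a \<le> ennreal (K * ((1/2) ^ N) powr \<sigma>')" using K(2) by (intro exI[of _ "K + 1"]) auto
    qed
  qed
qed

text \<open>The energy increases with the radius, so r may be rounded up to a power of 1/2, at the
  cost of a factor 2^\<sigma>.\<close>

lemma corr_decay_of_majorant:
  assumes q: "2 \<le> q" and K: "0 < K" "\<And>N. majorant q N a \<le> ennreal (K * ((1/2) ^ N) powr \<sigma>)" and \<sigma>: "0 \<le> \<sigma>"
  shows "corr_decay (sam a) q \<sigma>"
proof (rule corr_decayI[of "K * 2 powr \<sigma>" 1])
  interpret M: borel_prob "sam a" by (rule borel_prob_sam)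
  fix r :: real assume r: "0 < r" "r < 1"
  obtain k where k: "(1/2) ^ Suc k < r" "r \<le> (1/2) ^ k" using dyadic_scale[of r 0] r by auto
  have "corr_integral (sam a) q r \<le> corr_integral (sam a) q ((1/2) ^ k)" unfolding corr_integral_def
    using q k by (intro nn_integral_mono ennreal_leI powr_mono2 M.finite_measure_mono subset_cball) auto
  also have "\<dots> \<le> majorant q k a" by (rule corr_integral_le_majorant[OF q])
  also have "\<dots> \<le> ennreal (K * ((1/2) ^ k) powr \<sigma>)" by (rule K(2))
  also have "\<dots> \<le> ennreal (K * (2 * r) powr \<sigma>)"
    using k K \<sigma> by (intro ennreal_leI mult_left_mono powr_mono2) auto
  also have "\<dots> = ennreal (K * 2 powr \<sigma> * r powr \<sigma>)" using r by (simp add: powr_mult mult.assoc)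
  finally show "corr_integral (sam a) q r \<le> ennreal (K * 2 powr \<sigma> * r powr \<sigma>)" .
qed (use K in auto)

text \<open>The averaged estimates hold on one ball of translations at a time; countably many balls
  exhaust the parameter space.\<close>

lemma AE_corr_decay:
  assumes D: "transversal D" and q: "2 \<le> q" and \<sigma>: "\<sigma> \<le> D" and M: "moment_bound q \<sigma> M" and \<sigma>': "0 \<le> \<sigma>'" "\<sigma>' < \<sigma>"
  shows "AE a in lborel. corr_decay (sam a) q \<sigma>'"
proof -
  have "AE a in lborel. \<forall>k::nat. a \<in> cball 0 (real k) \<longrightarrow> (\<exists>K>0. \<forall>N. majorant q N a \<le> ennreal (K * ((1/2) ^ N) powr \<sigma>'))"
    unfolding AE_all_countable using \<sigma>' by (intro allI AE_majorant_decay[OF D _ \<sigma> M]) auto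
  then show ?thesis
  proof eventually_elim
    case (elim a)
    obtain k :: nat where "norm a \<le> real k" using real_arch_simple by blast
    then obtain K where "0 < K" "\<And>N. majorant q N a \<le> ennreal (K * ((1/2) ^ N) powr \<sigma>')" using elim by auto
    then show ?case using corr_decay_of_majorant[OF q _ _ \<sigma>'(1)] by blast
  qed
qed

end

section \<open>The spectrum\<close>

context affine_ifs
begin

text \<open>Collects what separates the general case (D = 1) from that of similitudes (D = d). With
  \<sigma> = (q - 1) s the constraint is the range \<sigma> <= D of transversality.\<close>

definition norm_regular :: "real \<Rightarrow> bool" where
  "norm_regular D \<longleftrightarrow> transversal D \<and>
     (\<forall>q s I. 2 \<le> q \<longrightarrow> 0 \<le> s \<longrightarrow> (q - 1) * s \<le> D \<longrightarrow> phi s I = onorm (W I) powr s)"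

lemma psum_norm_regular:
  assumes "norm_regular D" "2 \<le> q" "0 \<le> s" "(q - 1) * s \<le> D"
  shows "psum q s n = (\<Sum>I | length I = n. pw I powr q * onorm (W I) powr - ((q - 1) * s))"
  unfolding psum_def
proof (intro sum.cong refl)
  fix I
  have "phi s I = onorm (W I) powr s" using assms unfolding norm_regular_def by blast
  then show "phi s I powr (1 - q) * pw I powr q = pw I powr q * onorm (W I) powr - ((q - 1) * s)"
    by (simp add: powr_powr algebra_simps)
qed

lemma norm_regular_1: "norm_regular 1"
  unfolding norm_regular_def
proof (intro conjI allI impI transversal_1)
  fix q s :: real and I :: "'m list" assume h: "2 \<le> q" "0 \<le> s" "(q - 1) * s \<le> 1"
  have "1 * s \<le> (q - 1) * s" using h by (intro mult_right_mono) auto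
  then show "phi s I = onorm (W I) powr s"
    using h singular_values_W(3) by (intro sv_function_le_1[OF linear_W]) auto
qed

lemma norm_regular_similitude:
  assumes "\<And>i. similitude (T i)"
  shows "norm_regular (real DIM('a))"
proof -
  have "\<exists>c>0. \<forall>v. norm (T i v) = c * norm v" for i
  proof -
    obtain c where "c > 0" "\<And>x y. dist (T i x) (T i y) = c * dist x y" using assms[of i] unfolding similitude_def by blast
    then show ?thesis using linear_0[OF linear_T[of i]] by (metis dist_0_norm dist_commute)
  qed
  then obtain c where c: "\<And>i. 0 < c i" "\<And>i v. norm (T i v) = c i * norm v" by metis
  have cW: "0 < prod_list (map c I)" "norm (W I v) = prod_list (map c I) * norm v" for I v
    by (induction I) (auto simp: c)
  have on: "onorm (W I) = prod_list (map c I)" for I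
    by (rule sv_function_conformal(1)[OF linear_W cW, of 0]) simp
  have "phi s I = onorm (W I) powr s" if "0 \<le> s" for s I
    unfolding on by (rule sv_function_conformal(2)[OF linear_W cW that])
  moreover have "transversal (real DIM('a))" by (rule transversal_conformal) (simp add: on cW(2))
  ultimately show ?thesis by (simp add: norm_regular_def)
qed

section \<open>Lower bound for the spectrum, for almost every translation\<close>

lemma AE_Lq_spectrum_ge:
  assumes reg: "norm_regular D"
  shows "AE a in lborel. \<forall>q\<ge>2. tau q \<le> D \<longrightarrow> ereal (tau q) \<le> Lq_spectrum (sam a) q"
proof -
  \<comment> \<open>The side conditions stand inside the almost-everywhere statement, so that it can
    be intersected over all rational q and s.\<close>
  have "AE a in lborel. 2 \<le> q \<and> 0 \<le> s \<and> s < tau q \<and> tau q \<le> D \<longrightarrow> corr_decay (sam a) q s" for q s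
  proof (cases "2 \<le> q \<and> 0 \<le> s \<and> s < tau q \<and> tau q \<le> D")
    case True
    then obtain \<sigma> where \<sigma>: "s < \<sigma>" "\<sigma> < tau q" using dense by blast
    \<comment> \<open>The exponent of phi that corresponds to the decay rate \<sigma>; it stays
      strictly below the critical exponent.\<close>
    define u where "u = \<sigma> / (q - 1)"
    have u: "0 \<le> u" "(q - 1) * u = \<sigma>" using True \<sigma> by (auto simp: u_def)
    have "(q - 1) * u < (q - 1) * mdim q" using \<sigma> True u by (simp add: tau_eq)
    then have "u < sdim q" using True by simp
    then obtain C \<theta> where C: "0 < \<theta>" "\<theta> < 1" "\<And>n. psum q u n \<le> C * \<theta> ^ n"
      using less_sdim_iff[of q u] True u by auto
    have C0: "0 \<le> C" using C(3)[of 0] psum_nonneg[of q u 0] by simp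
    have "moment_bound q \<sigma> C" unfolding moment_bound_def
    proof
      fix n
      have "psum q u n \<le> C * 1" using C C0 by (intro order_trans[OF C(3)] mult_left_mono power_le_one) auto
      then show "(\<Sum>I | length I = n. pw I powr q * onorm (W I) powr - \<sigma>) \<le> C"
        using psum_norm_regular[OF reg, of q u n] True u \<sigma> by simp
    qed
    then have "AE a in lborel. corr_decay (sam a) q s"
      using reg True \<sigma> by (intro AE_corr_decay[where \<sigma> = \<sigma> and D = D and M = C]) (auto simp: norm_regular_def)
    then show ?thesis by eventually_elim simp
  next
    case False
    then show ?thesis by (intro AE_I2) blast
  qed
  then have "AE a in lborel. \<forall>q\<in>\<rat>. \<forall>s\<in>\<rat>. 2 \<le> q \<and> 0 \<le> s \<and> s < tau q \<and> tau q \<le> D \<longrightarrow> corr_decay (sam a) q s"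
    by (intro AE_ball_countable[THEN iffD2] countable_rat ballI)
  then show ?thesis
  proof eventually_elim
    case (elim a)
    interpret M: borel_prob "sam a" by (rule borel_prob_sam)
    show ?case
    proof (intro allI impI)
      fix q assume q: "2 \<le> q" and tD: "tau q \<le> D"
      have tpos: "0 < tau q" using q mdim_pos[of q] by (simp add: tau_eq)
      have le: "ereal y \<le> Lq_spectrum (sam a) q" if y: "0 \<le> y" "y < tau q" for y
      proof -
        \<comment> \<open>A rational q' in [2, q] with tau(q') still above y. For q = 2 only q' = 2
          is available; otherwise \<open>tau_scale\<close> gives tau(q') > y once q' exceeds 1 + y
          (q - 1) / tau(q).\<close>
        obtain q' where q': "q' \<in> \<rat>" "2 \<le> q'" "q' \<le> q" "y < tau q'"
        proof (cases "q = 2")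
          case True
          then show ?thesis using that[of q] y by auto
        next
          case False
          have "y * (q - 1) / tau q < q - 1"
            using y q tpos by (simp add: pos_divide_less_eq mult.commute)
          then have "max 2 (1 + y * (q - 1) / tau q) < q" using False q by auto
          from Rats_dense_in_real[OF this] obtain q' where q': "q' \<in> \<rat>" "2 < q'" "1 + y * (q - 1) / tau q < q'" "q' < q" by auto
          have "y < (q' - 1) / (q - 1) * tau q"
          proof -
            have "y * (q - 1) / tau q < q' - 1" using q'(3) by simp
            then have "y * (q - 1) < (q' - 1) * tau q" using tpos by (simp add: pos_divide_less_eq)
            then show ?thesis using q by (simp add: pos_less_divide_eq)
          qed
          also have "\<dots> \<le> tau q'" using q' by (intro tau_scale) auto
          finally show ?thesis using that[of q'] q' by auto
        qed
        obtain s where s: "s \<in> \<rat>" "y < s" "s < tau q'" using Rats_dense_in_real[OF q'(4)] by blast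
        have "tau q' \<le> D" using tau_mono[of q' q] q' tD by simp
        then have "corr_decay (sam a) q' s" using elim q' s y by auto
        then have "corr_decay (sam a) q s" using q' by (intro M.corr_decay_mono[of q' q]) auto
        then have "ereal s \<le> Lq_spectrum (sam a) q" using q by (intro M.Lq_spectrum_ge) auto
        moreover have "ereal y \<le> ereal s" using s by simp
        ultimately show ?thesis by (rule order_trans[rotated])
      qed
      show "ereal (tau q) \<le> Lq_spectrum (sam a) q"
      proof (rule dense_le)
        fix z assume z: "z < ereal (tau q)"
        show "z \<le> Lq_spectrum (sam a) q"
        proof (cases "0 \<le> z")
          case True
          then obtain y where "z = ereal y" using z by (cases z) auto
          then show ?thesis using le[of y] z True by simp
        next
          case False
          then show ?thesis using le[of 0] tpos by (simp add: zero_ereal_def[symmetric])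
        qed
      qed
    qed
  qed
qed

section \<open>Upper bound for the spectrum, for every translation\<close>

lemma corr_decay_global:
  assumes "corr_decay (sam a) q t" "1 \<le> q" "0 \<le> t"
  shows "\<exists>C>0. \<forall>r>0. corr_integral (sam a) q r \<le> ennreal (C * r powr t)"
proof -
  interpret M: borel_prob "sam a" by (rule borel_prob_sam)
  obtain C r0 where C: "0 < C" "0 < r0" "\<And>r. 0 < r \<Longrightarrow> r < r0 \<Longrightarrow> corr_integral (sam a) q r \<le> ennreal (C * r powr t)"
    using assms(1) unfolding corr_decay_def by blast
  have "corr_integral (sam a) q r \<le> ennreal ((C + r0 powr - t) * r powr t)" if r: "0 < r" for r
  proof (cases "r < r0")
    case True
    have "C * r powr t \<le> (C + r0 powr - t) * r powr t" by (intro mult_right_mono) auto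
    then show ?thesis using C(3)[OF r True] by (meson ennreal_leI order_trans)
  next
    case False
    \<comment> \<open>From r0 on the energy is at most 1, while (r / r0)^t >= 1 because t >=
      0.\<close>
    then have "1 \<le> r0 powr - t * r powr t" using C r assms(3) powr_mono2[of t r0 r] by (simp add: powr_minus field_simps)
    also have "\<dots> \<le> (C + r0 powr - t) * r powr t" using C by (intro mult_right_mono) auto
    finally have "ennreal 1 \<le> ennreal ((C + r0 powr - t) * r powr t)" by (rule ennreal_leI)
    then show ?thesis using M.corr_integral_le_1[OF assms(2), of r] by (metis ennreal_1 order_trans)
  qed
  then show ?thesis using C by (intro exI[of _ "C + r0 powr - t"]) (auto intro: add_pos_nonneg)
qed

text \<open>A cylinder of diameter about \<open>2\<^sup>-\<^sup>k\<close> lies in one ball of that radius around each of its points, so its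
  contribution is dominated by the energy at scale \<open>2\<^sup>-\<^sup>k\<close>; no covering of images of balls is needed.\<close>

lemma moment_decay_of_corr:
  assumes q: "1 < q" and t: "0 \<le> \<tau>" "\<tau> < t" and C: "0 < C" "\<And>r. 0 < r \<Longrightarrow> corr_integral (sam a) q r \<le> ennreal (C * r powr t)"
  shows "\<exists>K \<theta>. 0 < \<theta> \<and> \<theta> < 1 \<and> (\<forall>n. (\<Sum>I | length I = n. pw I powr q * onorm (W I) powr - \<tau>) \<le> K * \<theta> ^ n)"
proof -
  interpret M: borel_prob "sam a" by (rule borel_prob_sam)
  \<comment> \<open>4 |a| bounds the distance of two coded points; the \<open>+ 1\<close> makes R
    positive also for a = 0.\<close>
  define R where "R = 4 * norm a + 1"
  have R: "0 < R" by (simp add: R_def add_nonneg_pos)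
  define \<theta> where "\<theta> = (1/2::real) powr (t - \<tau>)"
  have th: "0 < \<theta>" "\<theta> < 1" using t unfolding \<theta>_def by (auto intro!: powr_less_1)
  define A where "A = C * R powr t * 2 powr \<tau>"
  have A: "0 \<le> A" using C by (simp add: A_def)
  \<comment> \<open>The energy density at radius R 2^-k times a bound for the power -\<tau> of any
    norm exceeding 2^-(k+1).\<close>
  define G where "G k \<omega> = ennreal (((1/2) ^ Suc k) powr - \<tau>) * ennreal (M.prob (cball (coding a \<omega>) (R * (1/2) ^ k)) powr (q - 1))" for k \<omega>
  have [measurable]: "G k \<in> borel_measurable bernoulli" for k unfolding G_def by measurable
  have Gint: "(\<integral>\<^sup>+\<omega>. G k \<omega> \<partial>bernoulli) \<le> ennreal (A * \<theta> ^ k)" for k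
  proof -
    have "(\<integral>\<^sup>+\<omega>. G k \<omega> \<partial>bernoulli) = ennreal (((1/2) ^ Suc k) powr - \<tau>) * corr_integral (sam a) q (R * (1/2) ^ k)"
      unfolding G_def corr_integral_def by (subst nn_integral_cmult, measurable, subst nn_integral_sam, measurable)
    also have "\<dots> \<le> ennreal (((1/2) ^ Suc k) powr - \<tau>) * ennreal (C * (R * (1/2) ^ k) powr t)"
      using R by (intro mult_left_mono C(2)) auto
    also have "\<dots> = ennreal (A * \<theta> ^ k)"
    proof -
      have "((1/2::real) ^ Suc k) powr - \<tau> * (C * (R * (1/2) ^ k) powr t) = A * \<theta> ^ k"
      proof -
        have 1: "((1/2::real) ^ Suc k) powr - \<tau> = 2 powr \<tau> * ((1/2) powr - \<tau>) ^ k"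
          by (subst power_powr_swap) (auto simp: powr_minus powr_divide)
        have 2: "(R * (1/2) ^ k) powr t = R powr t * ((1/2) powr t) ^ k" using R by (simp add: powr_mult power_powr_swap)
        have 3: "((1/2::real) powr - \<tau>) ^ k * ((1/2) powr t) ^ k = \<theta> ^ k"
          unfolding power_mult_distrib[symmetric] powr_add[symmetric] \<theta>_def by simp
        show ?thesis unfolding 1 2 3[symmetric] A_def by (simp add: mult_ac)
      qed
      then show ?thesis using C(1) by (simp add: ennreal_mult[symmetric])
    qed
    finally show ?thesis .
  qed
  have "(\<Sum>I | length I = n. pw I powr q * onorm (W I) powr - \<tau>) \<le> A / (1 - \<theta>) * \<theta> ^ n" for n
  proof -
    define f where "f I = ennreal (pw I powr (q - 1) * onorm (W I) powr - \<tau>)" for I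
    have "ennreal (\<Sum>I | length I = n. pw I powr q * onorm (W I) powr - \<tau>) = (\<Sum>I | length I = n. ennreal (pw I) * f I)"
    proof -
      have "pw I * pw I powr (q - 1) = pw I powr q" for I using powr_add[of "pw I" 1 "q - 1"] pw_pos[of I] by simp
      then have "ennreal (pw I) * f I = ennreal (pw I powr q * onorm (W I) powr - \<tau>)" for I
        unfolding f_def using pw_pos[of I] by (simp add: ennreal_mult[symmetric] less_imp_le mult.assoc[symmetric])
      then show ?thesis by (simp add: sum_ennreal)
    qed
    also have "\<dots> = (\<integral>\<^sup>+\<omega>. f (stake n \<omega>) \<partial>bernoulli)" by (rule nn_integral_bernoulli_stake[symmetric])
    \<comment> \<open>The scale k depends on the word. Summing over all k >= n avoids sorting words
      by norm and costs only the factor 1 / (1 - \<theta>).\<close>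
    also have "\<dots> \<le> (\<integral>\<^sup>+\<omega>. (\<Sum>k. G (k + n) \<omega>) \<partial>bernoulli)"
    proof (intro nn_integral_mono)
      fix \<omega> :: "'m stream"
      define I where "I = stake n \<omega>"
      obtain k where k: "n \<le> k" "(1/2) ^ Suc k < onorm (W I)" "onorm (W I) \<le> (1/2) ^ k"
        using dyadic_scale[OF onorm_W_pos[of I], of n] onorm_W_le[of I] by (auto simp: I_def)
      have "pw I \<le> M.prob (cball (coding a \<omega>) (R * (1/2) ^ k))"
      proof -
        have "dist (coding a \<omega>) (coding a \<omega>') \<le> R * (1/2) ^ k" if "stake n \<omega>' = stake n \<omega>" for \<omega>'
        proof -
          have "\<omega> = I @- sdrop n \<omega>" "\<omega>' = I @- sdrop n \<omega>'" using stake_sdrop[of n \<omega>'] that by (simp_all add: I_def stake_sdrop)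
          then have "dist (coding a \<omega>) (coding a \<omega>') = norm (W I (coding a (sdrop n \<omega>) - coding a (sdrop n \<omega>')))"
            unfolding dist_norm using coding_shift_diff by metis
          also have "\<dots> \<le> onorm (W I) * norm (coding a (sdrop n \<omega>) - coding a (sdrop n \<omega>'))" by (rule onorm[OF bounded_linear_W])
          also have "\<dots> \<le> (1/2) ^ k * R"
          proof (intro mult_mono k(3))
            show "norm (coding a (sdrop n \<omega>) - coding a (sdrop n \<omega>')) \<le> R"
              using norm_triangle_ineq4[of "coding a (sdrop n \<omega>)" "coding a (sdrop n \<omega>')"] norm_coding[of a "sdrop n \<omega>"] norm_coding[of a "sdrop n \<omega>'"]
              by (simp add: R_def)
          qed auto
          finally show ?thesis by (simp add: mult.commute)
        qed
        then have "B.prob {\<omega>'. stake n \<omega>' = stake n \<omega>} \<le> B.prob {\<omega>'. dist (coding a \<omega>) (coding a \<omega>') \<le> R * (1/2) ^ k}"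
        proof (intro B.finite_measure_mono)
          have "Measurable.pred bernoulli (\<lambda>\<omega>'. dist (coding a \<omega>) (coding a \<omega>') \<le> R * (1/2) ^ k)" by measurable
          then show "{\<omega>'. dist (coding a \<omega>) (coding a \<omega>') \<le> R * (1/2) ^ k} \<in> B.events" by (simp add: pred_def)
        qed auto
        then show ?thesis by (simp add: prob_sam_cball prob_cylinder I_def)
      qed
      then have "pw I powr (q - 1) * onorm (W I) powr - \<tau> \<le> M.prob (cball (coding a \<omega>) (R * (1/2) ^ k)) powr (q - 1) * ((1/2) ^ Suc k) powr - \<tau>"
        using k q t pw_pos[of I] by (intro mult_mono powr_mono2 powr_mono2') auto
      then have "f I \<le> G k \<omega>" unfolding f_def G_def by (subst ennreal_mult[symmetric]) (auto simp: mult.commute intro: ennreal_leI)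
      also have "\<dots> \<le> (\<Sum>k. G (k + n) \<omega>)"
        using sum_le_suminf[OF summableI, of "{k - n}" "\<lambda>k. G (k + n) \<omega>"] k(1) by simp
      finally show "f (stake n \<omega>) \<le> (\<Sum>k. G (k + n) \<omega>)" by (simp add: I_def)
    qed
    also have "\<dots> = (\<Sum>k. \<integral>\<^sup>+\<omega>. G (k + n) \<omega> \<partial>bernoulli)" by (rule nn_integral_suminf) measurable
    also have "\<dots> \<le> (\<Sum>k. ennreal (A * \<theta> ^ n * \<theta> ^ k))"
      by (intro suminf_le summableI allI order_trans[OF Gint]) (simp add: power_add mult_ac)
    also have "\<dots> = ennreal (\<Sum>k. A * \<theta> ^ n * \<theta> ^ k)"
      using A th by (intro suminf_ennreal2) (auto intro!: summable_mult summable_geometric)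
    also have "(\<Sum>k. A * \<theta> ^ n * \<theta> ^ k) = A / (1 - \<theta>) * \<theta> ^ n"
      using th suminf_mult[OF summable_geometric[of \<theta>], of "A * \<theta> ^ n"] suminf_geometric[of \<theta>] by simp
    finally show ?thesis using A th by (subst (asm) ennreal_le_iff) auto
  qed
  then show ?thesis using th by blast
qed

lemma Lq_spectrum_le:
  assumes reg: "norm_regular D" and q: "2 \<le> q" "tau q \<le> D"
  shows "Lq_spectrum (sam a) q \<le> ereal (tau q)"
proof (rule ccontr)
  interpret M: borel_prob "sam a" by (rule borel_prob_sam)
  assume "\<not> Lq_spectrum (sam a) q \<le> ereal (tau q)"
  then obtain t where t: "ereal (tau q) < t" "t < Lq_spectrum (sam a) q" using dense by (metis not_le)
  then obtain t' where t': "t = ereal t'" by (cases t) auto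
  have tt: "tau q < t'" using t t' by simp
  have tau0: "0 < tau q" using q mdim_pos[of q] by (simp add: tau_eq)
  have dec: "corr_decay (sam a) q t'" using M.corr_decay_of_less_Lq[OF _ _ support_sam] t t' q by simp
  have q1: "1 < q" using q by simp
  \<comment> \<open>Together with tau(q) < t' this makes the cap d inactive, so that tau(q) / (q -
    1) is the critical exponent \<open>sdim q\<close>.\<close>
  have "t' \<le> (q - 1) * real DIM('a)" using M.corr_decay_upper[OF q1 dec support_sam] by (simp add: mult.commute)
  then have "(q - 1) * mdim q < (q - 1) * real DIM('a)" using less_le_trans[OF tt] unfolding tau_eq[OF q1] by blast
  then have "mdim q < real DIM('a)" using q by (simp only: mult_less_cancel_left_pos)
  then have md: "mdim q = sdim q" by auto
  then have tau: "tau q = (q - 1) * sdim q" using q by (simp add: tau_eq)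
  obtain C where C: "0 < C" "\<And>r. 0 < r \<Longrightarrow> corr_integral (sam a) q r \<le> ennreal (C * r powr t')"
    using corr_decay_global[OF dec] q tt tau0 by auto
  have s0: "0 \<le> sdim q" using sdim_pos[of q] q by simp
  have "\<exists>K \<theta>. 0 < \<theta> \<and> \<theta> < 1 \<and> (\<forall>n. psum q (sdim q) n \<le> K * \<theta> ^ n)"
    using moment_decay_of_corr[OF _ _ tt C] q tau0 psum_norm_regular[OF reg q(1) s0] by (simp add: tau)
  then have "sdim q < sdim q" using less_sdim_iff[of q "sdim q"] q s0 by simp
  then show False by simp
qed

lemma AE_Lq_spectrum_eq:
  assumes reg: "norm_regular D"
  shows "AE a in lebesgue. \<forall>q\<ge>2. tau q \<le> D \<longrightarrow> Lq_spectrum (self_affine_measure T p a) q = ereal (tau q)"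
proof -
  have "AE a in lborel. \<forall>q\<ge>2. tau q \<le> D \<longrightarrow> Lq_spectrum (self_affine_measure T p a) q = ereal (tau q)"
    using AE_Lq_spectrum_ge[OF reg]
    by eventually_elim (auto simp: self_affine_measure_eq intro!: antisym Lq_spectrum_le[OF reg])
  then show ?thesis by (rule AE_completion)
qed

end

theorem theorem6p2:
  fixes T :: "'m::finite \<Rightarrow> real ^ 'd \<Rightarrow> real ^ 'd"
    and p :: "'m \<Rightarrow> real"
  assumes "2 \<le> CARD('m)"
    and "\<And>i. linear (T i)"
    and "\<And>i. bij (T i)"
    and "\<And>i. onorm (T i) < 1 / 2"
    and "\<And>i. 0 < p i"
    and "(\<Sum>i\<in>UNIV. p i) = 1"
  shows
    "(AE a in (lebesgue :: (real ^ 'd ^ 'm) measure). \<forall>q\<in>q_interval T p.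
        Lq_spectrum (self_affine_measure T p a) q = ereal (tau_fun T p q)) \<and>
     (\<exists>\<tau>'. (tau_fun T p has_real_derivative \<tau>') (at_right 1) \<and>
        (\<tau>' \<le> 1 \<and> (CARD('d) = 1 \<and> \<tau>' = 1 \<longrightarrow> D_fun T p 2 \<le> 1) \<longrightarrow>
           q_interval T p \<noteq> {} \<and> is_interval (q_interval T p) \<and>
           {2..1 + 1 / \<tau>'} \<subseteq> q_interval T p)) \<and>
     ((\<forall>i. similitude (T i)) \<longrightarrow>
        (AE a in (lebesgue :: (real ^ 'd ^ 'm) measure).
          \<forall>q\<in>{2..(GREATEST q. 0 \<le> q \<and> tau_fun T p q \<le> real CARD('d))}.
            Lq_spectrum (self_affine_measure T p a) q = ereal (tau_fun T p q)))"
proof -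
  interpret affine_ifs T p by (rule affine_ifs.intro[OF assms])
  have dim: "DIM(real ^ 'd) = CARD('d)" by simp
  show ?thesis
  proof (intro conjI impI)
    show "AE a in lebesgue. \<forall>q\<in>q_interval T p. Lq_spectrum (self_affine_measure T p a) q = ereal (tau_fun T p q)"
      using AE_Lq_spectrum_eq[OF norm_regular_1]
      by (rule AE_mp) (auto intro!: AE_I2 dest: q_interval_tau)
    obtain \<tau>' where \<tau>': "(tau_fun T p has_real_derivative \<tau>') (at_right 1)" "0 < \<tau>'" "\<And>q. 1 < q \<Longrightarrow> mdim q \<le> \<tau>'"
      using right_derivative_tau by blast
    show "\<exists>\<tau>'. (tau_fun T p has_real_derivative \<tau>') (at_right 1) \<and>
        (\<tau>' \<le> 1 \<and> (CARD('d) = 1 \<and> \<tau>' = 1 \<longrightarrow> D_fun T p 2 \<le> 1) \<longrightarrow>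
           q_interval T p \<noteq> {} \<and> is_interval (q_interval T p) \<and> {2..1 + 1 / \<tau>'} \<subseteq> q_interval T p)"
      using \<tau>'(1) q_interval_contains[OF \<tau>'(2,3)] by (intro exI[of _ \<tau>']) (auto simp: dim)
    assume "\<forall>i. similitude (T i)"
    then have reg: "norm_regular (real DIM(real ^ 'd))" by (intro norm_regular_similitude) simp
    show "AE a in lebesgue. \<forall>q\<in>{2..(GREATEST q. 0 \<le> q \<and> tau_fun T p q \<le> real CARD('d))}.
            Lq_spectrum (self_affine_measure T p a) q = ereal (tau_fun T p q)"
      using AE_Lq_spectrum_eq[OF reg]
      by (rule AE_mp) (auto intro!: AE_I2 Greatest_tau[unfolded dim] simp: dim)
  qed
qed

end
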